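(* Let $n$ be a positive integer and let $\lambda\in[0,n]$. Then there exists an entire function $A$ of order $\rho(A)=n$ such that, for two normalized solutions $f_1$ and $f_2$ of the differential equation $f''+Af=0$, the associated Bank--Laine function $E=f_1f_2$ satisfies $\lambda(f_1)=\lambda$ and $\lambda(f_2)=\infty$. Moreover, the Bank--Laine function $E_c=f_1(cf_1+f_2)$ satisfies $\lambda(E_c)=\infty$ for any constant $c\in\mathbb{C}$.
   Context: For an entire function $A$, all solutions of $f''+Af=0$ on $\mathbb{C}$ are entire. Two linearly independent solutions $f_1,f_2$ of $f''+Af=0$ are called normalized if their Wronskian satisfies $f_1f_2'-f_1'f_2=1$. An entire function $E$ is a Bank--Laine function if $E(z)=0$ implies $E'(z)=1$ or $E'(z)=-1$; the product $E=f_1f_2$ of two normalized solutions is a Bank--Laine function. For an entire function $f$, $\rho(f)=\limsup_{r\to\infty}\frac{\log^+ T(r,f)}{\log r}$ is the order ($T(r,f)$ being the Nevanlinna characteristic), and $\lambda(f)=\limsup_{r\to\infty}\frac{\log^+ n(r,0,f)}{\log r}$ is the exponent of convergence of the zeros, where $n(r,0,f)$ is the number of zeros of $f$ in $|z|\le r$, counted with multiplicity. *)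

theory Defs
  imports "HOL-Complex_Analysis.Complex_Analysis"
begin

definition log_plus :: "real \<Rightarrow> real" where
  "log_plus x = ln (max 1 x)"

definition proximity :: "(complex \<Rightarrow> complex) \<Rightarrow> real \<Rightarrow> real" where
  "proximity f r = integral {0..2 * pi} (\<lambda>t. log_plus (cmod (f (of_real r * cis t)))) / (2 * pi)"

definition pole_count :: "(complex \<Rightarrow> complex) \<Rightarrow> real \<Rightarrow> nat" where
  "pole_count f r = (\<Sum>z | cmod z \<le> r \<and> is_pole f z. nat (- zorder f z))"

definition integrated_pole_count :: "(complex \<Rightarrow> complex) \<Rightarrow> real \<Rightarrow> real" where
  "integrated_pole_count f r =
     integral {0..r} (\<lambda>t. (real (pole_count f t) - real (pole_count f 0)) / t)
     + real (pole_count f 0) * ln r"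

text \<open>The Nevanlinna characteristic $T(r,f) = m(r,f) + N(r,f)$. It is defined for meromorphic
  functions; for entire functions the term $N(r,f)$ vanishes.\<close>

definition nevanlinna_T :: "(complex \<Rightarrow> complex) \<Rightarrow> real \<Rightarrow> real" where
  "nevanlinna_T f r = proximity f r + integrated_pole_count f r"

definition growth_order :: "(complex \<Rightarrow> complex) \<Rightarrow> ereal" where
  "growth_order f = Limsup at_top (\<lambda>r::real. ereal (log_plus (nevanlinna_T f r) / ln r))"

text \<open>Zeros are counted with multiplicity. The count is meaningful only if \<open>f\<close> is entire and not
  identically zero: then the index set is finite and \<open>zorder\<close> is the (positive) multiplicity.\<close>

definition zero_count :: "(complex \<Rightarrow> complex) \<Rightarrow> real \<Rightarrow> nat" where
  "zero_count f r = (\<Sum>z | cmod z \<le> r \<and> f z = 0. nat (zorder f z))"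

definition zero_exponent :: "(complex \<Rightarrow> complex) \<Rightarrow> ereal" where
  "zero_exponent f = Limsup at_top (\<lambda>r::real. ereal (log_plus (real (zero_count f r)) / ln r))"

definition solves :: "(complex \<Rightarrow> complex) \<Rightarrow> (complex \<Rightarrow> complex) \<Rightarrow> bool" where
  "solves A f \<longleftrightarrow> f holomorphic_on UNIV \<and> (\<forall>z. deriv (deriv f) z + A z * f z = 0)"

definition normalized_solutions ::
    "(complex \<Rightarrow> complex) \<Rightarrow> (complex \<Rightarrow> complex) \<Rightarrow> (complex \<Rightarrow> complex) \<Rightarrow> bool" where
  "normalized_solutions A f1 f2 \<longleftrightarrow>
     solves A f1 \<and> solves A f2 \<and>
     (\<forall>a b::complex. (\<forall>z. a * f1 z + b * f2 z = 0) \<longrightarrow> a = 0 \<and> b = 0) \<and>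
     (\<forall>z. f1 z * deriv f2 z - deriv f1 z * f2 z = 1)"

definition bank_laine :: "(complex \<Rightarrow> complex) \<Rightarrow> bool" where
  "bank_laine E \<longleftrightarrow>
     E holomorphic_on UNIV \<and> (\<forall>z. E z = 0 \<longrightarrow> deriv E z = 1 \<or> deriv E z = -1)"

end

theory Submission
  imports Defs
begin

text \<open>
  The coefficient \<open>A\<close> is found through the logarithmic derivative \<open>\<psi> = f\<^sub>1' / f\<^sub>1\<close>, because
  \<open>A = - (\<psi>' + \<psi>\<^sup>2)\<close>. If every pole \<open>b\<close> of a meromorphic function \<open>\<psi>\<close> satisfies
  \<open>\<psi>(z) = 1 / (z - b) + O(z - b)\<close>, then the singularities cancel in \<open>\<psi>' + \<psi>\<^sup>2\<close>, so that \<open>A\<close> is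
  entire and \<open>\<psi>\<close> is the logarithmic derivative of an entire solution with simple zeros at the
  poles of \<open>\<psi>\<close> (\<open>logarithmic_derivative_realization\<close>). A second solution \<open>f\<^sub>2\<close> is given by a power
  series (\<open>entire_linear_ode_solution\<close>).

  Such a \<open>\<psi>\<close> is the limit of a recursion that adds the \<open>N\<^sub>k\<close> roots of
  \<open>z ^ N\<^sub>k = R\<^sub>k ^ N\<^sub>k\<close> as new poles in step \<open>k\<close>:
  \<open>\<psi>\<^sub>k\<^sub>+\<^sub>1 = (1 - U)\<^sup>2 \<psi>\<^sub>k + (1 - (1 - U)\<^sup>2) \<eta>\<^sub>k\<close>, where \<open>\<eta>\<^sub>k\<close> is an explicit function with the right
  poles at the new points. The polynomial \<open>U\<close> is \<open>1\<close> at the new points and vanishes to second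
  order at the old ones, so \<open>\<psi>\<^sub>k\<^sub>+\<^sub>1\<close> behaves like \<open>\<eta>\<^sub>k\<close> near the former and like \<open>\<psi>\<^sub>k\<close> near the
  latter. It contains the factor \<open>(z / R\<^sub>k) ^ d\<^sub>k\<close> with \<open>d\<^sub>k = R\<^sub>k ^ n\<close>: for \<open>\<bar>z\<bar> \<le> R\<^sub>k / 2\<close> the step
  changes almost nothing, and between \<open>2 R\<^sub>k\<close> and \<open>R\<^sub>k\<^sub>+\<^sub>1 / 2\<close> it makes \<open>\<psi>\<close> at least \<open>4 ^ d\<^sub>k\<close>
  (\<open>\<delta>_bound\<close>, \<open>\<psi>_annulus\<close>). The radii grow so fast that everything from earlier steps is
  negligible at radius \<open>R\<^sub>k\<close>. With \<open>N\<^sub>k\<close> of the size of \<open>R\<^sub>k\<close> to the power \<open>l\<close>, the zeros of \<open>f\<^sub>1\<close> have exponent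
  \<open>l\<close>. In the same wide annuli the function \<open>1 / \<psi>\<close> is tiny, and so is its
  derivative; hence \<open>A = \<psi>\<^sup>2 ((1 / \<psi>)' - 1)\<close> has the size of \<open>\<psi>\<^sup>2\<close> there and its order is \<open>n\<close>.

  It remains to see that \<open>E = f\<^sub>1 (c f\<^sub>1 + f\<^sub>2)\<close> has infinite exponent for every \<open>c\<close>. Since the
  Wronskian is \<open>1\<close>, \<open>E' = 1 + 2 \<psi> E\<close>. Suppose that the zeros of \<open>E\<close> had finite exponent. On a disc of
  radius \<open>3 R\<close> write \<open>E = p exp(- W)\<close>, where \<open>p\<close> is the polynomial of the zeros of \<open>E\<close> in the disc; then
  \<open>exp W = p' - p W' - 2 \<psi> p\<close> in the annulus between \<open>R\<close> and \<open>3 R\<close>. If \<open>Re W\<close> exceeded a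
  certain bound of polynomial growth in \<open>R\<close>, this identity at the maximum points of \<open>Re W\<close> on
  circles would force \<open>Re W\<close> to become infinite within distance \<open>1\<close> (\<open>Re_bound_from_derivative_inequality\<close>). So \<open>W'\<close> is
  polynomially bounded, whereas \<open>\<psi>\<close> is exponentially large, and \<open>1 / E = p' / p - W' - 2 \<psi>\<close> makes \<open>E\<close>
  exponentially small on a circle that stays away from the zeros of \<open>p\<close>. By the maximum principle
  \<open>E\<close> is small at every fixed point, and \<open>R \<rightarrow> \<infinity>\<close> gives \<open>E = 0\<close>, which is absurd
  (\<open>riccati_zeros_not_polynomially_bounded\<close>). As the zeros of \<open>f\<^sub>1 f\<^sub>2\<close> are those of \<open>f\<^sub>1\<close> and of \<open>f\<^sub>2\<close>, and the
  former have exponent \<open>l\<close>, the exponent of \<open>f\<^sub>2\<close> is infinite as well.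
\<close>

section \<open>Orders of growth\<close>

text \<open>
  This computes both the order of \<open>A\<close> and the exponent of the zeros of \<open>f\<^sub>1\<close>. The factor
  \<open>(ln x)\<^sup>2\<close> leaves room for logarithmic losses in upper bounds, and for an upper limit a
  lower bound along one sequence is enough.
\<close>

lemma Limsup_log_ratio_eqI:
  fixes g :: "real \<Rightarrow> real" and r :: "nat \<Rightarrow> real"
  assumes a: "a \<ge> 0" and "C > 0" "c > 0"
    and upper: "eventually (\<lambda>x. g x \<le> C * x powr a * (ln x)^2) at_top"
    and r: "filterlim r at_top sequentially"
    and lower: "eventually (\<lambda>k. g (r k) \<ge> c * r k powr a) sequentially"
  shows "Limsup at_top (\<lambda>x. ereal (log_plus (g x) / ln x)) = ereal a"
proof (rule antisym)
  define u where "u = (\<lambda>x::real. (\<bar>ln C\<bar> + a * ln x + 2 * ln (ln x)) / ln x)"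
  have u: "(u \<longlongrightarrow> a) at_top"
    unfolding u_def by real_asymp
  have ev: "eventually (\<lambda>x. log_plus (g x) / ln x \<le> u x) at_top"
    using upper eventually_gt_at_top[of "exp 1"]
  proof eventually_elim
    case (elim x)
    have x: "ln x > 1" "x > 1"
      using elim(2) by (metis exp_gt_zero ln_exp ln_less_cancel_iff order.strict_trans)
        (use elim(2) in \<open>metis exp_ge_add_one_self less_numeral_extra(1) one_less_exp_iff order.strict_trans\<close>)
    have "max 1 (g x) \<le> exp \<bar>ln C\<bar> * x powr a * (ln x)^2"
    proof (rule max.boundedI)
      have 1: "exp \<bar>ln C\<bar> \<ge> 1" by simp
      have 2: "x powr a \<ge> 1" using x a by (simp add: ge_one_powr_ge_zero)
      have 3: "(ln x)^2 \<ge> 1" using x by (simp add: one_le_power)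
      show "1 \<le> exp \<bar>ln C\<bar> * x powr a * (ln x)^2"
        using mult_mono[OF mult_mono[OF 1 2] 3] by simp
      have "C \<le> exp \<bar>ln C\<bar>" using \<open>C > 0\<close>
        by (metis abs_ge_self exp_le_cancel_iff exp_ln)
      hence "C * x powr a * (ln x)^2 \<le> exp \<bar>ln C\<bar> * x powr a * (ln x)^2"
        by (intro mult_right_mono) auto
      with elim(1) show "g x \<le> exp \<bar>ln C\<bar> * x powr a * (ln x)^2" by linarith
    qed
    hence "log_plus (g x) \<le> ln (exp \<bar>ln C\<bar> * x powr a * (ln x)^2)"
      unfolding log_plus_def by (intro ln_mono) auto
    also have "\<dots> = \<bar>ln C\<bar> + a * ln x + 2 * ln (ln x)"
      using x by (simp add: ln_mult ln_realpow)
    finally show ?case unfolding u_def using x by (simp add: divide_right_mono)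
  qed
  show "Limsup at_top (\<lambda>x. ereal (log_plus (g x) / ln x)) \<le> ereal a"
  proof -
    have "Limsup at_top (\<lambda>x. ereal (log_plus (g x) / ln x)) \<le> Limsup at_top (\<lambda>x. ereal (u x))"
      by (intro Limsup_mono) (use ev in \<open>auto elim: eventually_mono\<close>)
    also have "\<dots> = ereal a"
      by (intro lim_imp_Limsup tendsto_ereal u) auto
    finally show ?thesis .
  qed
next
  define v where "v = (\<lambda>x::real. (ln c + a * ln x) / ln x)"
  have v: "(v \<longlongrightarrow> a) at_top"
    unfolding v_def by real_asymp
  have ev: "eventually (\<lambda>k. v (r k) \<le> log_plus (g (r k)) / ln (r k)) sequentially"
    using lower filterlim_at_top_dense[THEN iffD1, OF r, rule_format, of 1]
  proof eventually_elim
    case (elim k)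
    have "ln c + a * ln (r k) = ln (c * r k powr a)"
      using elim \<open>c > 0\<close> by (simp add: ln_mult)
    also have "\<dots> \<le> log_plus (g (r k))"
      unfolding log_plus_def using elim \<open>c > 0\<close> by (intro ln_mono) auto
    finally show ?case unfolding v_def using elim by (simp add: divide_right_mono)
  qed
  have "ereal a = Limsup sequentially (\<lambda>k. ereal (v (r k)))"
    by (intro lim_imp_Limsup[symmetric] tendsto_ereal filterlim_compose[OF v r]) auto
  also have "\<dots> \<le> Limsup sequentially (\<lambda>k. ereal (log_plus (g (r k)) / ln (r k)))"
    by (intro Limsup_mono) (use ev in \<open>auto elim: eventually_mono\<close>)
  also have "\<dots> \<le> Limsup (filtermap r sequentially) (\<lambda>x. ereal (log_plus (g x) / ln x))"
    by (rule Limsup_filtermap_ge)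
  also have "\<dots> \<le> Limsup at_top (\<lambda>x. ereal (log_plus (g x) / ln x))"
    using r unfolding filterlim_def Limsup_def
    by (intro INF_superset_mono) (auto simp: le_filter_def)
  finally show "ereal a \<le> Limsup at_top (\<lambda>x. ereal (log_plus (g x) / ln x))" .
qed

section \<open>The inequality of Borel and Caratheodory\<close>

text \<open>
  The map \<open>w \<mapsto> w / (2 b - w)\<close> sends the half-plane \<open>Re w < b\<close> into the unit disc, so the Schwarz lemma
  applies to its composition with \<open>f - f c\<close>. The strict bound needed for this is available for
  every \<open>b > B - Re (f c)\<close>; the inequality itself follows when \<open>b\<close> tends to \<open>B - Re (f c)\<close>.
\<close>

lemma borel_caratheodory:
  fixes f :: "complex \<Rightarrow> complex"
  assumes holo: "f holomorphic_on ball c \<rho>" and B: "\<And>z. z \<in> ball c \<rho> \<Longrightarrow> Re (f z) \<le> B"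
    and z: "z \<in> ball c \<rho>"
  shows "norm (f z - f c) \<le> 2 * (B - Re (f c)) * dist c z / (\<rho> - dist c z)"
proof -
  have \<rho>: "\<rho> > 0" "dist c z < \<rho>" using z by (auto intro: le_less_trans[OF zero_le_dist])
  have main: "norm (f z - f c) \<le> 2 * b * dist c z / (\<rho> - dist c z)"
    if b: "b > B - Re (f c)" for b
  proof -
    define w where "w = (\<lambda>\<zeta>. f (c + of_real \<rho> * \<zeta>) - f c)"
    define \<phi> where "\<phi> = (\<lambda>\<zeta>. w \<zeta> / (2 * of_real b - w \<zeta>))"
    have b0: "b > 0" using B[of c] \<rho> b by auto
    have in_ball: "c + of_real \<rho> * \<zeta> \<in> ball c \<rho>" if "norm \<zeta> < 1" for \<zeta>
      using that \<rho> by (simp add: dist_norm norm_mult)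
    have Re_w: "Re (w \<zeta>) < b" if "norm \<zeta> < 1" for \<zeta>
      using B[OF in_ball[OF that]] b by (simp add: w_def)
    have lt: "norm (w \<zeta>) < norm (2 * of_real b - w \<zeta>)" if "norm \<zeta> < 1" for \<zeta>
    proof -
      have "(norm (w \<zeta>))\<^sup>2 < (norm (2 * of_real b - w \<zeta>))\<^sup>2"
        unfolding cmod_power2 using mult_strict_left_mono[OF Re_w[OF that] b0]
        by (simp add: power2_eq_square algebra_simps)
      thus ?thesis by (meson norm_ge_zero power2_less_imp_less)
    qed
    have w_holo: "w holomorphic_on ball 0 1"
      unfolding w_def
      by (intro holomorphic_intros holomorphic_on_compose_gen[OF _ holo, unfolded o_def])
        (use in_ball in auto)
    have nz: "2 * of_real b - w \<zeta> \<noteq> 0" if "norm \<zeta> < 1" for \<zeta>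
      using lt[OF that] by force
    have \<phi>_holo: "\<phi> holomorphic_on ball 0 1"
      unfolding \<phi>_def by (intro holomorphic_intros w_holo) (use nz in auto)
    have \<phi>1: "norm (\<phi> \<zeta>) < 1" if "norm \<zeta> < 1" for \<zeta>
      unfolding \<phi>_def norm_divide using lt[OF that] nz[OF that] by (simp add: divide_simps)
    define \<zeta> where "\<zeta> = (z - c) / of_real \<rho>"
    have \<zeta>: "norm \<zeta> = dist c z / \<rho>" "norm \<zeta> < 1"
      using \<rho> by (auto simp: \<zeta>_def norm_divide dist_norm norm_minus_commute)
    have z_eq: "c + of_real \<rho> * \<zeta> = z" using \<rho> by (simp add: \<zeta>_def)
    have "norm (\<phi> \<zeta>) \<le> norm \<zeta>"
      by (rule Schwarz_Lemma(1)[OF \<phi>_holo _ \<phi>1 \<zeta>(2)]) (auto simp: \<phi>_def w_def)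
    hence "norm (w \<zeta>) \<le> norm \<zeta> * norm (2 * of_real b - w \<zeta>)"
      using nz[OF \<zeta>(2)] by (simp add: \<phi>_def norm_divide divide_simps)
    also have "\<dots> \<le> norm \<zeta> * (2 * b + norm (w \<zeta>))"
      using norm_triangle_ineq4[of "2 * of_real b" "w \<zeta>"] b0 by (intro mult_left_mono) auto
    finally have "norm (w \<zeta>) * (1 - norm \<zeta>) \<le> 2 * b * norm \<zeta>"
      by (simp add: algebra_simps)
    hence "norm (f z - f c) * (1 - dist c z / \<rho>) \<le> 2 * b * (dist c z / \<rho>)"
      by (simp add: w_def z_eq \<zeta>(1))
    hence "norm (f z - f c) * ((1 - dist c z / \<rho>) * \<rho>) \<le> 2 * b * (dist c z / \<rho> * \<rho>)"
      using \<rho> by (metis (no_types, opaque_lifting) mult.assoc mult_right_mono less_imp_le)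
    hence "norm (f z - f c) * (\<rho> - dist c z) \<le> 2 * b * dist c z"
      using \<rho> by (simp add: algebra_simps)
    thus ?thesis using \<rho> by (simp add: pos_le_divide_eq)
  qed
  have lim: "((\<lambda>b. 2 * b * dist c z / (\<rho> - dist c z)) \<longlongrightarrow>
          2 * (B - Re (f c)) * dist c z / (\<rho> - dist c z)) (at_right (B - Re (f c)))"
    using \<rho> by (intro tendsto_intros) auto
  show ?thesis
    by (rule tendsto_lowerbound[OF lim])
      (auto simp: eventually_at_filter intro!: main always_eventually)
qed

lemma borel_caratheodory_deriv:
  fixes f :: "complex \<Rightarrow> complex"
  assumes holo: "f holomorphic_on ball c \<rho>" and B: "\<And>z. z \<in> ball c \<rho> \<Longrightarrow> Re (f z) \<le> B"
    and \<rho>: "\<rho> > 0"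
  shows "norm (deriv f c) \<le> 4 * (B - Re (f c)) / \<rho>"
proof -
  have *: "norm (f z - f c) \<le> 2 * (B - Re (f c))" if "norm (c - z) = \<rho> / 2" for z
  proof -
    have d: "dist c z = \<rho> / 2" using that by (simp add: dist_norm)
    have "norm (f z - f c) \<le> 2 * (B - Re (f c)) * (\<rho> / 2) / (\<rho> - \<rho> / 2)"
      using borel_caratheodory[OF holo B, of z] d \<rho> by simp
    also have "\<dots> = 2 * (B - Re (f c))" using \<rho> by simp
    finally show ?thesis .
  qed
  have "norm ((deriv ^^ 1) (\<lambda>z. f z - f c) c) \<le> fact 1 * (2 * (B - Re (f c))) / (\<rho> / 2) ^ 1"
  proof (rule Cauchy_inequality)
    show "(\<lambda>z. f z - f c) holomorphic_on ball c (\<rho> / 2)"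
      using \<rho> by (intro holomorphic_intros holomorphic_on_subset[OF holo]) auto
    show "continuous_on (cball c (\<rho> / 2)) (\<lambda>z. f z - f c)"
      using \<rho> by (intro continuous_intros holomorphic_on_imp_continuous_on
          holomorphic_on_subset[OF holo]) auto
  qed (use * \<rho> in \<open>auto simp: norm_minus_commute\<close>)
  moreover have "deriv (\<lambda>z. f z - f c) c = deriv f c"
    using holomorphic_on_imp_differentiable_at[OF holo] \<rho> by simp
  ultimately show ?thesis using \<rho> by (simp add: field_simps)
qed

lemma Re_attains_max_on_circle:
  fixes W :: "complex \<Rightarrow> complex"
  assumes holo: "W holomorphic_on ball 0 \<rho>" and s: "0 < s" "s < \<rho>"
  obtains z where "norm z = s" "\<And>w. norm w \<le> s \<Longrightarrow> Re (W w) \<le> Re (W z)"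
proof -
  have cont: "continuous_on (cball 0 s) W"
    using s by (intro holomorphic_on_imp_continuous_on holomorphic_on_subset[OF holo]) auto
  have "\<exists>z\<in>sphere 0 s. \<forall>w\<in>sphere 0 s. Re (W w) \<le> Re (W z)"
    using s by (intro continuous_attains_sup continuous_intros continuous_on_subset[OF cont]) auto
  then obtain z where z: "z \<in> sphere 0 s" "\<And>w. w \<in> sphere 0 s \<Longrightarrow> Re (W w) \<le> Re (W z)"
    by blast
  have "Re (W w) \<le> Re (W z)" if "norm w \<le> s" for w
  proof (rule maximum_real_frontier[of W "cball 0 s"])
    show "W holomorphic_on interior (cball 0 s)"
      using s by (intro holomorphic_on_subset[OF holo]) (auto simp: interior_cball)
  qed (use cont z that s in \<open>auto simp: frontier_cball\<close>)
  with z show ?thesis using that by auto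
qed

text \<open>
  If \<open>Re W\<close> exceeds \<open>Q + 4\<close> on the disc of radius \<open>R\<close>, then it grows by at least \<open>2\<close> whenever the
  radius grows by \<open>2\<close> to the power \<open>- (j + 1)\<close>, for \<open>j = 0, 1, 2, \<dots>\<close>: otherwise the inequality of Borel and
  Caratheodory bounds \<open>W'\<close> at a maximum point of \<open>Re W\<close> by a multiple of \<open>2 ^ j\<close>, which is too small compared
  with \<open>exp (Re W - Q)\<close>. The radii stay below \<open>R + 1\<close>, so \<open>Re W\<close> would be unbounded on a compact disc.
\<close>

lemma Re_bound_from_derivative_inequality:
  fixes W :: "complex \<Rightarrow> complex"
  assumes holo: "W holomorphic_on ball 0 \<rho>" and R: "0 < R" "R + 1 < \<rho>" and Q: "Q \<ge> 0"
    and ineq: "\<And>z. R \<le> norm z \<Longrightarrow> norm z \<le> R + 1 \<Longrightarrow>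
                 exp (Re (W z)) \<le> exp Q * (1 + norm (deriv W z))"
    and z: "norm z \<le> R"
  shows "Re (W z) \<le> Q + 4"
proof (rule ccontr)
  assume contra: "\<not> ?thesis"
  define s where "s = (\<lambda>j::nat. R + 1 - (1/2) ^ j)"
  have s_bounds: "R \<le> s j" "s j < R + 1" for j
    by (auto simp: s_def power_le_one)
  have s_Suc: "s (Suc j) = s j + (1/2) ^ Suc j" for j
    by (simp add: s_def)
  have big: "exp (4 + 2 * real j) > 1 + 8 * 2 ^ Suc j" for j
  proof -
    have "exp (4::real) > 17"
    proof -
      have "(5/2::real) ^ 4 \<le> exp 1 ^ 4"
        using exp_lower_Taylor_quadratic[of "1::real"] by (intro power_mono) auto
      also have "exp (1::real) ^ 4 = exp 4" by (simp flip: exp_of_nat_mult)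
      finally show ?thesis by (simp add: power4_eq_xxxx)
    qed
    moreover have "exp (2 * real j) \<ge> 2 ^ j"
    proof -
      have "(2::real) \<le> exp 2" using exp_ge_add_one_self[of 2] by simp
      hence "2 ^ j \<le> exp (2::real) ^ j" by (intro power_mono) auto
      thus ?thesis by (simp add: exp_of_nat_mult mult.commute flip: exp_of_nat_mult)
    qed
    ultimately have "exp 4 * exp (2 * real j) > 17 * 2 ^ j"
      by (intro mult_less_le_imp_less) auto
    moreover have "(1::real) \<le> 2 ^ j" by simp
    ultimately show ?thesis unfolding exp_add power_Suc by linarith
  qed
  have ex: "\<exists>w. norm w \<le> s j \<and> Re (W w) \<ge> Q + 4 + 2 * real j" for j
  proof (induction j)
    case 0
    show ?case using z contra by (intro exI[of _ z]) (auto simp: s_def)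
  next
    case (Suc j)
    then obtain w where w: "norm w \<le> s j" "Re (W w) \<ge> Q + 4 + 2 * real j" by blast
    obtain v where v: "norm v = s j" "\<And>w. norm w \<le> s j \<Longrightarrow> Re (W w) \<le> Re (W v)"
      using Re_attains_max_on_circle[OF holo, of "s j"] s_bounds[of j] R by auto
    have Wv: "Re (W v) \<ge> Q + 4 + 2 * real j" using v w by force
    show ?case
    proof (rule ccontr)
      assume c: "\<not> ?case"
      define \<delta> where "\<delta> = (1/2::real) ^ Suc j"
      have sub: "norm u \<le> s (Suc j)" if "u \<in> ball v \<delta>" for u
        using that v norm_triangle_ineq[of v "u - v"]
        by (simp add: s_Suc \<delta>_def dist_norm norm_minus_commute)
      have le: "Re (W u) \<le> Re (W v) + 2" if "u \<in> ball v \<delta>" for u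
        using sub[OF that] c Wv by force
      have "norm (deriv W v) \<le> 4 * (Re (W v) + 2 - Re (W v)) / \<delta>"
      proof (rule borel_caratheodory_deriv[OF _ le])
        show "W holomorphic_on ball v \<delta>"
          using sub s_bounds[of "Suc j"] R by (intro holomorphic_on_subset[OF holo]) force
      qed (auto simp: \<delta>_def)
      also have "\<dots> = 8 * 2 ^ Suc j" by (simp add: \<delta>_def power_one_over field_simps)
      finally have D: "norm (deriv W v) \<le> 8 * 2 ^ Suc j" .
      have "exp (Re (W v)) \<le> exp Q * (1 + norm (deriv W v))"
        using s_bounds[of j] v by (intro ineq) auto
      also have "\<dots> \<le> exp Q * (1 + 8 * 2 ^ Suc j)" using D by (intro mult_left_mono) auto
      also have "\<dots> < exp Q * exp (4 + 2 * real j)" using big by (intro mult_strict_left_mono) auto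
      also have "\<dots> = exp (Q + 4 + 2 * real j)" by (simp flip: exp_add add: add.assoc)
      finally show False using Wv by simp
    qed
  qed
  have "bounded (W ` cball 0 (R + 1))"
    using R by (intro compact_imp_bounded compact_continuous_image holomorphic_on_imp_continuous_on
        holomorphic_on_subset[OF holo]) auto
  then obtain M where "\<forall>x\<in>W ` cball 0 (R + 1). norm x \<le> M"
    unfolding bounded_iff by blast
  hence M: "norm (W w) \<le> M" if "norm w \<le> R + 1" for w using that by simp
  obtain j where j: "real j > M" using reals_Archimedean2 by blast
  obtain w where "norm w \<le> s j" "Re (W w) \<ge> Q + 4 + 2 * real j" using ex by blast
  moreover from this have "norm (W w) \<le> M" using s_bounds[of j] by (intro M) auto
  ultimately show False using complex_Re_le_cmod[of "W w"] j Q by linarith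
qed

section \<open>Entire solutions of second-order linear equations\<close>

fun ode_coeff :: "complex fps \<Rightarrow> complex \<Rightarrow> complex \<Rightarrow> nat \<Rightarrow> complex" where
  "ode_coeff a u v 0 = u"
| "ode_coeff a u v (Suc 0) = v"
| "ode_coeff a u v (Suc (Suc n)) =
     - (\<Sum>i\<le>n. fps_nth a (n - i) * ode_coeff a u v i) / (of_nat (Suc (Suc n)) * of_nat (Suc n))"

text \<open>
  If the first coefficients satisfy the bound \<open>K\<close>, the recursion gives
  \<open>K M r\<^sup>2 / (k + 2)\<close> for the term of index \<open>k + 2\<close>, which is at most \<open>K\<close> as soon as \<open>k + 2 \<ge> M r\<^sup>2\<close>. Thus the
  maximum over finitely many terms bounds all of them.
\<close>

lemma ode_coeff_bounded:
  assumes r: "r > 0" and a: "\<And>i. norm (fps_nth a i) * r ^ i \<le> M"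
  shows "\<exists>K. \<forall>n. norm (ode_coeff a u v n) * r ^ n \<le> K"
proof -
  define c where "c = ode_coeff a u v"
  have M: "M \<ge> 0" using a[of 0] norm_ge_zero[of "fps_nth a 0"] by (simp del: norm_ge_zero)
  obtain m :: nat where m: "real m \<ge> M * r ^ 2" using real_arch_simple by blast
  define K where "K = Max ((\<lambda>n. norm (c n) * r ^ n) ` {..m + 2})"
  have K: "norm (c n) * r ^ n \<le> K" if "n \<le> m + 2" for n
    unfolding K_def by (rule Max_ge) (use that in auto)
  have K0: "K \<ge> 0" using K[of 0] order_trans[OF norm_ge_zero[of "c 0"]] by simp
  have "norm (c n) * r ^ n \<le> K" for n
  proof (induction n rule: less_induct)
    case (less n)
    show ?case
    proof (cases "n \<le> m + 2")
      case False
      then obtain k where k: "n = Suc (Suc k)" "k \<ge> m" by (metis Suc_le_D add_2_eq_Suc' nat_le_linear not_less_eq_eq)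
      have sum: "norm (\<Sum>i\<le>k. fps_nth a (k - i) * c i) * r ^ k \<le> real (Suc k) * (M * K)"
      proof -
        have "norm (\<Sum>i\<le>k. fps_nth a (k - i) * c i) * r ^ k
                \<le> (\<Sum>i\<le>k. norm (fps_nth a (k - i) * c i)) * r ^ k"
          using r by (intro mult_right_mono norm_sum) auto
        also have "\<dots> = (\<Sum>i\<le>k. (norm (fps_nth a (k - i)) * r ^ (k - i)) * (norm (c i) * r ^ i))"
          unfolding sum_distrib_right
          by (intro sum.cong refl) (simp add: norm_mult flip: power_add)
        also have "\<dots> \<le> (\<Sum>i\<le>k. M * K)"
          using less k r M by (intro sum_mono mult_mono a) auto
        finally show ?thesis by simp
      qed
      have "norm (c n) * r ^ n = norm (\<Sum>i\<le>k. fps_nth a (k - i) * c i) * r ^ k * r\<^sup>2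
               / (real (Suc (Suc k)) * real (Suc k))"
        unfolding c_def k ode_coeff.simps norm_divide norm_minus_cancel norm_mult norm_of_nat
        by (simp add: power2_eq_square del: of_nat_Suc)
      also have "\<dots> \<le> real (Suc k) * (M * K) * r\<^sup>2 / (real (Suc (Suc k)) * real (Suc k))"
        using sum by (intro divide_right_mono mult_right_mono) auto
      also have "\<dots> = K * (M * r\<^sup>2 / real (Suc (Suc k)))"
        by (simp add: divide_simps del: of_nat_Suc)
      also have "\<dots> \<le> K * 1"
        using m k K0 by (intro mult_left_mono) (auto simp: divide_simps)
      finally show ?thesis by simp
    qed (use K in auto)
  qed
  thus ?thesis unfolding c_def by blast
qed

lemma fps_conv_radius_infinity_iff_bounded:
  fixes f :: "complex fps"
  shows "fps_conv_radius f = \<infinity> \<longleftrightarrow> (\<forall>r>0. \<exists>K. \<forall>n. norm (fps_nth f n) * r ^ n \<le> K)"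
proof safe
  fix r :: real assume "fps_conv_radius f = \<infinity>" "r > 0"
  hence "summable (\<lambda>n. norm (fps_nth f n * of_real r ^ n))"
    by (intro norm_summable_fps) auto
  hence "summable (\<lambda>n. norm (fps_nth f n) * r ^ n)"
    using \<open>r > 0\<close> by (simp add: norm_mult norm_power)
  hence "Bseq (\<lambda>n. norm (fps_nth f n) * r ^ n)"
    using summable_LIMSEQ_zero convergentI convergent_imp_Bseq by blast
  thus "\<exists>K. \<forall>n. norm (fps_nth f n) * r ^ n \<le> K"
    unfolding Bseq_def using \<open>r > 0\<close> by (auto simp: abs_mult)
next
  assume *: "\<forall>r>0. \<exists>K. \<forall>n. norm (fps_nth f n) * r ^ n \<le> K"
  have "fps_conv_radius f \<ge> ereal r" if r: "r > 0" for r
    unfolding fps_conv_radius_def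
  proof (rule conv_radius_geI_ex')
    fix s :: real assume s: "0 < s" "ereal s < ereal r"
    from * r obtain K where K: "\<And>n. norm (fps_nth f n) * r ^ n \<le> K" by blast
    show "summable (\<lambda>n. fps_nth f n * of_real s ^ n)"
    proof (rule summable_comparison_test)
      show "\<exists>N. \<forall>n\<ge>N. norm (fps_nth f n * of_real s ^ n) \<le> K * (s / r) ^ n"
      proof (intro exI[of _ 0] allI impI)
        fix n
        have "norm (fps_nth f n * of_real s ^ n) = norm (fps_nth f n) * r ^ n * (s / r) ^ n"
          using s r by (simp add: norm_mult norm_power power_divide)
        also have "\<dots> \<le> K * (s / r) ^ n" using K s r by (intro mult_right_mono) auto
        finally show "norm (fps_nth f n * of_real s ^ n) \<le> K * (s / r) ^ n" .
      qed
      show "summable (\<lambda>n. K * (s / r) ^ n)"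
        using s r by (intro summable_mult summable_geometric) auto
    qed
  qed
  hence "fps_conv_radius f \<ge> ereal (real n)" for n
    by (cases "n = 0") (auto simp: fps_conv_radius_def conv_radius_nonneg zero_ereal_def[symmetric])
  thus "fps_conv_radius f = \<infinity>"
    by (intro ereal_top) (metis ereal_less_eq(3) order.trans real_arch_simple)
qed

theorem entire_linear_ode_solution:
  assumes A: "A holomorphic_on UNIV"
  obtains f where "f holomorphic_on UNIV" "\<And>z. deriv (deriv f) z + A z * f z = 0"
    "f 0 = u" "deriv f 0 = v"
proof -
  define a where "a = fps_expansion A 0"
  have ra: "fps_conv_radius a = \<infinity>"
    using conv_radius_fps_expansion[of A 0 \<infinity>] A unfolding a_def by simp
  have ea: "eval_fps a z = A z" for z
    using eval_fps_expansion[of A 0 \<infinity> z] A unfolding a_def by simp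
  define c where "c = Abs_fps (ode_coeff a u v)"
  have rc: "fps_conv_radius c = \<infinity>"
    unfolding fps_conv_radius_infinity_iff_bounded
  proof (intro allI impI)
    fix r :: real assume r: "r > 0"
    then obtain M where "\<And>n. norm (fps_nth a n) * r ^ n \<le> M"
      using ra unfolding fps_conv_radius_infinity_iff_bounded by blast
    from ode_coeff_bounded[OF r this] show "\<exists>K. \<forall>n. norm (fps_nth c n) * r ^ n \<le> K"
      by (simp add: c_def)
  qed
  have rc': "fps_conv_radius (fps_deriv c) = \<infinity>" 
    using fps_conv_radius_deriv[of c] rc by simp
  have eq: "fps_deriv (fps_deriv c) = - (a * c)"
  proof (rule fps_ext)
    fix n
    have "fps_nth (a * c) n = (\<Sum>i\<le>n. fps_nth a (n - i) * ode_coeff a u v i)"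
      unfolding fps_mult_nth c_def atLeast0AtMost
      by (rule sum.reindex_bij_witness[of _ "\<lambda>i. n - i" "\<lambda>i. n - i"]) auto
    moreover have "fps_nth (fps_deriv (fps_deriv c)) n
        = of_nat (Suc (Suc n)) * of_nat (Suc n) * ode_coeff a u v (Suc (Suc n))"
      by (simp add: c_def algebra_simps)
    ultimately show "fps_nth (fps_deriv (fps_deriv c)) n = fps_nth (- (a * c)) n"
      by (simp del: of_nat_Suc)
  qed
  have d1: "deriv (eval_fps c) = eval_fps (fps_deriv c)"
    using rc by (intro ext eval_fps_deriv[symmetric]) auto
  have d2: "deriv (eval_fps (fps_deriv c)) = eval_fps (fps_deriv (fps_deriv c))"
    using rc' by (intro ext eval_fps_deriv[symmetric]) auto
  show ?thesis
  proof (rule that[of "eval_fps c"])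
    show "eval_fps c holomorphic_on UNIV"
      using rc by (intro holomorphic_intros) auto
    fix z
    have "eval_fps (a * c) z = A z * eval_fps c z"
      using rc ra by (subst eval_fps_mult) (auto simp: ea)
    moreover have "eval_fps (- (a * c)) z = - eval_fps (a * c) z"
      using rc ra fps_conv_radius_mult[of a c] by (intro eval_fps_minus) auto
    ultimately show "deriv (deriv (eval_fps c)) z + A z * eval_fps c z = 0"
      by (simp add: d1 d2 eq)
  next
    show "eval_fps c 0 = u" by (simp add: eval_fps_at_0 c_def)
    show "deriv (eval_fps c) 0 = v" unfolding d1 by (simp add: eval_fps_at_0 c_def)
  qed
qed

section \<open>Functions with simple zeros\<close>

lemma zorder_simple_zero:
  assumes "f holomorphic_on UNIV" "f z = 0" "deriv f z \<noteq> 0"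
  shows "zorder f z = 1"
  by (rule zorder_zero_eqI[OF assms(1)]) (use assms in auto)

lemma exists_nonzero_if_simple_zeros:
  assumes "E holomorphic_on UNIV" "\<And>z. E z = 0 \<Longrightarrow> deriv E z \<noteq> 0"
  shows "\<exists>z. norm z < 1 \<and> E z \<noteq> 0"
proof (rule ccontr)
  assume "\<not> ?thesis"
  hence E0: "E z = 0" if "norm z < 1" for z using that by blast
  have "eventually (\<lambda>z. E z = 0) (nhds 0)"
    by (rule eventually_mono[OF eventually_nhds_in_open[of "ball 0 1"]]) (use E0 in auto)
  hence "deriv E 0 = deriv (\<lambda>_. 0) 0" by (intro deriv_cong_ev) auto
  with assms(2)[OF E0[of 0]] show False by simp
qed

lemma finite_zeros_cball:
  assumes "E holomorphic_on UNIV" "\<And>z. E z = 0 \<Longrightarrow> deriv E z \<noteq> 0"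
  shows "finite {z. norm z \<le> r \<and> E z = 0}"
proof -
  have "finite {z\<in>cball 0 r. E z = 0}"
  proof (cases "E constant_on UNIV")
    case True
    then obtain c where c: "E = (\<lambda>_. c)" by (auto simp: constant_on_def)
    with assms(2) have "c \<noteq> 0" by auto
    thus ?thesis using c by simp
  next
    case False
    thus ?thesis using assms(1) by (intro holomorphic_compact_finite_zeros[of E UNIV]) auto
  qed
  thus ?thesis by (simp add: cball_def dist_norm conj_commute)
qed

text \<open>
  Only the zeros inside the disc are divided out, by a polynomial; this replaces a canonical product.
\<close>

lemma factor_out_simple_zeros:
  fixes \<rho> :: real and E :: "complex \<Rightarrow> complex"
  assumes E: "E holomorphic_on UNIV" "\<And>z. E z = 0 \<Longrightarrow> deriv E z \<noteq> 0"
  defines "S \<equiv> {z. norm z < \<rho> \<and> E z = 0}"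
  obtains W where "W holomorphic_on ball 0 \<rho>"
    "\<And>z. norm z < \<rho> \<Longrightarrow> E z = (\<Prod>a\<in>S. z - a) * exp (- W z)"
proof -
  have fin: "finite S"
    by (rule finite_subset[OF _ finite_zeros_cball[OF E, of \<rho>]]) (auto simp: S_def)
  define p where "p = (\<lambda>z. \<Prod>a\<in>S. z - a)"
  have p_holo: "p holomorphic_on X" for X unfolding p_def by (intro holomorphic_intros)
  have p0: "p z = 0 \<longleftrightarrow> z \<in> S" for z unfolding p_def using fin by auto
  have dp: "deriv p z \<noteq> 0" if z: "z \<in> S" for z
  proof -
    have "(p has_field_derivative (\<Sum>x\<in>S. 1 * (\<Prod>y\<in>S - {x}. z - y))) (at z)"
      unfolding p_def by (rule has_field_derivative_prod) (auto intro!: derivative_eq_intros)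
    moreover have "(\<Sum>x\<in>S. 1 * (\<Prod>y\<in>S - {x}. z - y)) = (\<Sum>x\<in>{z}. 1 * (\<Prod>y\<in>S - {x}. z - y))"
      using fin z by (intro sum.mono_neutral_right) auto
    ultimately have "deriv p z = (\<Prod>y\<in>S - {z}. z - y)" by (simp add: DERIV_imp_deriv)
    thus ?thesis using fin by simp
  qed
  obtain h where h: "h holomorphic_on ball 0 \<rho>" "\<And>z. z \<in> ball 0 \<rho> \<Longrightarrow> h z \<noteq> 0"
    "\<And>z. z \<in> ball 0 \<rho> \<Longrightarrow> E z = h z * p z"
  proof (rule holomorphic_zorder_factorization[of E "ball 0 \<rho>" p])
    fix z :: complex assume z: "z \<in> ball 0 \<rho>"
    show iff: "(p z = 0) = (E z = 0)" using z by (auto simp: p0 S_def)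
    show "zorder p z = zorder E z"
    proof (cases "E z = 0")
      case True
      thus ?thesis using iff dp p0 E by (simp add: zorder_simple_zero p_holo)
    next
      case False
      moreover have "p analytic_on {z}" "E analytic_on {z}"
        using p_holo[of UNIV] E(1) by (auto simp: analytic_at)
      ultimately show ?thesis using iff zorder_eq_0I by metis
    qed
  qed (use E p_holo holomorphic_on_subset in auto)
  obtain g where g: "g holomorphic_on ball 0 \<rho>" "\<And>z. z \<in> ball 0 \<rho> \<Longrightarrow> h z = exp (g z)"
    by (rule contractible_imp_holomorphic_log[OF h(1) convex_imp_contractible h(2)]) auto
  show ?thesis
  proof (rule that[of "\<lambda>z. - g z"])
    show "(\<lambda>z. - g z) holomorphic_on ball 0 \<rho>" using g by (intro holomorphic_intros)
    show "E z = (\<Prod>a\<in>S. z - a) * exp (- (- g z))" if "norm z < \<rho>" for z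
      using h(3)[of z] g(2)[of z] that by (simp add: p_def mult.commute)
  qed
qed

text \<open>
  Pigeonhole: of \<open>card S + 1\<close> disjoint intervals of length \<open>\<tau>\<close> one contains no value of \<open>m\<close> on \<open>S\<close>, and \<open>r\<close>
  is its midpoint.
\<close>

lemma exists_radius_away_from_finite_set:
  fixes S :: "'a set" and m :: "'a \<Rightarrow> real"
  assumes "finite S" "\<tau> > 0"
  obtains r where "R \<le> r" "r \<le> R + real (card S + 1) * \<tau>" "\<And>a. a \<in> S \<Longrightarrow> \<bar>m a - r\<bar> \<ge> \<tau> / 2"
proof -
  define I where "I = (\<lambda>j::nat. {R + real j * \<tau> <..< R + (real j + 1) * \<tau>})"
  have "\<exists>j\<in>{..card S}. m ` S \<inter> I j = {}"
  proof (rule ccontr)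
    assume "\<not> ?thesis"
    hence "\<forall>j\<in>{..card S}. \<exists>a. a \<in> S \<and> m a \<in> I j" by blast
    then obtain f where f: "\<And>j. j \<le> card S \<Longrightarrow> f j \<in> S \<and> m (f j) \<in> I j"
      by (metis atMost_iff)
    have "inj_on f {..card S}"
    proof (rule inj_onI)
      fix i j assume ij: "i \<in> {..card S}" "j \<in> {..card S}" "f i = f j"
      hence x: "m (f i) \<in> I i" "m (f i) \<in> I j" using f by (metis atMost_iff)+
      have "real i * \<tau> < (real j + 1) * \<tau>" "real j * \<tau> < (real i + 1) * \<tau>"
        using x by (auto simp: I_def intro: less_trans)
      hence "real i < real j + 1" "real j < real i + 1" using \<open>\<tau> > 0\<close> by simp_all
      thus "i = j" by linarith
    qed
    moreover have "f ` {..card S} \<subseteq> S" using f by auto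
    ultimately have "card {..card S} \<le> card S" using assms(1) card_inj_on_le by blast
    thus False by simp
  qed
  then obtain j where j: "j \<le> card S" "\<And>a. a \<in> S \<Longrightarrow> m a \<notin> I j" by auto
  define r where "r = R + (real j + 1/2) * \<tau>"
  show ?thesis
  proof (rule that[of r])
    show "R \<le> r" using assms by (simp add: r_def)
    have "(real j + 1/2) * \<tau> \<le> real (card S + 1) * \<tau>"
      using j assms by (intro mult_right_mono) auto
    thus "r \<le> R + real (card S + 1) * \<tau>" by (simp add: r_def)
    fix a assume "a \<in> S"
    hence "m a \<le> R + real j * \<tau> \<or> m a \<ge> R + (real j + 1) * \<tau>" using j(2)[of a] by (auto simp: I_def)
    thus "\<bar>m a - r\<bar> \<ge> \<tau> / 2" by (auto simp: r_def algebra_simps abs_real_def)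
  qed
qed

section \<open>Entire solutions of a Riccati-type equation have many zeros\<close>

text \<open>
  The quantitative core of the argument, for one disc of radius \<open>3 R\<close>. Off the zeros of \<open>f\<close> the equation for \<open>E\<close>
  reads \<open>E' = 1 + 2 \<psi> E\<close> with \<open>\<psi> = f' / f\<close>. The number \<open>P\<close> collects all bounds for \<open>W\<close>, which
  are small compared with the lower bound \<open>exp (R / 4)\<close> for \<open>\<psi>\<close>. The terms of \<open>P\<close> with \<open>z1\<close> and
  \<open>d\<close> come from a lower bound for \<open>Re W\<close> at the point \<open>z1\<close>, where \<open>E\<close> does not vanish.
\<close>

lemma riccati_small_value:
  fixes f E :: "complex \<Rightarrow> complex" and R d :: real
  assumes E: "E holomorphic_on UNIV" "\<And>z. E z = 0 \<Longrightarrow> deriv E z \<noteq> 0"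
    and ode: "\<And>z. f z * deriv E z = f z + 2 * deriv f z * E z"
    and R: "R \<ge> 8"
    and ann: "\<And>z. R \<le> norm z \<Longrightarrow> norm z \<le> 3 * R \<Longrightarrow> f z \<noteq> 0 \<and>
               exp (R/4) \<le> norm (deriv f z / f z) \<and> norm (deriv f z / f z) \<le> exp T"
    and T: "T \<ge> 0"
    and count: "real (card {z. norm z \<le> 3 * R \<and> E z = 0}) \<le> N"
    and z1: "norm z1 < 1" "E z1 \<noteq> 0"
    and d: "0 < d" "d \<le> 1" "\<And>z. E z = 0 \<Longrightarrow> dist z1 z \<ge> d"
    and P: "P = ln 3 + N * ln (7 * R) + T + 4 + \<bar>ln (norm (E z1))\<bar> + N * ln (1 / d)"
    and large: "4 * N * (N + 1) + 17 * P \<le> exp (R / 4)"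
  shows "norm (E z1) \<le> exp (- R / 4)"
proof -
  define S where "S = {z. norm z < 3 * R \<and> E z = 0}"
  have fin': "finite {z. norm z \<le> 3 * R \<and> E z = 0}" by (rule finite_zeros_cball[OF E])
  have fin: "finite S" by (rule finite_subset[OF _ fin']) (auto simp: S_def)
  have cardS: "real (card S) \<le> N"
    using card_mono[OF fin', of S] count by (force simp: S_def)
  have N0: "N \<ge> 0" using cardS by linarith
  obtain W where W: "W holomorphic_on ball 0 (3 * R)"
    "\<And>z. norm z < 3 * R \<Longrightarrow> E z = (\<Prod>a\<in>S. z - a) * exp (- W z)"
    unfolding S_def using factor_out_simple_zeros[OF E, of "3 * R"] by blast
  define p where "p = (\<lambda>z. \<Prod>a\<in>S. z - a)"
  define X where "X = exp (N * ln (7 * R))"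
  define Q where "Q = ln 3 + N * ln (7 * R) + T"
  have X1: "X \<ge> 1" unfolding X_def using N0 R by simp
  have p_holo: "p holomorphic_on A" for A unfolding p_def by (intro holomorphic_intros)
  have p_le: "norm (p z) \<le> X" if "norm z \<le> 3 * R + 1" for z :: complex
  proof -
    have "norm (p z) = (\<Prod>a\<in>S. norm (z - a))" by (simp add: p_def flip: prod_norm)
    also have "\<dots> \<le> (\<Prod>a\<in>S. 7 * R)"
    proof (rule prod_mono, intro conjI)
      fix a assume "a \<in> S"
      thus "norm (z - a) \<le> 7 * R" using that R norm_triangle_ineq4[of z a] by (simp add: S_def)
    qed auto
    also have "\<dots> = (7 * R) powr real (card S)" using R by (simp add: powr_realpow)
    also have "\<dots> \<le> (7 * R) powr N" using cardS R by (intro powr_mono) auto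
    also have "\<dots> = X" using R by (simp add: X_def powr_def)
    finally show ?thesis .
  qed
  have dp_le: "norm (deriv p z) \<le> X" if z: "norm z \<le> 3 * R" for z :: complex
  proof -
    have "norm ((deriv ^^ 1) p z) \<le> fact 1 * X / 1 ^ 1"
    proof (rule Cauchy_inequality)
      fix x assume "norm (z - x) = 1"
      thus "norm (p x) \<le> X" using z norm_triangle_ineq4[of z "z - x"] by (intro p_le) auto
    qed (auto intro!: p_holo holomorphic_on_imp_continuous_on)
    thus ?thesis by simp
  qed
  define \<psi> where "\<psi> = (\<lambda>z. deriv f z / f z)"
  have dE: "deriv E z = (deriv p z - p z * deriv W z) * exp (- W z)" if z: "norm z < 3 * R" for z
  proof -
    have "(p has_field_derivative deriv p z) (at z)"
      using p_holo[of UNIV] by (simp add: holomorphic_derivI)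
    moreover have "(W has_field_derivative deriv W z) (at z)"
      using W(1) z by (auto intro: holomorphic_derivI)
    ultimately have "((\<lambda>z. p z * exp (- W z)) has_field_derivative
        (deriv p z - p z * deriv W z) * exp (- W z)) (at z)"
      by (auto intro!: derivative_eq_intros simp: algebra_simps)
    hence "(E has_field_derivative (deriv p z - p z * deriv W z) * exp (- W z)) (at z)"
      by (rule has_field_derivative_transform_within_open[of _ _ _ "ball 0 (3 * R)"])
        (use z W(2) in \<open>auto simp: p_def\<close>)
    thus ?thesis by (rule DERIV_imp_deriv)
  qed
  have dE': "deriv E z = 1 + 2 * \<psi> z * E z" if "R \<le> norm z" "norm z \<le> 3 * R" for z
    using ode[of z] ann[OF that] by (simp add: \<psi>_def field_simps)
  have expW: "exp (W z) = deriv p z - p z * deriv W z - 2 * \<psi> z * p z"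
    if z: "R \<le> norm z" "norm z < 3 * R" for z
  proof -
    have "(deriv p z - p z * deriv W z) * exp (- W z) = 1 + 2 * \<psi> z * (p z * exp (- W z))"
      using dE[of z] dE'[of z] W(2)[of z] z by (simp add: p_def)
    hence "(deriv p z - p z * deriv W z) * (exp (- W z) * exp (W z)) =
             exp (W z) + 2 * \<psi> z * p z * (exp (- W z) * exp (W z))"
      by (metis (no_types, opaque_lifting) distrib_right mult.assoc mult_1)
    thus ?thesis by (simp flip: exp_add add: algebra_simps)
  qed
  \<comment> \<open>upper bound for \<open>Re W\<close> from the identity for \<open>exp W\<close>\<close>
  have ReW: "Re (W z) \<le> Q + 4" if "norm z \<le> 2 * R" for z :: complex
  proof (rule Re_bound_from_derivative_inequality[OF W(1), of "2 * R"])
    show "Q \<ge> 0" unfolding Q_def using N0 R T by simp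
    fix z :: complex assume z: "2 * R \<le> norm z" "norm z \<le> 2 * R + 1"
    have X0: "X \<ge> 0" "exp T \<ge> 1" using X1 T by auto
    have "exp (Re (W z)) = norm (deriv p z - p z * deriv W z - 2 * \<psi> z * p z)"
      using expW[of z] z R by (simp flip: norm_exp_eq_Re)
    also have "\<dots> \<le> norm (deriv p z) + norm (p z) * norm (deriv W z) + 2 * norm (\<psi> z) * norm (p z)"
      using norm_triangle_ineq4[of "deriv p z - p z * deriv W z" "2 * \<psi> z * p z"]
        norm_triangle_ineq4[of "deriv p z" "p z * deriv W z"] by (simp add: norm_mult)
    also have "\<dots> \<le> X + X * norm (deriv W z) + 2 * exp T * X"
      using z R ann[of z] X0
      by (intro add_mono mult_mono dp_le p_le order_refl) (auto simp: \<psi>_def)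
    also have "\<dots> \<le> 3 * X * exp T * (1 + norm (deriv W z))"
    proof -
      have 1: "X * 1 \<le> X * exp T" using X0 by (intro mult_left_mono) auto
      have "X * norm (deriv W z) \<le> X * exp T * norm (deriv W z)"
        using 1 by (intro mult_right_mono) auto
      moreover have "0 \<le> X * exp T * norm (deriv W z)" using X0 by simp
      ultimately show ?thesis using 1 by (simp add: algebra_simps)
    qed
    also have "3 * X * exp T = exp Q" by (simp add: Q_def X_def exp_add)
    finally show "exp (Re (W z)) \<le> exp Q * (1 + norm (deriv W z))" .
  qed (use R that in auto)
  have P_nonneg: "P \<ge> 0" unfolding P using N0 R T d by (intro add_nonneg_nonneg mult_nonneg_nonneg ln_ge_zero) (auto simp: divide_simps)
  \<comment> \<open>no zero lies within \<open>d\<close> of \<open>z1\<close>, so \<open>p\<close> is not too small there\<close>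
  have ReW1: "Q + 4 - Re (W z1) \<le> P"
  proof -
    have "d powr N \<le> d powr real (card S)" using cardS d by (intro powr_mono') auto
    also have "\<dots> = (\<Prod>a\<in>S. d)" using d by (simp add: powr_realpow)
    also have "\<dots> \<le> (\<Prod>a\<in>S. norm (z1 - a))"
      using d by (intro prod_mono) (auto simp: S_def dist_norm)
    also have "\<dots> = norm (p z1)" by (simp add: p_def flip: prod_norm)
    finally have "d powr N * exp (- Re (W z1)) \<le> norm (p z1) * exp (- Re (W z1))"
      by (intro mult_right_mono) auto
    also have "\<dots> = norm (E z1)" using W(2)[of z1] z1 R by (simp add: p_def norm_mult)
    finally have "ln (d powr N * exp (- Re (W z1))) \<le> ln (norm (E z1))"
      using d z1 by (intro ln_mono) auto
    hence "N * ln d - Re (W z1) \<le> ln (norm (E z1))" using d by (simp add: ln_mult)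
    thus ?thesis unfolding P Q_def using d by (simp add: ln_div)
  qed
  \<comment> \<open>from \<open>z1\<close> the bounds spread to the disc of radius \<open>3 R / 2\<close>, at the cost of a constant factor\<close>
  have dW: "norm (deriv W z) \<le> 17 * P" if z: "norm z \<le> 3 / 2 * R" for z
  proof -
    have dist: "dist z1 z \<le> 3 / 2 * R + 1"
      using z z1 norm_triangle_ineq4[of z1 z] by (simp add: dist_norm)
    have sub: "norm u \<le> 2 * R" if "u \<in> ball z1 (2 * R - 1)" for u
      using that z1 norm_triangle_ineq[of z1 "u - z1"] by (simp add: dist_norm norm_minus_commute)
    have "norm (W z - W z1) \<le> 2 * (Q + 4 - Re (W z1)) * dist z1 z / ((2 * R - 1) - dist z1 z)"
    proof (rule borel_caratheodory)
      show "W holomorphic_on ball z1 (2 * R - 1)"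
        using sub R by (intro holomorphic_on_subset[OF W(1)]) force
    qed (use sub ReW dist R in auto)
    also have "\<dots> = 2 * (Q + 4 - Re (W z1)) * (dist z1 z / ((2 * R - 1) - dist z1 z))" by simp
    also have "\<dots> \<le> 2 * P * 8"
    proof (intro mult_mono)
      show "dist z1 z / (2 * R - 1 - dist z1 z) \<le> 8"
        using dist R by (subst pos_divide_le_eq) auto
      show "0 \<le> dist z1 z / (2 * R - 1 - dist z1 z)" using dist R by simp
    qed (use P_nonneg ReW1 ReW[of z1] z1 R in auto)
    finally have "norm (W z - W z1) \<le> 16 * P" by simp
    hence "Re (W z1) - Re (W z) \<le> 16 * P"
      using complex_Re_le_cmod[of "W z1 - W z"] by (simp add: norm_minus_commute)
    hence le: "Q + 4 - Re (W z) \<le> 17 * P" using ReW1 by linarith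
    have sub: "norm u \<le> 2 * R" if "u \<in> ball z (R / 2)" for u
      using that z norm_triangle_ineq[of z "u - z"] by (simp add: dist_norm norm_minus_commute)
    have "norm (deriv W z) \<le> 4 * (Q + 4 - Re (W z)) / (R / 2)"
    proof (rule borel_caratheodory_deriv)
      show "W holomorphic_on ball z (R / 2)"
        using sub R by (intro holomorphic_on_subset[OF W(1)]) force
    qed (use sub ReW R in auto)
    also have "\<dots> \<le> 4 * (17 * P) / (R / 2)" using le R by (intro divide_right_mono) auto
    also have "\<dots> \<le> 17 * P" using R P_nonneg using mult_left_mono[of 8 R P] by (simp add: divide_simps mult.commute)
    finally show ?thesis .
  qed
  define \<tau> where "\<tau> = R / 2 / real (card S + 1)"
  have \<tau>: "\<tau> > 0" unfolding \<tau>_def using R by simp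
  obtain r where r: "R \<le> r" "r \<le> R + real (card S + 1) * \<tau>"
      "\<And>a. a \<in> S \<Longrightarrow> \<bar>norm a - r\<bar> \<ge> \<tau> / 2"
    using exists_radius_away_from_finite_set[OF fin \<tau>, of R norm] by metis
  have "real (card S + 1) * \<tau> = R / 2"
    unfolding \<tau>_def by (subst times_divide_eq_right, rule nonzero_mult_div_cancel_left) simp
  hence r2: "r \<le> 3 / 2 * R" using r(2) by linarith
  \<comment> \<open>on this circle \<open>p' / p\<close> is at most \<open>4 N (N + 1)\<close>\<close>
  have small: "norm (E z) \<le> exp (- R / 4)" if z: "norm z = r" for z :: complex
  proof -
    have za: "norm (z - a) \<ge> \<tau> / 2" if "a \<in> S" for a
      using r(3)[OF that] z norm_triangle_ineq3[of z a] by linarith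
    have za0: "z \<noteq> a" if "a \<in> S" for a using za[OF that] \<tau> by auto
    have pz: "p z \<noteq> 0" unfolding p_def using fin za0 by auto
    have Ez: "E z \<noteq> 0" using W(2)[of z] pz z r2 R by (simp add: p_def)
    have "(p has_field_derivative (p z * (\<Sum>a\<in>S. 1 / (z - a)))) (at z)"
      unfolding p_def by (rule has_field_derivative_prod') (auto intro!: derivative_eq_intros dest: za0)
    hence "deriv p z / p z = (\<Sum>a\<in>S. 1 / (z - a))" using pz by (simp add: DERIV_imp_deriv)
    also have "norm \<dots> \<le> (\<Sum>a\<in>S. 2 / \<tau>)"
    proof (rule order_trans[OF norm_sum sum_mono])
      fix a assume "a \<in> S"
      thus "norm (1 / (z - a)) \<le> 2 / \<tau>" using za[of a] \<tau> za0[of a]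
        by (simp add: norm_divide divide_simps mult.commute)
    qed
    also have "\<dots> = 4 * real (card S) * (real (card S) + 1) / R"
      using R by (simp add: \<tau>_def field_simps)
    also have "\<dots> \<le> 4 * N * (N + 1) / 1"
      using R cardS N0 by (intro frac_le mult_mono add_mono) auto
    finally have q: "norm (deriv p z / p z) \<le> 4 * N * (N + 1)" by simp
    have "deriv E z = E z * (deriv p z / p z - deriv W z)"
    proof -
      have Ep: "E z = p z * exp (- W z)" using W(2)[of z] z r2 R by (simp add: p_def)
      have "deriv E z = (deriv p z - p z * deriv W z) * exp (- W z)"
        using dE[of z] z r2 R by simp
      also have "\<dots> = E z * (deriv p z / p z - deriv W z)"
        unfolding Ep using pz by (simp add: algebra_simps)
      finally show ?thesis .
    qed
    hence "1 + 2 * \<psi> z * E z = E z * (deriv p z / p z - deriv W z)"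
      using dE'[of z] z r r2 R by simp
    hence eq: "1 / E z = deriv p z / p z - deriv W z - 2 * \<psi> z" using Ez by (simp add: field_simps)
    have "norm (2 * \<psi> z) \<le> norm (deriv p z / p z) + norm (deriv W z) + norm (1 / E z)"
      using norm_triangle_ineq4[of "deriv p z / p z - deriv W z" "1 / E z"]
        norm_triangle_ineq4[of "deriv p z / p z" "deriv W z"] unfolding eq by simp
    moreover have "norm (2 * \<psi> z) \<ge> 2 * exp (R / 4)"
    proof -
      have "exp (R / 4) \<le> norm (\<psi> z)" using ann[of z] z r r2 R by (simp add: \<psi>_def)
      thus ?thesis by (simp add: norm_mult)
    qed
    ultimately have "norm (1 / E z) \<ge> exp (R / 4)"
      using q dW[of z] z r2 large by linarith
    hence "norm (E z) * exp (R / 4) \<le> 1" using Ez by (simp add: norm_divide field_simps)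
    hence "norm (E z) * (exp (R / 4) * exp (- R / 4)) \<le> 1 * exp (- R / 4)"
      unfolding mult.assoc[symmetric] by (intro mult_right_mono) auto
    thus ?thesis by (simp flip: exp_add)
  qed
  show ?thesis
  proof (rule maximum_modulus_frontier[of E "ball 0 r"])
    fix z :: complex assume "z \<in> frontier (ball 0 r)"
    thus "norm (E z) \<le> exp (- R / 4)" using small r R by (auto simp: frontier_ball)
  qed (use E z1 r R in \<open>auto intro!: holomorphic_on_imp_continuous_on intro: holomorphic_on_subset\<close>)
qed

text \<open>
  Applied with \<open>f = f\<^sub>1\<close> and \<open>E = f\<^sub>1 (c f\<^sub>1 + f\<^sub>2)\<close>. The bounds of \<open>riccati_small_value\<close> are powers of
  \<open>R\<close> times logarithms, hence \<open>E\<close> at the fixed point \<open>z1\<close> is at most \<open>exp (- R / 4)\<close> for arbitrarily large \<open>R\<close>.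
\<close>

lemma riccati_zeros_not_polynomially_bounded:
  fixes f E :: "complex \<Rightarrow> complex" and K :: nat
  assumes E: "E holomorphic_on UNIV" "\<And>z. E z = 0 \<Longrightarrow> deriv E z \<noteq> 0"
    and ode: "\<And>z. f z * deriv E z = f z + 2 * deriv f z * E z"
    and annuli: "\<And>R0. \<exists>R\<ge>R0. \<forall>z. R \<le> norm z \<longrightarrow> norm z \<le> 3 * R \<longrightarrow> f z \<noteq> 0 \<and>
               exp (R/4) \<le> norm (deriv f z / f z) \<and> norm (deriv f z / f z) \<le> exp (R ^ K)"
    and count: "\<And>r. r \<ge> r0 \<Longrightarrow> real (card {z. norm z \<le> r \<and> E z = 0}) \<le> r ^ K"
  shows False
proof -
  obtain z1 where z1: "norm z1 < 1" "E z1 \<noteq> 0"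
    using exists_nonzero_if_simple_zeros[OF E] by blast
  have "open (E -` (- {0}))"
    by (intro open_vimage holomorphic_on_imp_continuous_on E) auto
  then obtain d0 where d0: "d0 > 0" "ball z1 d0 \<subseteq> E -` (- {0})"
    using z1 by (force simp: open_contains_ball)
  define d where "d = min d0 1"
  have d: "0 < d" "d \<le> 1" using d0 by (auto simp: d_def)
  have dist: "dist z1 z \<ge> d" if "E z = 0" for z
    using d0 that by (force simp: d_def subset_iff)
  define L where "L = \<bar>ln (norm (E z1))\<bar>"
  define \<kappa> where "\<kappa> = ln (1 / d)"
  define P where "P = (\<lambda>R. ln 3 + (3 * R) ^ K * ln (7 * R) + R ^ K + 4 + L + (3 * R) ^ K * \<kappa>)"
  have "eventually (\<lambda>R. 4 * (3 * R) ^ K * ((3 * R) ^ K + 1) + 17 * P R \<le> exp (R / 4)) at_top"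
    unfolding P_def by real_asymp
  moreover have "eventually (\<lambda>R. exp (- R / 4) < norm (E z1)) at_top"
  proof -
    have "((\<lambda>R::real. exp (- R / 4)) \<longlongrightarrow> 0) at_top" by real_asymp
    thus ?thesis by (rule order_tendstoD) (use z1 in auto)
  qed
  moreover have "eventually (\<lambda>R. R \<ge> 8 \<and> R \<ge> r0) at_top"
    by (intro eventually_conj eventually_ge_at_top)
  ultimately have "eventually (\<lambda>R. 4 * (3 * R) ^ K * ((3 * R) ^ K + 1) + 17 * P R \<le> exp (R / 4) \<and>
      exp (- R / 4) < norm (E z1) \<and> R \<ge> 8 \<and> R \<ge> r0) at_top"
    by eventually_elim auto
  then obtain R0 where R0: "\<And>R. R \<ge> R0 \<Longrightarrow>
      4 * (3 * R) ^ K * ((3 * R) ^ K + 1) + 17 * P R \<le> exp (R / 4) \<and>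
      exp (- R / 4) < norm (E z1) \<and> R \<ge> 8 \<and> R \<ge> r0"
    unfolding eventually_at_top_linorder by blast
  obtain R where R: "R \<ge> R0" and ann: "\<And>z. R \<le> norm z \<Longrightarrow> norm z \<le> 3 * R \<Longrightarrow> f z \<noteq> 0 \<and>
               exp (R/4) \<le> norm (deriv f z / f z) \<and> norm (deriv f z / f z) \<le> exp (R ^ K)"
    using annuli[of R0] by blast
  note R' = R0[OF R]
  have "norm (E z1) \<le> exp (- R / 4)"
  proof (rule riccati_small_value[OF E ode _ ann _ _ z1 d dist])
    show "real (card {z. norm z \<le> 3 * R \<and> E z = 0}) \<le> (3 * R) ^ K"
      using R' by (intro count) auto
    show "P R = ln 3 + (3 * R) ^ K * ln (7 * R) + R ^ K + 4 + \<bar>ln (norm (E z1))\<bar> + (3 * R) ^ K * ln (1 / d)"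
      by (simp add: P_def L_def \<kappa>_def)
  qed (use R' in auto)
  with R' show False by linarith
qed

section \<open>Potentials from prescribed logarithmic derivatives\<close>

lemma locally_finite_imp_not_islimpt:
  fixes Z :: "complex set"
  assumes "\<And>r. finite (Z \<inter> cball 0 r)"
  shows "\<not> z islimpt Z"
proof
  assume "z islimpt Z"
  moreover have "eventually (\<lambda>w. w \<in> ball 0 (norm z + 1)) (at z)"
    by (intro eventually_at_in_open') auto
  ultimately have "z islimpt (Z \<inter> ball 0 (norm z + 1))" by (rule islimpt_Int_eventually)
  moreover have "finite (Z \<inter> ball 0 (norm z + 1))"
    by (rule finite_subset[OF _ assms[of "norm z + 1"]]) auto
  ultimately show False using islimpt_finite by blast
qed

lemma entire_with_simple_zeros:
  fixes Z :: "complex set"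
  assumes inf: "infinite Z" and fin: "\<And>r. finite (Z \<inter> cball 0 r)" and "0 \<notin> Z"
  obtains g where "g holomorphic_on UNIV" "\<And>z. g z = 0 \<longleftrightarrow> z \<in> Z" "\<And>z. z \<in> Z \<Longrightarrow> zorder g z = 1"
proof -
  have "closed Z" using locally_finite_imp_not_islimpt[OF fin] closed_limpt by blast
  then obtain a :: "nat \<Rightarrow> complex" where a: "inj a" "range a = Z" "filterlim a at_infinity at_top"
    using sequence_of_sparse_set_exists[OF inf _ fin] by metis
  interpret weierstrass_product' a
    by standard (use a \<open>0 \<notin> Z\<close> finite_vimageI[OF _ a(1)] in auto)
  show ?thesis
  proof (rule that[of f])
    fix z assume "z \<in> Z"
    then obtain n where n: "z = a n" using a by auto
    hence "a -` {z} = {n}" using a(1) by (auto simp: inj_def)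
    thus "zorder f z = 1" by (simp add: zorder)
  qed (use holomorphic zero a in auto)
qed

text \<open>
  Let \<open>g\<close> be an entire function with simple zeros exactly in \<open>Z\<close>. Then \<open>\<psi> - g' / g\<close> has only removable
  singularities, and \<open>f = g exp Q\<close> for a primitive \<open>Q\<close> of its entire extension. Near
  \<open>b \<in> Z\<close> write \<open>\<psi> = 1 / (z - b) + \<phi>\<close> with \<open>\<phi> b = 0\<close>; then
  \<open>\<psi>' + \<psi>\<^sup>2 = \<phi>' + 2 \<phi> / (z - b) + \<phi>\<^sup>2\<close> has a limit at \<open>b\<close>, because the double poles cancel and the simple
  pole has coefficient \<open>2 \<phi> b\<close>.
\<close>

theorem logarithmic_derivative_realization:
  fixes Z :: "complex set" and \<psi> :: "complex \<Rightarrow> complex"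
  assumes inf: "infinite Z" and fin: "\<And>r. finite (Z \<inter> cball 0 r)" and "0 \<notin> Z"
    and \<psi>: "\<psi> holomorphic_on - Z"
    and pole: "\<And>b. b \<in> Z \<Longrightarrow> ((\<lambda>z. \<psi> z - 1 / (z - b)) \<longlongrightarrow> 0) (at b)"
  obtains f A where "f holomorphic_on UNIV" "A holomorphic_on UNIV"
    "\<And>z. f z = 0 \<longleftrightarrow> z \<in> Z" "\<And>z. z \<notin> Z \<Longrightarrow> deriv f z = \<psi> z * f z"
    "\<And>z. z \<in> Z \<Longrightarrow> deriv f z \<noteq> 0"
    "\<And>z. deriv (deriv f) z + A z * f z = 0"
    "\<And>z. z \<notin> Z \<Longrightarrow> A z = - (deriv \<psi> z + (\<psi> z)\<^sup>2)"
proof -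
  obtain g where g: "g holomorphic_on UNIV" "\<And>z. g z = 0 \<longleftrightarrow> z \<in> Z" "\<And>z. z \<in> Z \<Longrightarrow> zorder g z = 1"
    using entire_with_simple_zeros[OF inf fin \<open>0 \<notin> Z\<close>] by metis
  have no_limpt: "\<not> z islimpt Z" for z by (rule locally_finite_imp_not_islimpt[OF fin])
  have clZ: "closed Z" using no_limpt closed_limpt by blast
  have ev_notin: "eventually (\<lambda>w. w \<notin> Z) (at z)" for z
    using no_limpt islimpt_iff_eventually by blast
  have open_Z: "open (- Z)" using clZ by auto
  have ana_off: "h analytic_on {z}" if "h holomorphic_on - Z" "z \<notin> Z" for h z
    using that open_Z by (auto simp: analytic_at)
  have sing: "isolated_singularity_at h z" if "h holomorphic_on - Z" for h z
  proof -
    obtain r where r: "r > 0" "\<And>w. w \<noteq> z \<Longrightarrow> dist w z < r \<Longrightarrow> w \<notin> Z"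
      using ev_notin[of z] by (auto simp: eventually_at)
    have "h analytic_on ball z r - {z}"
      by (rule analytic_on_subset[of h "- Z"])
        (use that open_Z r in \<open>auto simp: analytic_on_open dist_commute\<close>)
    thus ?thesis using r by (auto simp: isolated_singularity_at_def)
  qed
  have g_nz: "\<exists>w. g w \<noteq> 0" using g(2) \<open>0 \<notin> Z\<close> by blast
  have factor: "\<exists>r k. r > 0 \<and> k holomorphic_on ball b r \<and>
      (\<forall>w\<in>ball b r. g w = k w * (w - b) \<and> k w \<noteq> 0)" if b: "b \<in> Z" for b
  proof -
    obtain r where "r > 0" "zor_poly g b holomorphic_on cball b r"
      "\<forall>w\<in>cball b r. g w = zor_poly g b w * (w - b) ^ nat (zorder g b) \<and> zor_poly g b w \<noteq> 0"
      using zorder_exist_zero[OF g(1), of b] g_nz by auto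
    thus ?thesis using g(3)[OF b]
      by (intro exI[of _ r] exI[of _ "zor_poly g b"]) (auto intro: holomorphic_on_subset)
  qed
  have dfactor: "(g has_field_derivative (deriv k w * (w - b) + k w)) (at w)"
    if "k holomorphic_on ball b r" "\<forall>w\<in>ball b r. g w = k w * (w - b) \<and> k w \<noteq> 0" "w \<in> ball b r"
    for b r k w
  proof (rule has_field_derivative_transform_within_open[of "\<lambda>w. k w * (w - b)" _ _ "ball b r"])
    have "(k has_field_derivative deriv k w) (at w)"
      using that by (auto intro: holomorphic_derivI)
    thus "((\<lambda>w. k w * (w - b)) has_field_derivative (deriv k w * (w - b) + k w)) (at w)"
      by (auto intro!: derivative_eq_intros)
  qed (use that in auto)
  define H0 where "H0 = (\<lambda>z. \<psi> z - deriv g z / g z)"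
  have H0_holo: "H0 holomorphic_on - Z"
    unfolding H0_def
    by (intro holomorphic_intros \<psi> holomorphic_on_subset[OF g(1)] holomorphic_deriv[of _ UNIV] g(1) open_Z
        holomorphic_on_subset[OF holomorphic_deriv[OF g(1)]])
       (use g(2) in auto)
  have H0_lim: "\<exists>c. H0 \<midarrow>b\<rightarrow> c" if b: "b \<in> Z" for b
  proof -
    obtain r k where k: "r > 0" "k holomorphic_on ball b r"
      "\<forall>w\<in>ball b r. g w = k w * (w - b) \<and> k w \<noteq> 0"
      using factor[OF b] by blast
    have "eventually (\<lambda>w. w \<in> ball b r - {b}) (at b)"
      using k by (intro eventually_at_in_open) auto
    hence "eventually (\<lambda>w. (\<psi> w - 1 / (w - b)) - deriv k w / k w = H0 w) (at b)"
    proof eventually_elim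
      case (elim w)
      hence "deriv g w = deriv k w * (w - b) + k w"
        using dfactor[OF k(2,3)] by (auto intro: DERIV_imp_deriv)
      moreover have "g w = k w * (w - b)" "k w \<noteq> 0" "w - b \<noteq> 0" using k(3) elim by auto
      ultimately show ?case by (simp add: H0_def add_divide_distrib)
    qed
    moreover have "((\<lambda>w. (\<psi> w - 1 / (w - b)) - deriv k w / k w) \<longlongrightarrow> 0 - deriv k b / k b) (at b)"
    proof (intro tendsto_intros pole b)
      have "continuous_on (ball b r) k" "continuous_on (ball b r) (deriv k)"
        using k by (auto intro!: holomorphic_on_imp_continuous_on holomorphic_deriv)
      thus "k \<midarrow>b\<rightarrow> k b" "deriv k \<midarrow>b\<rightarrow> deriv k b"
        using k(1) by (auto simp: continuous_on_eq_continuous_at isCont_def)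
      show "k b \<noteq> 0" using k by auto
    qed
    ultimately have "H0 \<midarrow>b\<rightarrow> 0 - deriv k b / k b" by (rule Lim_transform_eventually[rotated])
    thus ?thesis ..
  qed
  have remove_holo: "remove_sings h holomorphic_on UNIV"
    if "h holomorphic_on - Z" "\<And>b. b \<in> Z \<Longrightarrow> \<exists>c. h \<midarrow>b\<rightarrow> c" for h
  proof -
    have "remove_sings h analytic_on {z}" for z
    proof (cases "z \<in> Z")
      case True
      from that(2)[OF True] obtain c where "h \<midarrow>z\<rightarrow> c" by blast
      thus ?thesis using remove_sings_analytic_at sing that(1) by blast
    next
      case False
      thus ?thesis using ana_off that(1) remove_sings_analytic_on by blast
    qed
    thus ?thesis using analytic_imp_holomorphic analytic_on_analytic_at by blast
  qed
  have remove_eq: "remove_sings h z = h z" if "h holomorphic_on - Z" "z \<notin> Z" for h z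
    using ana_off[OF that] by simp
  define H where "H = remove_sings H0"
  have H: "H holomorphic_on UNIV" unfolding H_def by (rule remove_holo[OF H0_holo H0_lim])
  have H_eq: "H z = \<psi> z - deriv g z / g z" if "z \<notin> Z" for z
    using remove_eq[OF H0_holo that] by (simp add: H_def H0_def)
  obtain Q where Q: "\<And>x. (Q has_field_derivative H x) (at x)"
    using holomorphic_convex_primitive'[OF convex_UNIV open_UNIV H] by auto
  define f where "f = (\<lambda>z. g z * exp (Q z))"
  have dg: "(g has_field_derivative deriv g z) (at z)" for z
    using g(1) by (auto intro: holomorphic_derivI)
  have df: "(f has_field_derivative (deriv g z + g z * H z) * exp (Q z)) (at z)" for z
    unfolding f_def by (auto intro!: derivative_eq_intros dg Q simp: algebra_simps)
  have f_holo: "f holomorphic_on UNIV"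
    using df by (auto simp: holomorphic_on_def field_differentiable_def)
  have f0: "f z = 0 \<longleftrightarrow> z \<in> Z" for z using g(2) by (simp add: f_def)
  have df_off: "deriv f z = \<psi> z * f z" if "z \<notin> Z" for z
    using DERIV_imp_deriv[OF df[of z]] H_eq[OF that] g(2)[of z] that by (simp add: f_def field_simps)
  have df_on: "deriv f b \<noteq> 0" if b: "b \<in> Z" for b
  proof -
    obtain r k where k: "r > 0" "k holomorphic_on ball b r"
      "\<forall>w\<in>ball b r. g w = k w * (w - b) \<and> k w \<noteq> 0"
      using factor[OF b] by blast
    have "deriv g b = k b" using dfactor[OF k(2,3), of b] k(1) by (auto dest: DERIV_imp_deriv)
    thus ?thesis using DERIV_imp_deriv[OF df[of b]] g(2)[of b] b k by auto
  qed
  define A0 where "A0 = (\<lambda>z. - (deriv \<psi> z + (\<psi> z)\<^sup>2))"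
  have A0_holo: "A0 holomorphic_on - Z"
    unfolding A0_def by (intro holomorphic_intros \<psi> open_Z)
  have A0_lim: "\<exists>c. A0 \<midarrow>b\<rightarrow> c" if b: "b \<in> Z" for b
  proof -
    define \<phi>0 where "\<phi>0 = (\<lambda>z. \<psi> z - 1 / (z - b))"
    define \<phi> where "\<phi> = remove_sings \<phi>0"
    have \<phi>0_holo: "\<phi>0 holomorphic_on - Z" unfolding \<phi>0_def
      using b by (intro holomorphic_intros \<psi>) auto
    have lim0: "\<phi>0 \<midarrow>b\<rightarrow> 0" using pole[OF b] by (simp add: \<phi>0_def)
    have \<phi>_ana: "\<phi> analytic_on {b}" unfolding \<phi>_def
      by (rule remove_sings_analytic_at[OF sing[OF \<phi>0_holo] lim0])
    have \<phi>b: "\<phi> b = 0" unfolding \<phi>_def using lim0 by blast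
    have \<phi>_eq: "\<phi> z = \<phi>0 z" if "z \<notin> Z" for z unfolding \<phi>_def by (rule remove_eq[OF \<phi>0_holo that])
    have "eventually (\<lambda>z. z \<notin> Z \<and> z \<noteq> b) (at b)"
      using ev_notin[of b] by (auto simp: eventually_at_filter elim: eventually_mono)
    hence "eventually (\<lambda>z. - (deriv \<phi> z + 2 * (\<phi> z / (z - b)) + (\<phi> z)\<^sup>2) = A0 z) (at b)"
    proof eventually_elim
      case (elim z)
      have "(\<psi> has_field_derivative deriv \<psi> z) (at z)"
        using elim \<psi> open_Z by (auto intro: holomorphic_derivI)
      hence "(\<phi>0 has_field_derivative deriv \<psi> z + 1 / (z - b)\<^sup>2) (at z)"
        unfolding \<phi>0_def using elim
        by (auto intro!: derivative_eq_intros simp: power2_eq_square)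
      hence "(\<phi> has_field_derivative deriv \<psi> z + 1 / (z - b)\<^sup>2) (at z)"
        by (rule has_field_derivative_transform_within_open[OF _ open_Z]) (use elim \<phi>_eq in auto)
      hence "deriv \<phi> z = deriv \<psi> z + 1 / (z - b)\<^sup>2" by (rule DERIV_imp_deriv)
      moreover have "\<psi> z = \<phi> z + 1 / (z - b)" using \<phi>_eq elim by (simp add: \<phi>0_def)
      moreover have "\<phi> z / (z - b) = \<phi> z * (1 / (z - b))" "1 / (z - b)\<^sup>2 = (1 / (z - b))\<^sup>2"
        by (simp_all add: power_one_over)
      ultimately have "- (deriv \<phi> z + 2 * (\<phi> z / (z - b)) + (\<phi> z)\<^sup>2) =
          - (deriv \<psi> z + (\<phi> z + 1 / (z - b))\<^sup>2)"
        by (simp add: power2_sum algebra_simps del: times_divide_eq_right)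
      thus ?case by (simp add: A0_def \<open>\<psi> z = \<phi> z + 1 / (z - b)\<close>)
    qed
    moreover have "((\<lambda>z. - (deriv \<phi> z + 2 * (\<phi> z / (z - b)) + (\<phi> z)\<^sup>2)) \<longlongrightarrow>
        - (deriv \<phi> b + 2 * deriv \<phi> b + (\<phi> b)\<^sup>2)) (at b)"
    proof (intro tendsto_intros)
      show "\<phi> \<midarrow>b\<rightarrow> \<phi> b" using \<phi>_ana by (intro isContD analytic_at_imp_isCont)
      have "deriv \<phi> analytic_on {b}" using \<phi>_ana by (rule analytic_deriv)
      thus "deriv \<phi> \<midarrow>b\<rightarrow> deriv \<phi> b" by (intro isContD analytic_at_imp_isCont)
      have "(\<phi> has_field_derivative deriv \<phi> b) (at b)"
        using \<phi>_ana analytic_on_imp_differentiable_at DERIV_deriv_iff_field_differentiable by blast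
      thus "(\<lambda>z. \<phi> z / (z - b)) \<midarrow>b\<rightarrow> deriv \<phi> b"
        by (simp add: has_field_derivative_iff \<phi>b)
    qed
    ultimately have "A0 \<midarrow>b\<rightarrow> - (deriv \<phi> b + 2 * deriv \<phi> b + (\<phi> b)\<^sup>2)"
      by (rule Lim_transform_eventually[rotated])
    thus ?thesis ..
  qed
  define A where "A = remove_sings A0"
  have A_holo: "A holomorphic_on UNIV" unfolding A_def by (rule remove_holo[OF A0_holo A0_lim])
  have A_eq: "A z = - (deriv \<psi> z + (\<psi> z)\<^sup>2)" if "z \<notin> Z" for z
    using remove_eq[OF A0_holo that] by (simp add: A_def A0_def)
  have ode_off: "deriv (deriv f) z + A z * f z = 0" if z: "z \<notin> Z" for z
  proof -
    have "(\<psi> has_field_derivative deriv \<psi> z) (at z)"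
      using z \<psi> open_Z by (auto intro: holomorphic_derivI)
    moreover have "(f has_field_derivative deriv f z) (at z)"
      using f_holo by (auto intro: holomorphic_derivI)
    ultimately have "((\<lambda>z. \<psi> z * f z) has_field_derivative deriv \<psi> z * f z + \<psi> z * deriv f z) (at z)"
      by (auto intro!: derivative_eq_intros)
    hence "(deriv f has_field_derivative deriv \<psi> z * f z + \<psi> z * deriv f z) (at z)"
      by (rule has_field_derivative_transform_within_open[OF _ open_Z]) (use z df_off in auto)
    hence "deriv (deriv f) z = deriv \<psi> z * f z + \<psi> z * deriv f z" by (rule DERIV_imp_deriv)
    thus ?thesis by (simp add: A_eq[OF z] df_off[OF z] power2_eq_square algebra_simps)
  qed
  have ode: "deriv (deriv f) z + A z * f z = 0" for z
  proof -
    have "continuous_on UNIV (\<lambda>z. deriv (deriv f) z + A z * f z)"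
      by (intro holomorphic_on_imp_continuous_on holomorphic_intros f_holo A_holo holomorphic_deriv) auto
    hence "(\<lambda>z. deriv (deriv f) z + A z * f z) \<midarrow>z\<rightarrow> deriv (deriv f) z + A z * f z"
      by (simp add: continuous_on_eq_continuous_at isCont_def)
    moreover have "(\<lambda>z. deriv (deriv f) z + A z * f z) \<midarrow>z\<rightarrow> 0"
      by (rule tendsto_eventually) (use ev_notin[of z] ode_off in \<open>auto elim: eventually_mono\<close>)
    ultimately show ?thesis using LIM_unique by blast
  qed
  show ?thesis by (rule that[OF f_holo A_holo f0 df_off df_on ode A_eq])
qed

section \<open>Counting functions and Wronskians\<close>

lemma zero_count_simple:
  assumes "f holomorphic_on UNIV" "\<And>z. f z = 0 \<Longrightarrow> deriv f z \<noteq> 0"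
  shows "zero_count f r = card {z. norm z \<le> r \<and> f z = 0}"
proof -
  have "zero_count f r = (\<Sum>z | norm z \<le> r \<and> f z = 0. 1)"
    unfolding zero_count_def
    by (intro sum.cong refl) (use zorder_simple_zero[OF assms(1)] assms(2) in auto)
  thus ?thesis by simp
qed

lemma zero_exponent_finite_imp_power_bound:
  assumes "zero_exponent f \<noteq> \<infinity>"
  shows "\<exists>K r0. \<forall>r\<ge>r0. real (zero_count f r) \<le> r ^ K"
proof -
  obtain K :: nat where B: "zero_exponent f < ereal (real K)"
    using assms less_PInf_Ex_of_nat by blast
  have "eventually (\<lambda>r. ereal (log_plus (real (zero_count f r)) / ln r) < ereal (real K)) at_top"
    using B unfolding zero_exponent_def by (rule Limsup_lessD)
  hence "eventually (\<lambda>r. real (zero_count f r) \<le> r ^ K) at_top"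
    using eventually_gt_at_top[of 1]
  proof eventually_elim
    case (elim r)
    have "log_plus (real (zero_count f r)) < real K * ln r"
      using elim by (simp add: pos_divide_less_eq)
    hence "ln (max 1 (real (zero_count f r))) \<le> ln (r ^ K)"
      using elim by (simp add: log_plus_def ln_realpow)
    hence "max 1 (real (zero_count f r)) \<le> r ^ K" using elim by (subst (asm) ln_le_cancel_iff) auto
    thus ?case by simp
  qed
  thus ?thesis by (auto simp: eventually_at_top_linorder)
qed

lemma nevanlinna_T_entire:
  assumes "f holomorphic_on UNIV"
  shows "nevanlinna_T f r = proximity f r"
proof -
  have "\<not> is_pole f z" for z using assms not_is_pole_holomorphic[of UNIV z f] by auto
  hence "pole_count f t = 0" for t by (simp add: pole_count_def)
  thus ?thesis by (simp add: nevanlinna_T_def integrated_pole_count_def)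
qed

lemma log_plus_circle_integrable:
  assumes "f holomorphic_on UNIV"
  shows "(\<lambda>t. log_plus (norm (f (of_real r * cis t)))) integrable_on {0..2 * pi}"
  unfolding log_plus_def
proof (rule integrable_continuous_real)
  have "continuous_on UNIV f" using assms holomorphic_on_imp_continuous_on by blast
  thus "continuous_on {0..2 * pi} (\<lambda>t. ln (max 1 (norm (f (of_real r * cis t)))))"
  proof -
    assume f: "continuous_on UNIV f"
    have "continuous_on {0..2 * pi} (\<lambda>t. f (of_real r * cis t))"
      by (rule continuous_on_compose2[OF f]) (auto intro!: continuous_intros)
    thus ?thesis by (intro continuous_intros) auto
  qed
qed

lemma proximity_ge:
  assumes "f holomorphic_on UNIV" "r \<ge> 0"
    and "\<And>z. norm z = r \<Longrightarrow> L \<le> log_plus (norm (f z))"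
  shows "L \<le> proximity f r"
proof -
  have "integral {0..2 * pi} (\<lambda>t. L) \<le> integral {0..2 * pi} (\<lambda>t. log_plus (norm (f (of_real r * cis t))))"
    using assms by (intro integral_le log_plus_circle_integrable) (auto simp: norm_mult)
  hence "2 * pi * L \<le> integral {0..2 * pi} (\<lambda>t. log_plus (norm (f (of_real r * cis t))))" by simp
  thus ?thesis unfolding proximity_def by (simp add: pos_le_divide_eq mult.commute)
qed

lemma proximity_le:
  assumes "f holomorphic_on UNIV" "r \<ge> 0"
    and "\<And>z. norm z = r \<Longrightarrow> log_plus (norm (f z)) \<le> L"
  shows "proximity f r \<le> L"
proof -
  have "integral {0..2 * pi} (\<lambda>t. log_plus (norm (f (of_real r * cis t)))) \<le> integral {0..2 * pi} (\<lambda>t. L)"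
    using assms by (intro integral_le log_plus_circle_integrable) (auto simp: norm_mult)
  hence "integral {0..2 * pi} (\<lambda>t. log_plus (norm (f (of_real r * cis t)))) \<le> 2 * pi * L" by simp
  thus ?thesis unfolding proximity_def by (simp add: pos_divide_le_eq mult.commute)
qed

lemma wronskian_constant:
  assumes "f holomorphic_on UNIV" "g holomorphic_on UNIV"
    and "\<And>z. deriv (deriv f) z + A z * f z = 0" "\<And>z. deriv (deriv g) z + A z * g z = 0"
  shows "f z * deriv g z - deriv f z * g z = f 0 * deriv g 0 - deriv f 0 * g 0"
proof -
  have D: "(h has_field_derivative deriv h z) (at z)" if "h holomorphic_on UNIV" for h z
    using that by (auto intro: holomorphic_derivI)
  have "((\<lambda>z. f z * deriv g z - deriv f z * g z) has_field_derivative 0) (at z)" for z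
  proof -
    have "((\<lambda>z. f z * deriv g z - deriv f z * g z) has_field_derivative
            (deriv f z * deriv g z + f z * deriv (deriv g) z) -
            (deriv (deriv f) z * g z + deriv f z * deriv g z)) (at z)"
      using assms by (auto intro!: derivative_eq_intros D holomorphic_deriv simp: algebra_simps)
    moreover have "deriv (deriv f) z = - A z * f z" "deriv (deriv g) z = - A z * g z"
      using assms(3,4)[of z] by (simp_all add: add_eq_0_iff)
    ultimately show ?thesis by simp
  qed
  hence "\<exists>c. \<forall>z. f z * deriv g z - deriv f z * g z = c"
    using has_field_derivative_zero_constant[of UNIV "\<lambda>z. f z * deriv g z - deriv f z * g z"] by auto
  thus ?thesis by metis
qed

lemma exists_normalized_solution:
  assumes A: "A holomorphic_on UNIV" and f: "f holomorphic_on UNIV" "f 0 \<noteq> 0"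
    and ode: "\<And>z. deriv (deriv f) z + A z * f z = 0"
  obtains g where "g holomorphic_on UNIV" "\<And>z. deriv (deriv g) z + A z * g z = 0"
    "\<And>z. f z * deriv g z - deriv f z * g z = 1"
proof -
  obtain g where g: "g holomorphic_on UNIV" "\<And>z. deriv (deriv g) z + A z * g z = 0"
    "g 0 = 0" "deriv g 0 = 1 / f 0"
    using entire_linear_ode_solution[OF A] by metis
  show ?thesis
    using wronskian_constant[OF f(1) g(1) ode g(2)] f(2) g by (intro that[of g]) auto
qed

text \<open>
  With Wronskian \<open>1\<close> the product is a Bank--Laine function, and it satisfies the first-order equation to which \<open>riccati_zeros_not_polynomially_bounded\<close> applies.
\<close>

lemma wronskian_1_product:
  assumes f: "f holomorphic_on UNIV" and g: "g holomorphic_on UNIV"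
    and W: "\<And>z. f z * deriv g z - deriv f z * g z = 1"
  shows "deriv (\<lambda>z. f z * g z) z = 1 + 2 * deriv f z * g z"
    and "f z * g z = 0 \<Longrightarrow> deriv (\<lambda>z. f z * g z) z = 1 \<or> deriv (\<lambda>z. f z * g z) z = -1"
    and "g z = 0 \<Longrightarrow> deriv g z \<noteq> 0"
proof -
  have "deriv (\<lambda>z. f z * g z) z = f z * deriv g z + deriv f z * g z"
    using f g by (intro DERIV_imp_deriv)
      (auto intro!: derivative_eq_intros holomorphic_derivI[of _ UNIV])
  thus *: "deriv (\<lambda>z. f z * g z) z = 1 + 2 * deriv f z * g z"
    using W[of z] by (simp add: algebra_simps)
  show "deriv (\<lambda>z. f z * g z) z = 1 \<or> deriv (\<lambda>z. f z * g z) z = -1" if "f z * g z = 0"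
  proof (cases "g z = 0")
    case False
    hence "- (deriv f z * g z) = 1" using that W[of z] by simp
    hence "deriv f z * g z = -1" by (metis minus_minus)
    hence "1 + 2 * deriv f z * g z = - 1" by (simp only: mult.assoc) simp
    thus ?thesis unfolding * by blast
  qed (simp add: *)
  show "g z = 0 \<Longrightarrow> deriv g z \<noteq> 0" using W[of z] by auto
qed

section \<open>A lacunary recursion for the logarithmic derivative\<close>

lemma square_le_power2: "m \<ge> 4 \<Longrightarrow> m ^ 2 \<le> (2::nat) ^ m"
proof (induction m rule: nat_induct_at_least)
  case (Suc m)
  have "(Suc m)\<^sup>2 \<le> 2 * m\<^sup>2"
  proof -
    have "4 * m \<le> m * m" using Suc by (intro mult_right_mono) auto
    hence "2 * m + 1 \<le> m * m" using Suc.hyps by linarith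
    thus ?thesis by (simp add: power2_eq_square)
  qed
  thus ?case using Suc.IH by simp
qed simp

text \<open>
  For \<open>\<bar>z\<bar>\<close> beyond the poles, the \<open>k\<close>-th approximant is bounded by \<open>\<bar>z\<bar>\<close> to the power \<open>degree_bound n k\<close>. The
  base-2 logarithm of the next radius is \<open>degree_bound n k + k + 10\<close>, so the radius
  exceeds any fixed power of this exponent by far; the power of two in the recursion is the \<open>n\<close>-th power of that radius.
\<close>

primrec degree_bound :: "nat \<Rightarrow> nat \<Rightarrow> nat" where
  "degree_bound n 0 = n"
| "degree_bound n (Suc k) =
     degree_bound n k + 3 + 2 * (4 * k + 1) * 2 ^ (n * (degree_bound n k + k + 10))"

locale lacunary_riccati =
  fixes n :: nat and l :: real
  assumes n_pos: "n > 0" and l: "0 \<le> l" "l \<le> real n"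
begin

abbreviation "C \<equiv> degree_bound n"

text \<open>
  The radius is \<open>R k = 2 ^ e k\<close>, and \<open>d k = R k ^ n\<close>. The number \<open>N k\<close> of new poles is \<open>R k\<close> to the
  power \<open>l\<close>, rounded down to a power of two: then \<open>N j\<close> divides \<open>N k\<close> for \<open>j \<le> k\<close>, and the \<open>N k\<close>-th power
  of an old pole of modulus \<open>R j\<close> is simply \<open>R j ^ N k\<close>. This makes \<open>X k\<close> a polynomial
  of degree \<open>k\<close> in \<open>y k\<close>. It is \<open>1\<close> at the new poles (where \<open>y k\<close> is \<open>1\<close>) and \<open>0\<close> at the old ones (where
  \<open>y k\<close> is some \<open>\<beta> k j\<close>). By \<open>l \<le> n\<close> also \<open>N k\<close> divides \<open>d k\<close>, so the last factor of \<open>U k\<close> is \<open>1\<close> at the new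
  poles.

  The function \<open>G k\<close> is \<open>(1 - (1 - U)\<^sup>2) / z\<close>, written without a division by \<open>z\<close>; and \<open>\<theta> k z / z\<close>
  is the logarithmic derivative of the local branches of \<open>w = (y - 1) z powr ((1 - N) / 2)\<close>. They solve the
  Euler equation \<open>w'' = (N\<^sup>2 - 1) / (4 z\<^sup>2) w\<close>, so \<open>w''\<close> vanishes at the zeros of \<open>w\<close>, which are the new
  poles; this is why \<open>\<theta> k z / z\<close> has no constant term there.
\<close>

definition e :: "nat \<Rightarrow> nat" where "e k = C k + k + 10"
definition R :: "nat \<Rightarrow> real" where "R k = 2 ^ e k"
definition d :: "nat \<Rightarrow> nat" where "d k = 2 ^ (n * e k)"
definition N :: "nat \<Rightarrow> nat" where "N k = 2 ^ nat \<lfloor>l * e k\<rfloor>"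
definition y :: "nat \<Rightarrow> complex \<Rightarrow> complex" where "y k z = (z / of_real (R k)) ^ N k"
definition \<beta> :: "nat \<Rightarrow> nat \<Rightarrow> real" where "\<beta> k j = (R j / R k) ^ N k"
definition X :: "nat \<Rightarrow> complex \<Rightarrow> complex" where
  "X k z = (\<Prod>j<k. (y k z - of_real (\<beta> k j)) / of_real (1 - \<beta> k j))"
definition U :: "nat \<Rightarrow> complex \<Rightarrow> complex" where
  "U k z = (X k z)\<^sup>2 * (z / of_real (R k)) ^ d k"
definition G :: "nat \<Rightarrow> complex \<Rightarrow> complex" where
  "G k z = (X k z)\<^sup>2 * (z ^ (d k - 1) / of_real (R k) ^ d k) * (2 - U k z)"
definition \<theta> :: "nat \<Rightarrow> complex \<Rightarrow> complex" where
  "\<theta> k z = of_nat (N k) / (y k z - 1) + of_nat (N k + 1) / 2"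
primrec \<psi>s :: "nat \<Rightarrow> complex \<Rightarrow> complex" where
  "\<psi>s 0 = (\<lambda>z. z ^ n)"
| "\<psi>s (Suc k) = (\<lambda>z. \<psi>s k z + G k z * (\<theta> k z - z * \<psi>s k z))"
definition \<delta> :: "nat \<Rightarrow> complex \<Rightarrow> complex" where
  "\<delta> k z = G k z * (\<theta> k z - z * \<psi>s k z)"
definition Zk :: "nat \<Rightarrow> complex set" where "Zk k = {z. z ^ N k = of_real (R k) ^ N k}"
definition Zs :: "nat \<Rightarrow> complex set" where "Zs k = (\<Union>j<k. Zk j)"

lemma e_Suc: "e k + 6 \<le> e (Suc k)"
proof -
  have "(1::nat) * 1 * 1 \<le> (4 * k + 1) * 2 ^ (n * (C k + k + 10))" by (intro mult_le_mono) auto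
  thus ?thesis by (simp add: e_def)
qed

lemma e_less: "j < k \<Longrightarrow> e j + 6 \<le> e k"
proof (induction k)
  case (Suc k)
  thus ?case using e_Suc[of k] by (cases "j = k") auto
qed simp

lemma e_ge: "e k \<ge> k + 10" by (simp add: e_def)
lemma C_ge: "C k \<ge> n" by (induction k) auto
lemma R_pos: "R k > 0" by (simp add: R_def)
lemma R_neq_0 [simp]: "R k \<noteq> 0" using R_pos[of k] by linarith
lemma R_ge: "R k \<ge> 1024"
proof -
  have "(2::real) ^ 10 \<le> 2 ^ e k" using e_ge[of k] by (intro power_increasing) auto
  thus ?thesis by (simp add: R_def)
qed
lemma R_less: "j < k \<Longrightarrow> 64 * R j \<le> R k"
proof -
  assume "j < k"
  hence "(2::real) ^ (e j + 6) \<le> 2 ^ e k" using e_less by (intro power_increasing) auto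
  thus ?thesis by (simp add: R_def power_add)
qed
lemma R_mono: "j \<le> k \<Longrightarrow> R j \<le> R k"
proof (cases "j = k")
  case False
  moreover assume "j \<le> k"
  ultimately show ?thesis using R_less[of j k] R_pos[of j] by simp
qed simp
lemma R_ge_k: "R k \<ge> real k + 1"
proof -
  have "k + 1 \<le> 2 ^ k" using less_exp[of k] by linarith
  also have "\<dots> \<le> 2 ^ e k" using e_ge[of k] by (intro power_increasing) auto
  finally have "real (k + 1) \<le> real (2 ^ e k)" by (simp only: of_nat_le_iff)
  thus ?thesis by (simp add: R_def)
qed

lemma N_ge1: "N k \<ge> 1" by (simp add: N_def)
lemma d_ge1: "d k \<ge> 1" by (simp add: d_def)
lemma real_d: "real (d k) = R k ^ n" by (simp add: d_def R_def mult.commute flip: power_mult)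
lemma floor_le: "nat \<lfloor>l * real (e k)\<rfloor> \<le> n * e k"
proof -
  have "l * real (e k) \<le> real n * real (e k)" using l by (intro mult_right_mono) auto
  hence "\<lfloor>l * real (e k)\<rfloor> \<le> \<lfloor>real (n * e k)\<rfloor>" by (intro floor_mono) auto
  hence "\<lfloor>l * real (e k)\<rfloor> \<le> int (n * e k)" by (simp only: floor_of_nat)
  thus ?thesis by (simp only: nat_le_iff)
qed
lemma N_dvd_d: "N k dvd d k" unfolding N_def d_def by (rule le_imp_power_dvd[OF floor_le])
lemma N_le_d: "N k \<le> d k" using N_dvd_d[of k] d_ge1[of k] by (intro dvd_imp_le) auto
lemma N_dvd_N: "j \<le> k \<Longrightarrow> N j dvd N k"
proof -
  assume "j \<le> k"
  hence "e j \<le> e k" using e_less[of j k] by (cases "j = k") auto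
  hence "l * real (e j) \<le> l * real (e k)" using l by (intro mult_left_mono) auto
  hence "nat \<lfloor>l * e j\<rfloor> \<le> nat \<lfloor>l * e k\<rfloor>" by (intro nat_mono floor_mono)
  thus ?thesis unfolding N_def by (rule le_imp_power_dvd)
qed

lemma R_powr_l: "R k powr l = 2 powr (l * e k)"
proof -
  have "R k = 2 powr real (e k)" by (simp add: R_def powr_realpow)
  thus ?thesis by (simp add: powr_powr mult.commute)
qed
lemma N_eq_powr: "real (N k) = 2 powr of_int \<lfloor>l * e k\<rfloor>"
proof -
  have "\<lfloor>l * e k\<rfloor> \<ge> 0" using l by simp
  hence "real (nat \<lfloor>l * e k\<rfloor>) = of_int \<lfloor>l * e k\<rfloor>" by simp
  thus ?thesis unfolding N_def by (metis of_nat_numeral of_nat_power powr_realpow zero_less_numeral)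
qed
lemma N_le_powr: "real (N k) \<le> R k powr l"
  unfolding N_eq_powr R_powr_l by (rule powr_mono[OF of_int_floor_le]) simp
lemma N_ge_powr: "R k powr l \<le> 2 * real (N k)"
proof -
  have "2 powr (l * e k) \<le> 2 powr (1 + of_int \<lfloor>l * e k\<rfloor>)" by (intro powr_mono) linarith+
  thus ?thesis unfolding N_eq_powr R_powr_l by (simp add: powr_add)
qed

text \<open>
  The factor \<open>1 / 2 ^ d k\<close> gained at radius \<open>R k / 2\<close> beats \<open>R k ^ C k = 2 ^ (e k * C k)\<close>, the bound for the
  \<open>k\<close>-th approximant there.
\<close>

lemma d_large: "e k * C k + k + 5 \<le> d k"
proof -
  have "e k * C k + k + 5 \<le> e k * e k"
  proof -
    have "e k * e k = e k * C k + e k * (k + 10)" by (simp add: e_def algebra_simps)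
    moreover have "e k * (k + 10) \<ge> 1 * (k + 10)" using e_ge[of k] by (intro mult_le_mono) auto
    ultimately show ?thesis unfolding mult_1 by linarith
  qed
  also have "\<dots> \<le> 2 ^ e k" using square_le_power2[of "e k"] e_ge[of k] by (simp add: power2_eq_square)
  also have "\<dots> \<le> d k" unfolding d_def using n_pos by (intro power_increasing) auto
  finally show ?thesis .
qed

lemma C_Suc: "C (Suc k) = C k + 3 + 2 * (4 * k + 1) * d k"
  by (simp add: d_def e_def)

lemma C_Suc_le: "C (Suc k) \<le> 12 * (k + 1) * d k"
proof -
  have "C k \<le> e k" by (simp add: e_def)
  also have "\<dots> < 2 ^ e k" by (rule less_exp)
  also have "\<dots> \<le> d k" unfolding d_def using n_pos by (intro power_increasing) auto
  finally have "C k \<le> d k" by simp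
  thus ?thesis using d_ge1[of k] unfolding C_Suc by (simp add: algebra_simps)
qed

lemma \<beta>_bounds: "j < k \<Longrightarrow> 0 < \<beta> k j \<and> \<beta> k j \<le> 1 / 4"
proof -
  assume "j < k"
  hence q: "R j / R k \<le> 1 / 4" "0 < R j / R k" "R j / R k \<le> 1" using R_less[of j k] R_pos[of j] R_pos[of k]
    by (auto simp: pos_divide_le_eq)
  hence "(R j / R k) ^ N k \<le> (R j / R k) ^ 1" using N_ge1[of k] by (intro power_decreasing) auto
  hence "(R j / R k) ^ N k \<le> 1 / 4" using q(1) unfolding power_one_right by (rule order_trans)
  thus ?thesis using q by (simp add: \<beta>_def)
qed

lemma one_minus_\<beta>: "j < k \<Longrightarrow> 1 - \<beta> k j \<noteq> 0"
  using \<beta>_bounds[of j k] by auto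

lemma norm_Zk: "z \<in> Zk k \<Longrightarrow> norm z = R k"
proof -
  assume "z \<in> Zk k"
  hence "norm z ^ N k = R k ^ N k"
    unfolding Zk_def by (metis (mono_tags) R_pos mem_Collect_eq norm_of_real norm_power abs_of_pos)
  thus ?thesis using N_ge1[of k] R_pos[of k] by (auto intro!: power_eq_imp_eq_base[of "norm z" "N k" "R k"])
qed
lemma Zk_iff: "z \<in> Zk k \<longleftrightarrow> y k z = 1"
  by (simp add: Zk_def y_def power_divide)
lemma Zk_disjoint: "j \<noteq> k \<Longrightarrow> Zk j \<inter> Zk k = {}"
proof -
  assume "j \<noteq> k"
  hence "R j \<noteq> R k" using R_less[of j k] R_less[of k j] R_pos[of j] R_pos[of k]
    by (cases "j < k") auto
  thus ?thesis using norm_Zk by (metis disjoint_iff)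
qed
lemma card_Zk: "card (Zk k) = N k"
  unfolding Zk_def using N_ge1[of k] by (intro card_nth_roots) auto
lemma finite_Zk: "finite (Zk k)"
  using card_Zk[of k] N_ge1[of k] by (intro card_ge_0_finite) linarith
lemma finite_Zs: "finite (Zs k)" by (simp add: Zs_def finite_Zk)
lemma Zs_Suc: "Zs (Suc k) = Zs k \<union> Zk k" by (auto simp: Zs_def lessThan_Suc)
lemma Zs_Zk_disjoint: "Zs k \<inter> Zk k = {}"
proof -
  have "Zk j \<inter> Zk k = {}" if "j < k" for j using Zk_disjoint[of j k] that by simp
  thus ?thesis unfolding Zs_def by blast
qed

lemma X_eq_1: "z \<in> Zk k \<Longrightarrow> X k z = 1"
  unfolding X_def Zk_iff
proof (intro prod.neutral ballI)
  fix j assume "y k z = 1" "j \<in> {..<k}"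
  thus "(y k z - of_real (\<beta> k j)) / of_real (1 - \<beta> k j) = 1"
    using one_minus_\<beta>[of j k]
    by (metis div_self lessThan_iff of_real_1 of_real_diff of_real_eq_0_iff)
qed
lemma U_eq_1: "z \<in> Zk k \<Longrightarrow> U k z = 1"
proof -
  assume z: "z \<in> Zk k"
  obtain m where m: "d k = N k * m" using N_dvd_d[of k] unfolding dvd_def by blast
  have "(z / of_real (R k)) ^ d k = y k z ^ m" unfolding m y_def by (rule power_mult)
  also have "y k z = 1" using z by (simp only: Zk_iff)
  finally show ?thesis using X_eq_1[OF z] by (simp only: U_def power_one mult_1)
qed
lemma X_eq_0: "z \<in> Zs k \<Longrightarrow> X k z = 0"
proof -
  assume "z \<in> Zs k"
  then obtain j where j: "j < k" "z \<in> Zk j" by (auto simp: Zs_def)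
  obtain m where m: "N k = N j * m" using N_dvd_N[of j k] j unfolding dvd_def by auto
  have zj: "z ^ N j = of_real (R j) ^ N j" using j(2) unfolding Zk_def by blast
  have "z ^ N k = of_real (R j) ^ N k" unfolding m power_mult zj ..
  hence "y k z = of_real (\<beta> k j)"
    unfolding y_def \<beta>_def power_divide of_real_divide of_real_power by (rule arg_cong)
  hence "y k z - of_real (\<beta> k j) = 0" by simp
  thus ?thesis unfolding X_def using j by (intro prod_zero) auto
qed
lemma G_eq_0: "z \<in> Zs k \<Longrightarrow> G k z = 0" by (simp add: G_def X_eq_0)

lemma zG: "z * G k z = U k z * (2 - U k z)"
proof -
  have "z * z ^ (d k - 1) = z ^ d k" using d_ge1[of k] by (simp flip: power_Suc)
  thus ?thesis unfolding G_def by (simp add: U_def power_divide mult_ac)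
qed

text \<open>
  The recursion as a combination of the old approximant and \<open>\<theta> k z / z\<close> with weights \<open>(1 - U)\<^sup>2\<close> and
  \<open>1 - (1 - U)\<^sup>2 = z G k z\<close>.
\<close>

lemma \<psi>s_Suc: "\<psi>s (Suc k) z = (1 - U k z)\<^sup>2 * \<psi>s k z + G k z * \<theta> k z"
proof -
  have "\<psi>s (Suc k) z = (1 - z * G k z) * \<psi>s k z + G k z * \<theta> k z"
    by (simp add: algebra_simps)
  also have "1 - z * G k z = (1 - U k z)\<^sup>2"
    unfolding zG by (simp add: power2_eq_square algebra_simps)
  finally show ?thesis .
qed
declare \<psi>s.simps(2) [simp del]
lemma \<psi>s_Suc_\<delta>: "\<psi>s (Suc k) z = \<psi>s k z + \<delta> k z" by (simp add: \<psi>s.simps(2) \<delta>_def)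
lemma \<psi>s_eq_sum: "\<psi>s k z = z ^ n + (\<Sum>j<k. \<delta> j z)"
  by (induction k) (auto simp: \<psi>s_Suc_\<delta>)

lemma y_holo [holomorphic_intros]: "y k holomorphic_on A"
  unfolding y_def by (intro holomorphic_intros) auto
lemma X_holo [holomorphic_intros]: "X k holomorphic_on A"
  unfolding X_def using one_minus_\<beta>[of _ k]
  by (intro holomorphic_intros) (simp only: of_real_eq_0_iff lessThan_iff not_False_eq_True)
lemma U_holo [holomorphic_intros]: "U k holomorphic_on A"
  unfolding U_def by (intro holomorphic_intros) auto
lemma G_holo [holomorphic_intros]: "G k holomorphic_on A"
  unfolding G_def by (intro holomorphic_intros) auto
lemma \<theta>_holo: "\<theta> k holomorphic_on - Zk k"
  unfolding \<theta>_def by (intro holomorphic_intros) (auto simp: Zk_iff)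
lemma \<psi>s_holo: "\<psi>s k holomorphic_on - Zs k"
proof (induction k)
  case (Suc k)
  show ?case unfolding Zs_Suc \<psi>s.simps(2)
    by (intro holomorphic_intros holomorphic_on_subset[OF Suc] holomorphic_on_subset[OF \<theta>_holo]) auto
qed (auto intro!: holomorphic_intros)

end

section \<open>Poles of the approximants\<close>

lemma one_plus_power_expansion:
  "\<exists>p. \<forall>t::complex. (1 + t) ^ m =
     1 + of_nat m * t + of_nat m * (of_nat m - 1) / 2 * t\<^sup>2 + t ^ 3 * poly p t"
proof (induction m)
  case 0
  show ?case by (intro exI[of _ 0]) auto
next
  case (Suc m)
  then obtain p where p: "\<And>t::complex. (1 + t) ^ m =
     1 + of_nat m * t + of_nat m * (of_nat m - 1) / 2 * t\<^sup>2 + t ^ 3 * poly p t" by blast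
  show ?case
    by (intro exI[of _ "[:of_nat m * (of_nat m - 1) / 2:] + [:1, 1:] * p"] allI)
      (simp add: p power_Suc2 del: power_Suc, simp add: field_simps power2_eq_square power3_eq_cube)
qed

lemma partial_fraction_identity:
  fixes b t s m :: complex
  assumes "t \<noteq> 0" "1 + t \<noteq> 0" "s \<noteq> 0" "b \<noteq> 0"
  shows "(m / (t * s) + (m + 1) / 2) / (b * (1 + t)) - 1 / (b * t) =
         (2 * m + (m + 1) * t * s - 2 * s * (1 + t)) / (2 * b * t * s * (1 + t))"
proof -
  have "(m / (t * s) + (m + 1) / 2) = (2 * m + (m + 1) * t * s) / (2 * t * s)"
    using assms by (simp add: add_divide_eq_iff divide_add_eq_iff mult_ac)
  moreover have "1 / (b * t) = (2 * s * (1 + t)) / (2 * b * t * s * (1 + t))"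
    using assms by simp
  ultimately show ?thesis by (simp add: diff_divide_distrib mult_ac)
qed

lemma holo_tendsto: "f holomorphic_on UNIV \<Longrightarrow> f \<midarrow>b\<rightarrow> f b"
  by (meson UNIV_I analytic_at_imp_isCont analytic_on_analytic_at analytic_on_open isContD open_UNIV)

lemma holo_quotient_tendsto:
  "f holomorphic_on UNIV \<Longrightarrow> (\<lambda>z. (f z - f b) / (z - b)) \<midarrow>b\<rightarrow> deriv f b"
  using holomorphic_derivI[of f UNIV b] by (simp add: has_field_derivative_iff)

context lacunary_riccati
begin

text \<open>
  With \<open>t = z / b - 1\<close>, \<open>y k z = (1 + t) ^ N k\<close> is known up to third order in \<open>t\<close>, and the constant
  \<open>(N + 1) / 2\<close> in \<open>\<theta>\<close> is exactly what cancels the constant term at the pole.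
\<close>

lemma \<theta>_tendsto:
  assumes b: "b \<in> Zk k"
  shows "((\<lambda>z. \<theta> k z / z - 1 / (z - b)) \<longlongrightarrow> 0) (at b)"
proof -
  define m :: complex where "m = of_nat (N k)"
  define a where "a = m * (m - 1) / 2"
  obtain p where p: "\<And>t::complex. (1 + t) ^ N k = 1 + m * t + a * t\<^sup>2 + t ^ 3 * poly p t"
    using one_plus_power_expansion[of "N k"] unfolding m_def a_def by blast
  have m0: "m \<noteq> 0" using N_ge1[of k] by (simp add: m_def)
  have b0: "b \<noteq> 0" using norm_Zk[OF b] R_pos[of k] by auto
  define s where "s = (\<lambda>t. m + a * t + t\<^sup>2 * poly p t)"
  define q where "q = (\<lambda>t. (m - 1) * a - 2 * poly p t + (m - 1) * t * poly p t)"
  define T where "T = (\<lambda>z. z / b - 1)"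
  have y_eq: "y k z = (1 + T z) ^ N k" for z
  proof -
    have "b ^ N k = of_real (R k) ^ N k" using b by (simp add: Zk_def)
    thus ?thesis by (simp add: y_def T_def power_divide)
  qed
  have T: "T \<midarrow>b\<rightarrow> 0" unfolding T_def using b0 by (auto intro!: tendsto_eq_intros)
  have sT: "(\<lambda>z. s (T z)) \<midarrow>b\<rightarrow> m" and qT: "(\<lambda>z. q (T z)) \<midarrow>b\<rightarrow> q 0"
    unfolding s_def q_def
    by (auto intro!: tendsto_eq_intros T isCont_tendsto_compose[OF poly_isCont T])
  have "(\<lambda>z. T z * q (T z) / (2 * b * s (T z) * (1 + T z))) \<midarrow>b\<rightarrow> 0 * q 0 / (2 * b * m * (1 + 0))"
    using m0 b0 by (intro tendsto_intros T sT qT) auto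
  moreover have "eventually (\<lambda>z. T z * q (T z) / (2 * b * s (T z) * (1 + T z)) =
      \<theta> k z / z - 1 / (z - b)) (at b)"
  proof -
    have "eventually (\<lambda>z. s (T z) \<noteq> 0) (at b)" using tendsto_imp_eventually_ne[OF sT m0] .
    moreover have "eventually (\<lambda>z. z \<noteq> 0) (at b)"
      using tendsto_imp_eventually_ne[OF tendsto_ident_at b0] .
    moreover have "eventually (\<lambda>z. z \<noteq> b) (at b)" by (simp add: eventually_at_filter)
    ultimately show ?thesis
    proof eventually_elim
      case (elim z)
      define t where "t = T z"
      have z: "z = b * (1 + t)" using b0 by (simp add: t_def T_def)
      have t: "t \<noteq> 0" "1 + t \<noteq> 0" "s t \<noteq> 0"
        using elim b0 by (simp_all add: t_def T_def)
      have y1: "y k z - 1 = t * s t"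
        unfolding y_eq t_def[symmetric] p s_def by (simp add: algebra_simps power2_eq_square power3_eq_cube)
      have key: "2 * m + (m + 1) * t * s t - 2 * s t * (1 + t) = t\<^sup>2 * q t"
        unfolding s_def q_def a_def by (simp add: field_simps power2_eq_square power3_eq_cube)
      have "\<theta> k z / z - 1 / (z - b) = (m / (t * s t) + (m + 1) / 2) / (b * (1 + t)) - 1 / (b * t)"
      proof -
        have "\<theta> k z = m / (t * s t) + (m + 1) / 2" unfolding \<theta>_def y1 by (simp add: m_def add_ac)
        moreover have "z - b = b * t" using z by (simp add: algebra_simps)
        ultimately show ?thesis by (simp only: z)
      qed
      also have "\<dots> = (2 * m + (m + 1) * t * s t - 2 * s t * (1 + t)) / (2 * b * t * s t * (1 + t))"
        using t b0 by (rule partial_fraction_identity)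
      also have "\<dots> = t * q t / (2 * b * s t * (1 + t))"
        unfolding key using t b0 by (simp add: divide_simps power2_eq_square)
      finally show ?case by (simp add: t_def)
    qed
  qed
  ultimately show ?thesis using Lim_transform_eventually by force
qed

lemma \<theta>_tendsto_off: "b \<notin> Zk k \<Longrightarrow> \<theta> k \<midarrow>b\<rightarrow> \<theta> k b"
  unfolding \<theta>_def by (intro tendsto_intros holo_tendsto y_holo) (auto simp: Zk_iff)

text \<open>
  The correction has the factor \<open>X\<^sup>2\<close>, which vanishes to second order at an old pole and therefore
  absorbs the simple pole of \<open>\<psi>s k\<close>.
\<close>

lemma \<delta>_tendsto:
  assumes b: "b \<in> Zs k" and pole: "((\<lambda>z. \<psi>s k z - 1 / (z - b)) \<longlongrightarrow> 0) (at b)"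
  shows "\<delta> k \<midarrow>b\<rightarrow> 0"
proof -
  define c where "c = (\<lambda>z. (z ^ (d k - 1) / of_real (R k) ^ d k) * (2 - U k z))"
  have c: "c \<midarrow>b\<rightarrow> c b" unfolding c_def by (intro holo_tendsto holomorphic_intros) auto
  have Gc: "G k z = (X k z)\<^sup>2 * c z" for z by (simp add: G_def c_def)
  have X0: "X k b = 0" by (rule X_eq_0[OF b])
  have X: "X k \<midarrow>b\<rightarrow> 0" using holo_tendsto[OF X_holo, of k b] X0 by simp
  have Xq: "(\<lambda>z. X k z / (z - b)) \<midarrow>b\<rightarrow> deriv (X k) b"
    using holo_quotient_tendsto[OF X_holo, of k b] X0 by simp
  have bk: "b \<notin> Zk k" using b Zs_Zk_disjoint by blast
  have "(\<lambda>z. (X k z)\<^sup>2 * c z * \<theta> k z - c z * z * (X k z * (X k z / (z - b)) +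
          (X k z)\<^sup>2 * (\<psi>s k z - 1 / (z - b)))) \<midarrow>b\<rightarrow>
        0\<^sup>2 * c b * \<theta> k b - c b * b * (0 * deriv (X k) b + 0\<^sup>2 * 0)"
    by (intro tendsto_intros X c Xq \<theta>_tendsto_off bk pole)
  moreover have "eventually (\<lambda>z. (X k z)\<^sup>2 * c z * \<theta> k z - c z * z * (X k z * (X k z / (z - b)) +
          (X k z)\<^sup>2 * (\<psi>s k z - 1 / (z - b))) = \<delta> k z) (at b)"
    by (intro always_eventually allI) (simp add: \<delta>_def Gc algebra_simps power2_eq_square)
  ultimately show ?thesis using Lim_transform_eventually by force
qed

text \<open>
  At a new pole \<open>(1 - U)\<^sup>2\<close> vanishes to second order, so that \<open>\<psi>s (Suc k)\<close> agrees with \<open>\<theta> k z / z\<close>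
  up to a term that tends to \<open>0\<close>.
\<close>

lemma \<psi>s_pole: "b \<in> Zs k \<Longrightarrow> ((\<lambda>z. \<psi>s k z - 1 / (z - b)) \<longlongrightarrow> 0) (at b)"
proof (induction k)
  case (Suc k)
  show ?case
  proof (cases "b \<in> Zs k")
    case True
    have "((\<lambda>z. (\<psi>s k z - 1 / (z - b)) + \<delta> k z) \<longlongrightarrow> 0 + 0) (at b)"
      by (intro tendsto_add Suc.IH \<delta>_tendsto True)
    thus ?thesis by (simp add: \<psi>s_Suc_\<delta> algebra_simps)
  next
    case False
    with Suc.prems have b: "b \<in> Zk k" by (simp add: Zs_Suc)
    have b0: "b \<noteq> 0" using norm_Zk[OF b] R_pos[of k] by auto
    have U1: "U k b = 1" by (rule U_eq_1[OF b])
    have U: "(\<lambda>z. 1 - U k z) \<midarrow>b\<rightarrow> 0"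
      using tendsto_diff[OF tendsto_const[of 1] holo_tendsto[OF U_holo, of k b]] U1 by simp
    have Uq: "(\<lambda>z. (1 - U k z) / (z - b)) \<midarrow>b\<rightarrow> - deriv (U k) b"
    proof -
      have "(\<lambda>z. - ((U k z - U k b) / (z - b))) \<midarrow>b\<rightarrow> - deriv (U k) b"
        by (intro tendsto_minus holo_quotient_tendsto U_holo)
      thus ?thesis using U1 by (simp add: minus_divide_left)
    qed
    have ps: "\<psi>s k \<midarrow>b\<rightarrow> \<psi>s k b"
    proof -
      have "open (- Zs k)" using finite_Zs finite_imp_closed by blast
      hence "\<psi>s k analytic_on {b}" using \<psi>s_holo False by (auto simp: analytic_at)
      thus ?thesis by (intro isContD analytic_at_imp_isCont)
    qed
    define t where "t = (\<lambda>z. \<theta> k z / z - 1 / (z - b))"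
    have t: "t \<midarrow>b\<rightarrow> 0" unfolding t_def by (rule \<theta>_tendsto[OF b])
    have "(\<lambda>z. t z + (1 - U k z)\<^sup>2 * \<psi>s k z -
             (1 - U k z) * ((1 - U k z) / (z - b) * ((z - b) * t z + 1))) \<midarrow>b\<rightarrow>
          0 + 0\<^sup>2 * \<psi>s k b - 0 * (- deriv (U k) b * ((b - b) * 0 + 1))"
      by (intro tendsto_intros U Uq ps t)
    moreover have "eventually (\<lambda>z. t z + (1 - U k z)\<^sup>2 * \<psi>s k z -
             (1 - U k z) * ((1 - U k z) / (z - b) * ((z - b) * t z + 1)) =
             \<psi>s (Suc k) z - 1 / (z - b)) (at b)"
    proof -
      have "eventually (\<lambda>z. z \<noteq> 0) (at b)"
        using tendsto_imp_eventually_ne[OF tendsto_ident_at b0] .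
      moreover have "eventually (\<lambda>z. z \<noteq> b) (at b)" by (simp add: eventually_at_filter)
      ultimately show ?thesis
      proof eventually_elim
        case (elim z)
        have tz: "(z - b) * t z + 1 = (z - b) * (\<theta> k z / z)" 
          using elim by (simp add: t_def right_diff_distrib)
        have "(1 - U k z) * ((1 - U k z) / (z - b) * ((z - b) * t z + 1)) = (1 - U k z)\<^sup>2 * (\<theta> k z / z)"
          unfolding tz using elim by (simp add: power2_eq_square)
        moreover have "G k z * \<theta> k z = (1 - (1 - U k z)\<^sup>2) * (\<theta> k z / z)"
        proof -
          have "1 - (1 - U k z)\<^sup>2 = z * G k z" unfolding zG by (simp add: power2_eq_square algebra_simps)
          thus ?thesis using elim by simp
        qed
        ultimately show ?case unfolding \<psi>s_Suc by (simp add: t_def algebra_simps)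
      qed
    qed
    ultimately show ?thesis using Lim_transform_eventually by force
  qed
qed (simp add: Zs_def)

lemma \<delta>_eq_0: "b \<in> Zs k \<Longrightarrow> \<delta> k b = 0" by (simp add: \<delta>_def G_eq_0)

text \<open>
  At the old poles \<open>G k\<close> is \<open>0\<close>, so \<open>\<delta> k\<close> has the value \<open>0\<close> there, which is also its limit.
\<close>

lemma \<delta>_holo: "\<delta> k holomorphic_on ball 0 (R k)"
proof (rule no_isolated_singularity'[of "Zs k"])
  fix z assume "z \<in> Zs k"
  thus "(\<delta> k \<longlongrightarrow> \<delta> k z) (at z within ball 0 (R k))"
    using \<delta>_tendsto[OF _ \<psi>s_pole] \<delta>_eq_0[of z k] by (simp add: Lim_at_imp_Lim_at_within)
next
  show "\<delta> k holomorphic_on ball 0 (R k) - Zs k"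
    unfolding \<delta>_def using norm_Zk[of _ k]
    by (intro holomorphic_intros holomorphic_on_subset[OF \<psi>s_holo] holomorphic_on_subset[OF \<theta>_holo]) auto
qed (use finite_Zs in auto)

lemma norm_y: "norm (y k z) = (norm z / R k) ^ N k"
  using R_pos[of k] by (simp add: y_def norm_power norm_divide)

lemma norm_y_inner: "norm z \<le> R k / 2 \<Longrightarrow> norm (y k z) \<le> 1 / 2"
proof -
  assume "norm z \<le> R k / 2"
  hence q: "norm z / R k \<le> 1 / 2" using R_pos[of k] by (simp add: pos_divide_le_eq)
  have "(norm z / R k) ^ N k \<le> (1 / 2) ^ N k" using q R_pos[of k] by (intro power_mono) auto
  also have "\<dots> \<le> (1 / 2) ^ 1" using N_ge1[of k] by (intro power_decreasing) auto
  finally show ?thesis unfolding norm_y by simp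
qed

lemma norm_y_outer: "norm z \<ge> 2 * R k \<Longrightarrow> norm (y k z) \<ge> 2"
proof -
  assume "norm z \<ge> 2 * R k"
  hence q: "norm z / R k \<ge> 2" using R_pos[of k] by (simp add: pos_le_divide_eq)
  have "(2::real) ^ 1 \<le> 2 ^ N k" using N_ge1[of k] by (intro power_increasing) auto
  also have "\<dots> \<le> (norm z / R k) ^ N k" using q by (intro power_mono) auto
  finally show ?thesis unfolding norm_y by simp
qed

lemma norm_X_factor:
  assumes "j < k"
  shows "norm ((y k z - of_real (\<beta> k j)) / of_real (1 - \<beta> k j)) =
           norm (y k z - of_real (\<beta> k j)) / (1 - \<beta> k j)"
  using \<beta>_bounds[OF assms] by (simp only: norm_divide norm_of_real) simp

lemma norm_X_inner: assumes "norm z \<le> R k / 2" shows "norm (X k z) \<le> 1"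
proof -
  have "norm ((y k z - of_real (\<beta> k j)) / of_real (1 - \<beta> k j)) \<le> 1" if "j < k" for j
  proof -
    have "norm (y k z - of_real (\<beta> k j)) \<le> 1/2 + 1/4"
      using norm_triangle_ineq4[of "y k z" "of_real (\<beta> k j)"] norm_y_inner[OF assms] \<beta>_bounds[OF that]
      by simp
    thus ?thesis unfolding norm_X_factor[OF that] using \<beta>_bounds[OF that] by (simp add: pos_divide_le_eq)
  qed
  thus ?thesis unfolding X_def prod_norm[symmetric] by (intro prod_le_1) auto
qed

lemma norm_X_outer:
  assumes z: "norm z \<ge> 2 * R k"
  shows "norm (X k z) \<ge> 1" "norm (X k z) \<le> (norm z / R k) ^ (2 * k * N k)"
proof -
  define a where "a = norm (y k z)"
  have a: "a \<ge> 2" using norm_y_outer[OF z] by (simp add: a_def)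
  have bounds: "1 \<le> norm ((y k z - of_real (\<beta> k j)) / of_real (1 - \<beta> k j))"
    "norm ((y k z - of_real (\<beta> k j)) / of_real (1 - \<beta> k j)) \<le> a\<^sup>2" if "j < k" for j
  proof -
    have \<beta>: "0 < \<beta> k j" "\<beta> k j \<le> 1/4" using \<beta>_bounds[OF that] by auto
    have "a - \<beta> k j \<le> norm (y k z - of_real (\<beta> k j))" "norm (y k z - of_real (\<beta> k j)) \<le> a + \<beta> k j"
      using norm_triangle_ineq2[of "y k z" "of_real (\<beta> k j)"]
        norm_triangle_ineq4[of "y k z" "of_real (\<beta> k j)"] \<beta> by (auto simp: a_def)
    note n = this
    show "1 \<le> norm ((y k z - of_real (\<beta> k j)) / of_real (1 - \<beta> k j))"
      unfolding norm_X_factor[OF that] using n a \<beta> by (simp add: pos_le_divide_eq)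
    have "a + \<beta> k j \<le> a\<^sup>2 * (1 - \<beta> k j)"
    proof -
      have "a + \<beta> k j \<le> 3 / 2 * a" using \<beta> a by linarith
      also have "\<dots> \<le> a * a * (3 / 4)" using mult_left_mono[OF a, of a] a by linarith
      also have "\<dots> \<le> a * a * (1 - \<beta> k j)" using \<beta> a by (intro mult_left_mono) auto
      finally show ?thesis by (simp add: power2_eq_square)
    qed
    thus "norm ((y k z - of_real (\<beta> k j)) / of_real (1 - \<beta> k j)) \<le> a\<^sup>2"
      unfolding norm_X_factor[OF that] using n \<beta> by (simp add: pos_divide_le_eq)
  qed
  show "norm (X k z) \<ge> 1"
    unfolding X_def prod_norm[symmetric] using bounds(1) by (intro prod_ge_1) auto
  have "norm (X k z) \<le> (\<Prod>j<k. a\<^sup>2)"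
    unfolding X_def prod_norm[symmetric] using bounds(2) by (intro prod_mono) auto
  also have "\<dots> = (norm z / R k) ^ (2 * k * N k)"
    by (simp add: a_def norm_y flip: power_mult) (simp add: mult_ac)
  finally show "norm (X k z) \<le> (norm z / R k) ^ (2 * k * N k)" .
qed

lemma norm_U: "norm (U k z) = (norm (X k z))\<^sup>2 * (norm z / R k) ^ d k"
  using R_pos[of k] by (simp add: U_def norm_mult norm_power norm_divide)

lemma norm_U_inner: assumes "norm z \<le> R k / 2" shows "norm (U k z) \<le> (1/2) ^ d k"
proof -
  have q: "norm z / R k \<le> 1 / 2" using assms R_pos[of k] by (simp add: pos_divide_le_eq)
  have "norm (U k z) \<le> 1\<^sup>2 * (1 / 2) ^ d k"
    unfolding norm_U using q R_pos[of k] norm_X_inner[OF assms]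
    by (intro mult_mono power_mono) auto
  thus ?thesis by simp
qed

lemma norm_U_outer:
  assumes "norm z \<ge> 2 * R k"
  shows "2 ^ d k \<le> norm (U k z)" "norm (U k z) \<le> norm z ^ ((4 * k + 1) * d k)"
proof -
  define q where "q = norm z / R k"
  have q: "q \<ge> 2" using assms R_pos[of k] by (simp add: q_def pos_le_divide_eq)
  have "1\<^sup>2 * 2 ^ d k \<le> (norm (X k z))\<^sup>2 * q ^ d k"
    using norm_X_outer(1)[OF assms] q by (intro mult_mono power_mono) auto
  thus "2 ^ d k \<le> norm (U k z)" by (simp add: norm_U q_def)
  have "(norm (X k z))\<^sup>2 * q ^ d k \<le> (q ^ (2 * k * N k))\<^sup>2 * q ^ d k"
    using norm_X_outer(2)[OF assms] q by (intro mult_right_mono power_mono) (auto simp: q_def)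
  also have "\<dots> = q ^ (4 * k * N k + d k)" by (simp add: power_add flip: power_mult) (simp add: mult_ac)
  also have "\<dots> \<le> q ^ ((4 * k + 1) * d k)"
    using q mult_le_mono2[OF N_le_d[of k], of "4 * k"] by (intro power_increasing) auto
  also have "\<dots> \<le> norm z ^ ((4 * k + 1) * d k)"
  proof (rule power_mono)
    have "norm z / R k \<le> norm z / 1" using R_ge[of k] by (intro divide_left_mono) auto
    thus "q \<le> norm z" by (simp add: q_def)
  qed (use q in auto)
  finally show "norm (U k z) \<le> norm z ^ ((4 * k + 1) * d k)" by (simp add: norm_U q_def)
qed

end

section \<open>Size of the approximants and their limit\<close>

context lacunary_riccati
begin

text \<open>
  All poles of \<open>\<psi>s k\<close> have modulus at most \<open>\<rho> k / 2\<close>.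
\<close>

definition \<rho> :: "nat \<Rightarrow> real" where "\<rho> k = (case k of 0 \<Rightarrow> 1 | Suc j \<Rightarrow> 2 * R j)"

lemma \<rho>_le: "\<rho> k \<le> R k / 2"
proof (cases k)
  case (Suc j)
  thus ?thesis using R_less[of j k] R_pos[of j] by (simp add: \<rho>_def)
qed (use R_ge[of k] in \<open>simp add: \<rho>_def\<close>)

lemma N_le_R: "real (N k) \<le> R k ^ n"
  using N_le_d[of k] real_d[of k] by (metis of_nat_le_iff)

lemma norm_\<theta>:
  assumes "norm (y k z - 1) \<ge> 1 / 2"
  shows "norm (\<theta> k z) \<le> 3 * real (N k)"
proof -
  have "norm (of_nat (N k + 1) / 2 :: complex) = (real (N k) + 1) / 2"
    by (simp only: norm_divide norm_of_nat norm_numeral) simp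
  moreover have "norm (of_nat (N k) / (y k z - 1)) = real (N k) / norm (y k z - 1)"
    by (simp only: norm_divide norm_of_nat)
  ultimately have "norm (\<theta> k z) \<le> real (N k) / norm (y k z - 1) + (real (N k) + 1) / 2"
    unfolding \<theta>_def
    using norm_triangle_ineq[of "of_nat (N k) / (y k z - 1)" "of_nat (N k + 1) / 2"] by linarith
  also have "real (N k) / norm (y k z - 1) \<le> real (N k) / (1/2)"
    using assms by (intro divide_left_mono) auto
  also have "(real (N k) + 1) / 2 \<le> real (N k)" using N_ge1[of k] by simp
  finally show ?thesis by simp
qed

text \<open>
  Outside the circle of new poles \<open>U\<close> is large, so the weight \<open>(1 - U)\<^sup>2\<close> is comparable to \<open>U\<^sup>2\<close>. The other
  term is of size \<open>N k U\<^sup>2 / \<bar>z\<bar>\<close>, which is negligible because \<open>\<psi>s k\<close> is at least \<open>\<bar>z\<bar> ^ n \<ge> R k ^ n \<ge> N k\<close>.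
\<close>

lemma \<psi>s_step_bounds:
  assumes z: "norm z \<ge> 2 * R k" and h: "norm z ^ n \<le> norm (\<psi>s k z)"
  shows "(norm (U k z))\<^sup>2 * norm (\<psi>s k z) / 8 \<le> norm (\<psi>s (Suc k) z)"
    "norm (\<psi>s (Suc k) z) \<le> 3 * (norm (U k z))\<^sup>2 * norm (\<psi>s k z)"
proof -
  define u where "u = norm (U k z)"
  define h where "h = norm (\<psi>s k z)"
  have z2: "norm z \<ge> 2048" using z R_ge[of k] by simp
  have "(2::real) ^ 1 \<le> 2 ^ d k" using d_ge1[of k] by (intro power_increasing) auto
  hence u2: "u \<ge> 2" using norm_U_outer(1)[OF z] by (simp add: u_def)
  have h0: "h \<ge> 0" by (simp add: h_def)
  have y1: "norm (y k z - 1) \<ge> 1 / 2"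
    using norm_y_outer[OF z] norm_triangle_ineq2[of "y k z" 1] by simp
  have Nz: "real (N k) \<le> h"
  proof -
    have "R k ^ n \<le> norm z ^ n" using z R_pos[of k] by (intro power_mono) auto
    thus ?thesis using N_le_R[of k] assms(2) by (simp add: h_def)
  qed
  have "norm (G k z * \<theta> k z) * norm z = norm (z * G k z) * norm (\<theta> k z)" by (simp add: norm_mult)
  also have "norm (z * G k z) = u * norm (2 - U k z)" by (simp add: zG norm_mult u_def)
  also have "u * norm (2 - U k z) * norm (\<theta> k z) \<le> u * (2 * u) * (3 * real (N k))"
    using norm_triangle_ineq4[of 2 "U k z"] u2 norm_\<theta>[OF y1]
    by (intro mult_mono) (auto simp: u_def)
  also have "\<dots> \<le> u * (2 * u) * (3 * h)" using Nz u2 by (intro mult_left_mono) auto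
  finally have "norm (G k z * \<theta> k z) * norm z \<le> 6 * (u\<^sup>2 * h)" by (simp add: power2_eq_square mult_ac)
  moreover have "norm (G k z * \<theta> k z) * 2048 \<le> norm (G k z * \<theta> k z) * norm z"
    using z2 by (intro mult_left_mono) auto
  ultimately have small: "norm (G k z * \<theta> k z) \<le> u\<^sup>2 * h / 256"
    using mult_nonneg_nonneg[OF zero_le_power2[of u] h0] by linarith
  have lo: "u\<^sup>2 * h / 4 \<le> norm ((1 - U k z)\<^sup>2 * \<psi>s k z)"
  proof -
    have "u / 2 \<le> norm (1 - U k z)"
      using norm_triangle_ineq3[of 1 "U k z"] u2 by (simp add: u_def)
    hence "(u / 2)\<^sup>2 \<le> (norm (1 - U k z))\<^sup>2" using u2 by (intro power_mono) auto
    hence "(u / 2)\<^sup>2 * h \<le> (norm (1 - U k z))\<^sup>2 * h" using h0 by (intro mult_right_mono)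
    thus ?thesis by (simp add: norm_mult norm_power h_def power_divide)
  qed
  have hi: "norm ((1 - U k z)\<^sup>2 * \<psi>s k z) \<le> 9 / 4 * (u\<^sup>2 * h)"
  proof -
    have "norm (1 - U k z) \<le> 3 / 2 * u"
      using norm_triangle_ineq4[of 1 "U k z"] u2 by (simp add: u_def)
    hence "(norm (1 - U k z))\<^sup>2 \<le> (3 / 2 * u)\<^sup>2" by (intro power_mono) auto
    hence "(norm (1 - U k z))\<^sup>2 * h \<le> (3 / 2 * u)\<^sup>2 * h" using h0 by (intro mult_right_mono)
    thus ?thesis by (simp add: norm_mult norm_power h_def power_mult_distrib power_divide)
  qed
  have uh: "u\<^sup>2 * h \<ge> 0" using h0 by simp
  show "(norm (U k z))\<^sup>2 * norm (\<psi>s k z) / 8 \<le> norm (\<psi>s (Suc k) z)"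
    unfolding \<psi>s_Suc u_def[symmetric] h_def[symmetric]
    using norm_diff_ineq[of "(1 - U k z)\<^sup>2 * \<psi>s k z" "G k z * \<theta> k z"] lo small uh by linarith
  show "norm (\<psi>s (Suc k) z) \<le> 3 * (norm (U k z))\<^sup>2 * norm (\<psi>s k z)"
    unfolding \<psi>s_Suc u_def[symmetric] h_def[symmetric] mult.assoc
    using norm_triangle_ineq[of "(1 - U k z)\<^sup>2 * \<psi>s k z" "G k z * \<theta> k z"] hi small uh by linarith
qed

lemma \<psi>s_bounds:
  "norm z \<ge> \<rho> k \<Longrightarrow> norm z ^ n \<le> norm (\<psi>s k z) \<and> norm (\<psi>s k z) \<le> norm z ^ C k"
proof (induction k)
  case 0
  thus ?case by (simp add: norm_power)
next
  case (Suc k)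
  hence z: "norm z \<ge> 2 * R k" by (simp add: \<rho>_def)
  hence "norm z \<ge> \<rho> k" using \<rho>_le[of k] R_pos[of k] by simp
  note IH = Suc.IH[OF this]
  have z2: "norm z \<ge> 2048" using z R_ge[of k] by simp
  define u where "u = norm (U k z)"
  have ud: "2 ^ d k \<le> u" using norm_U_outer(1)[OF z] by (simp add: u_def)
  have "(2::real) ^ 3 \<le> (2 ^ d k)\<^sup>2"
  proof -
    have "C k \<ge> 1" using C_ge[of k] n_pos by simp
    hence "2 \<le> d k" using d_large[of k] by simp
    hence "(2::real) ^ 3 \<le> 2 ^ (d k * 2)" by (intro power_increasing) auto
    thus ?thesis by (simp add: power_mult)
  qed
  also have "\<dots> \<le> u\<^sup>2" using ud by (intro power_mono) auto
  finally have u8: "u\<^sup>2 \<ge> 8" by simp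
  have lower: "norm z ^ n \<le> norm (\<psi>s (Suc k) z)"
  proof -
    have "1 * norm z ^ n \<le> (u\<^sup>2 / 8) * norm (\<psi>s k z)" using u8 IH by (intro mult_mono) auto
    also have "\<dots> \<le> norm (\<psi>s (Suc k) z)" using \<psi>s_step_bounds(1)[OF z] IH by (simp add: u_def)
    finally show ?thesis by simp
  qed
  have "norm (\<psi>s (Suc k) z) \<le> 3 * u\<^sup>2 * norm (\<psi>s k z)"
    using \<psi>s_step_bounds(2)[OF z] IH by (simp add: u_def)
  also have "\<dots> \<le> norm z ^ 3 * (norm z ^ ((4 * k + 1) * d k))\<^sup>2 * norm z ^ C k"
  proof (intro mult_mono power_mono)
    have "norm z ^ 1 \<le> norm z ^ 3" using z2 by (intro power_increasing) auto
    thus "3 \<le> norm z ^ 3" using z2 by simp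
  qed (use IH norm_U_outer(2)[OF z] z2 in \<open>auto simp: u_def\<close>)
  also have "\<dots> = norm z ^ (3 + ((4 * k + 1) * d k) * 2 + C k)"
    by (simp only: power_add power_mult)
  also have "3 + ((4 * k + 1) * d k) * 2 + C k = C (Suc k)" unfolding C_Suc by simp
  finally show ?case using lower by blast
qed

text \<open>
  On the circle of radius \<open>R k / 2\<close> there are no poles and \<open>\<psi>s_bounds\<close> applies; the maximum principle
  carries the estimate to the disc, which contains the old poles.
\<close>

lemma \<delta>_bound:
  assumes "norm z \<le> R k / 2"
  shows "norm (\<delta> k z) \<le> (1/2) ^ Suc k"
proof -
  have circle: "norm (\<delta> k w) \<le> (1/2) ^ Suc k" if w: "norm w = R k / 2" for w :: complex
  proof -
    have w0: "norm w \<ge> 1" using w R_ge[of k] by simp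
    have "norm (y k w - 1) \<ge> 1/2"
      using norm_y_inner[of w k] w norm_triangle_ineq2[of 1 "y k w"] by (simp add: norm_minus_commute)
    note \<theta> = norm_\<theta>[OF this]
    have u: "norm (U k w) \<le> (1/2) ^ d k" using norm_U_inner[of w k] w by simp
    have "(1/2::real) ^ d k \<le> 1" by (simp add: power_le_one)
    hence "norm (U k w) \<le> 1" using u by linarith
    hence "norm (2 - U k w) \<le> 3" using norm_triangle_ineq4[of 2 "U k w"] by simp
    hence zG: "norm (w * G k w) \<le> (1/2) ^ d k * 3"
      unfolding zG norm_mult using u by (intro mult_mono) auto
    have "norm (G k w) * 1 \<le> norm (G k w) * norm w" using w0 by (intro mult_left_mono) auto
    hence Gw: "norm (G k w) \<le> (1/2) ^ d k * 3" using zG by (simp add: norm_mult mult.commute)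
    have R2: "R k ^ C k = 2 ^ (e k * C k)" by (simp add: R_def power_mult)
    have RC: "norm (\<psi>s k w) \<le> R k ^ C k"
    proof -
      have "\<rho> k \<le> norm w" using w \<rho>_le[of k] by simp
      hence "norm (\<psi>s k w) \<le> norm w ^ C k" using \<psi>s_bounds by blast
      also have "\<dots> \<le> R k ^ C k" using w R_pos[of k] by (intro power_mono) auto
      finally show ?thesis .
    qed
    have NC: "real (N k) \<le> R k ^ C k"
    proof -
      have "R k ^ n \<le> R k ^ C k" using R_ge[of k] C_ge by (intro power_increasing) auto
      thus ?thesis using N_le_R[of k] by linarith
    qed
    have "\<delta> k w = G k w * \<theta> k w - w * G k w * \<psi>s k w" by (simp add: \<delta>_def algebra_simps)
    hence "norm (\<delta> k w) \<le> norm (G k w) * norm (\<theta> k w) + norm (w * G k w) * norm (\<psi>s k w)"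
      by (metis norm_mult norm_triangle_ineq4)
    also have "\<dots> \<le> (1/2) ^ d k * 3 * (3 * R k ^ C k) + (1/2) ^ d k * 3 * R k ^ C k"
      using \<theta> NC RC Gw zG R_pos[of k] by (intro add_mono mult_mono) auto
    also have "\<dots> = 12 * 2 ^ (e k * C k) * (1/2) ^ d k" by (simp add: R2)
    also have "\<dots> \<le> 2 ^ 4 * 2 ^ (e k * C k) * (1/2) ^ (e k * C k + k + 5)"
    proof (rule mult_mono)
      show "(1/2::real) ^ d k \<le> (1/2) ^ (e k * C k + k + 5)"
        using d_large[of k] by (intro power_decreasing) auto
    qed auto
    also have "\<dots> = (1/2) ^ Suc k"
      by (simp add: power_add power_one_over field_simps)
    finally show ?thesis .
  qed
  show ?thesis
  proof (rule maximum_modulus_frontier[of "\<delta> k" "cball 0 (R k / 2)"])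
    show "\<delta> k holomorphic_on interior (cball 0 (R k / 2))"
      using R_pos[of k] by (intro holomorphic_on_subset[OF \<delta>_holo]) (auto simp: interior_cball)
    show "continuous_on (closure (cball 0 (R k / 2))) (\<delta> k)"
      using R_pos[of k]
      by (intro holomorphic_on_imp_continuous_on holomorphic_on_subset[OF \<delta>_holo]) auto
    fix w :: complex assume "w \<in> frontier (cball 0 (R k / 2))"
    thus "norm (\<delta> k w) \<le> (1/2) ^ Suc k" using circle R_pos[of k] by (auto simp: frontier_cball)
  qed (use assms in auto)
qed

definition \<psi> :: "complex \<Rightarrow> complex" where "\<psi> z = z ^ n + (\<Sum>j. \<delta> j z)"
definition \<Delta> :: "nat \<Rightarrow> complex \<Rightarrow> complex" where "\<Delta> k z = (\<Sum>j. \<delta> (j + k) z)"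
definition Z :: "complex set" where "Z = (\<Union>k. Zk k)"

lemma \<delta>_bound': "norm z \<le> R k / 2 \<Longrightarrow> norm (\<delta> (j + k) z) \<le> (1/2) ^ Suc j"
proof -
  assume "norm z \<le> R k / 2"
  hence "norm (\<delta> (j + k) z) \<le> (1/2) ^ Suc (j + k)"
    using R_mono[of k "j + k"] by (intro \<delta>_bound) auto
  also have "\<dots> \<le> (1/2) ^ Suc j" by (intro power_decreasing) auto
  finally show ?thesis .
qed

lemma summable_half: "summable (\<lambda>j. (1/2::real) ^ Suc j)" and suminf_half: "(\<Sum>j. (1/2::real) ^ Suc j) = 1"
  using power_half_series by (auto simp: sums_iff)

lemma summable_\<delta>_shift: "norm z \<le> R k / 2 \<Longrightarrow> summable (\<lambda>j. \<delta> (j + k) z)"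
  by (rule summable_comparison_test'[OF summable_half]) (use \<delta>_bound' in auto)

lemma norm_\<Delta>: assumes "norm z \<le> R k / 2" shows "norm (\<Delta> k z) \<le> 1"
proof -
  have s: "summable (\<lambda>j. norm (\<delta> (j + k) z))"
    by (rule summable_comparison_test'[OF summable_half]) (use \<delta>_bound'[OF assms] in auto)
  have "norm (\<Delta> k z) \<le> (\<Sum>j. norm (\<delta> (j + k) z))" unfolding \<Delta>_def by (rule summable_norm[OF s])
  also have "\<dots> \<le> (\<Sum>j. (1/2) ^ Suc j)"
    by (rule suminf_le[OF \<delta>_bound'[OF assms] s summable_half])
  finally show ?thesis by (simp only: suminf_half)
qed

lemma \<psi>_eq: assumes "norm z \<le> R k / 2" shows "\<psi> z = \<psi>s k z + \<Delta> k z"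
proof -
  have "summable (\<lambda>j. \<delta> j z)" using summable_\<delta>_shift[OF assms] summable_iff_shift by blast
  from suminf_split_initial_segment[OF this, of k] show ?thesis
    unfolding \<psi>_def \<Delta>_def \<psi>s_eq_sum by simp
qed

lemma \<Delta>_holo: "\<Delta> k holomorphic_on ball 0 (R k / 2)"
proof -
  have lim: "uniform_limit (ball 0 (R k / 2)) (\<lambda>m z. \<Sum>j<m. \<delta> (j + k) z) (\<Delta> k) sequentially"
    unfolding \<Delta>_def by (rule Weierstrass_m_test[OF _ summable_half]) (use \<delta>_bound' in auto)
  show ?thesis
  proof (rule holomorphic_uniform_sequence)
    fix m
    show "(\<lambda>z. \<Sum>j<m. \<delta> (j + k) z) holomorphic_on ball 0 (R k / 2)"
    proof (intro holomorphic_intros holomorphic_on_subset[OF \<delta>_holo])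
      fix j show "ball 0 (R k / 2) \<subseteq> ball 0 (R (j + k))"
        using R_mono[of k "j + k"] R_pos[of k] by (intro subset_ball) auto
    qed
  next
    fix x :: complex assume "x \<in> ball 0 (R k / 2)"
    hence "\<exists>r>0. cball x r \<subseteq> ball 0 (R k / 2)" using open_contains_cball open_ball by blast
    thus "\<exists>r>0. cball x r \<subseteq> ball 0 (R k / 2) \<and>
        uniform_limit (cball x r) (\<lambda>m z. \<Sum>j<m. \<delta> (j + k) z) (\<Delta> k) sequentially"
      using uniform_limit_on_subset[OF lim] by blast
  qed auto
qed

lemma Z_Int: "norm z \<le> R k / 2 \<Longrightarrow> z \<in> Z \<longleftrightarrow> z \<in> Zs k"
proof
  assume z: "norm z \<le> R k / 2" "z \<in> Z"
  then obtain j where j: "z \<in> Zk j" by (auto simp: Z_def)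
  have "\<not> k \<le> j"
  proof
    assume "k \<le> j"
    hence "R k \<le> norm z" using R_mono norm_Zk[OF j] by simp
    thus False using z R_pos[of k] by simp
  qed
  thus "z \<in> Zs k" using j by (auto simp: Zs_def)
qed (auto simp: Z_def Zs_def)

lemma exists_R: "\<exists>k. norm (z::complex) < R k / 2"
proof -
  obtain k where "2 * norm z < real k" using reals_Archimedean2 by blast
  thus ?thesis using R_ge_k[of k] by (intro exI[of _ k]) simp
qed

lemma \<psi>_holo: "\<psi> holomorphic_on - Z"
proof -
  have "\<psi> field_differentiable at z within - Z" if z: "z \<notin> Z" for z
  proof -
    obtain k where k: "norm z < R k / 2" using exists_R by blast
    define S where "S = ball 0 (R k / 2) - Zs k"
    have S: "open S" "z \<in> S" 
      using finite_Zs[of k] z Z_Int[of z k] k unfolding S_def by (auto intro: finite_imp_closed)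
    have "(\<lambda>z. \<psi>s k z + \<Delta> k z) holomorphic_on S"
      by (intro holomorphic_intros holomorphic_on_subset[OF \<psi>s_holo] holomorphic_on_subset[OF \<Delta>_holo])
        (auto simp: S_def)
    hence "\<psi> holomorphic_on S"
    proof (rule holomorphic_transform)
      fix x assume "x \<in> S"
      thus "\<psi>s k x + \<Delta> k x = \<psi> x" using \<psi>_eq[of x k] by (simp add: S_def)
    qed
    hence "\<psi> field_differentiable at z" using S by (meson holomorphic_on_imp_differentiable_at)
    thus ?thesis by (rule field_differentiable_at_within)
  qed
  thus ?thesis by (auto simp: holomorphic_on_def)
qed

text \<open>
  All corrections after step \<open>k\<close> vanish at the poles of \<open>\<psi>s k\<close>.
\<close>

lemma \<psi>_pole: assumes "b \<in> Z" shows "((\<lambda>z. \<psi> z - 1 / (z - b)) \<longlongrightarrow> 0) (at b)"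
proof -
  obtain k where k: "norm b < R k / 2" using exists_R by blast
  have b: "b \<in> Zs k" using Z_Int[of b k] k assms by simp
  have "\<Delta> k b = 0"
  proof -
    have "b \<in> Zs (j + k)" for j using b by (auto simp: Zs_def)
    thus ?thesis by (simp add: \<Delta>_def \<delta>_eq_0)
  qed
  moreover have "continuous_on (ball 0 (R k / 2)) (\<Delta> k)"
    by (intro holomorphic_on_imp_continuous_on \<Delta>_holo)
  hence "\<Delta> k \<midarrow>b\<rightarrow> \<Delta> k b" using k by (auto simp: continuous_on_eq_continuous_at isCont_def)
  ultimately have "((\<lambda>z. (\<psi>s k z - 1 / (z - b)) + \<Delta> k z) \<longlongrightarrow> 0 + 0) (at b)"
    by (intro tendsto_add \<psi>s_pole b) auto
  moreover have "eventually (\<lambda>z. z \<in> ball 0 (R k / 2)) (at b)"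
    using k by (intro eventually_at_in_open') auto
  hence "eventually (\<lambda>z. (\<psi>s k z - 1 / (z - b)) + \<Delta> k z = \<psi> z - 1 / (z - b)) (at b)"
  proof eventually_elim
    case (elim z)
    thus ?case using \<psi>_eq[of z k] by simp
  qed
  ultimately show ?thesis using Lim_transform_eventually by force
qed

lemma \<psi>_annulus:
  assumes z: "2 * R k \<le> norm z" "norm z \<le> R (Suc k) / 2"
  shows "z \<notin> Z" "4 ^ d k \<le> norm (\<psi> z)" "norm (\<psi> z) \<le> 2 * norm z ^ C (Suc k)"
proof -
  show "z \<notin> Z"
  proof
    assume "z \<in> Z"
    hence "z \<in> Zs (Suc k)" using Z_Int z by blast
    then obtain j where j: "j < Suc k" "z \<in> Zk j" unfolding Zs_def by blast
    hence "norm z \<le> R k" using norm_Zk[of z j] R_mono[of j k] by simp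
    thus False using z R_pos[of k] by simp
  qed
  have z2: "norm z \<ge> 2048" using z R_ge[of k] by simp
  have "norm z \<ge> \<rho> k" using z \<rho>_le[of k] R_pos[of k] by simp
  note b = \<psi>s_bounds[OF this]
  have bS: "norm (\<psi>s (Suc k) z) \<le> norm z ^ C (Suc k)"
    using \<psi>s_bounds[of "Suc k" z] z by (simp add: \<rho>_def)
  have \<psi>: "\<psi> z = \<psi>s (Suc k) z + \<Delta> (Suc k) z" "norm (\<Delta> (Suc k) z) \<le> 1"
    using \<psi>_eq[of z "Suc k"] norm_\<Delta>[of z "Suc k"] z by auto
  have "norm z ^ 1 \<le> norm z ^ n" using z2 n_pos by (intro power_increasing) auto
  hence h: "norm (\<psi>s k z) \<ge> 2048" using b z2 by simp
  have "(2 ^ d k)\<^sup>2 * 2048 / 8 \<le> (norm (U k z))\<^sup>2 * norm (\<psi>s k z) / 8"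
    using norm_U_outer(1)[OF z(1)] h by (intro divide_right_mono mult_mono power_mono) auto
  also have "\<dots> \<le> norm (\<psi>s (Suc k) z)" using \<psi>s_step_bounds(1)[OF z(1)] b by simp
  also have "(2 ^ d k)\<^sup>2 = (4::real) ^ d k" by (simp add: power2_eq_square flip: power_mult_distrib)
  finally have "4 ^ d k * 256 \<le> norm (\<psi>s (Suc k) z)" by simp
  moreover have "(1::real) \<le> 4 ^ d k" by simp
  ultimately show "4 ^ d k \<le> norm (\<psi> z)"
    using norm_diff_ineq[of "\<psi>s (Suc k) z" "\<Delta> (Suc k) z"] \<psi>(2) unfolding \<psi>(1) by linarith
  have "1 \<le> norm z ^ C (Suc k)" using z2 by (intro one_le_power) auto
  thus "norm (\<psi> z) \<le> 2 * norm z ^ C (Suc k)"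
    using norm_triangle_ineq[of "\<psi>s (Suc k) z" "\<Delta> (Suc k) z"] \<psi> bS by simp
qed

end

section \<open>Exponent of convergence and order\<close>

context lacunary_riccati
begin

lemma finite_Z_cball: "finite (Z \<inter> cball 0 r)"
proof -
  obtain k where k: "norm (of_real r :: complex) < R k / 2" using exists_R by blast
  have "Z \<inter> cball 0 r \<subseteq> Zs k"
  proof
    fix z assume "z \<in> Z \<inter> cball 0 r"
    hence z: "z \<in> Z" "norm z \<le> r" by auto
    have "norm z \<le> R k / 2" using z k by simp
    thus "z \<in> Zs k" using Z_Int z by blast
  qed
  thus ?thesis using finite_Zs finite_subset by blast
qed

lemma real_C_Suc_le: "real (C (Suc k)) \<le> 12 * (real k + 1) * real (d k)"
proof -
  have "real (C (Suc k)) \<le> real (12 * (k + 1) * d k)" using C_Suc_le by (simp only: of_nat_le_iff)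
  also have "\<dots> = 12 * (real k + 1) * real (d k)" by simp
  finally show ?thesis .
qed

lemma infinite_Z: "infinite Z"
proof
  assume "finite Z"
  hence "finite (norm ` Z)" by simp
  moreover have "range R \<subseteq> norm ` Z"
  proof
    fix x assume "x \<in> range R"
    then obtain k where k: "x = R k" by blast
    have "Zk k \<noteq> {}" using card_Zk[of k] N_ge1[of k] by auto
    then obtain z where "z \<in> Zk k" by blast
    hence "z \<in> Z" "x = norm z" using norm_Zk k unfolding Z_def by auto
    thus "x \<in> norm ` Z" by blast
  qed
  ultimately have "finite (range R)" using finite_subset by blast
  moreover have "inj R"
  proof (rule injI)
    fix i j assume "R i = R j"
    thus "i = j" using R_less[of i j] R_less[of j i] R_pos[of i] R_pos[of j]
      by (cases i j rule: linorder_cases) auto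
  qed
  ultimately show False using finite_imageD infinite_UNIV_nat by blast
qed

lemma zero_notin_Z: "0 \<notin> Z"
proof
  assume "0 \<in> Z"
  then obtain k where "0 \<in> Zk k" unfolding Z_def by blast
  thus False using norm_Zk[of 0 k] R_pos[of k] by simp
qed

lemma real_e_eq_log: "real (e k) = log 2 (R k)"
  by (simp add: R_def log_nat_power)

lemma count_le:
  assumes r: "r \<ge> exp 1"
  shows "real (card {z. norm z \<le> r \<and> z \<in> Z}) \<le> 2 * r powr l * (ln r)\<^sup>2"
proof -
  have r1: "r > 1" "ln r \<ge> 1"
  proof -
    have "(1::real) < exp 1" by simp
    thus "r > 1" using r by linarith
    thus "ln r \<ge> 1" using r by (subst ln_ge_iff) auto
  qed
  define m where "m = nat \<lfloor>log 2 r\<rfloor>"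
  have m: "real m \<le> log 2 r" using r1 by (simp add: m_def)
  have sub: "{z. norm z \<le> r \<and> z \<in> Z} \<subseteq> (\<Union>j\<in>{j\<in>{..<m}. R j \<le> r}. Zk j)"
  proof
    fix z assume "z \<in> {z. norm z \<le> r \<and> z \<in> Z}"
    then obtain j where j: "z \<in> Zk j" "R j \<le> r" using norm_Zk by (auto simp: Z_def)
    have "real (e j) \<le> log 2 r" unfolding real_e_eq_log using j R_pos[of j] r1 by simp
    hence "real (j + 10) \<le> log 2 r" using e_ge[of j] by linarith
    hence "int (j + 10) \<le> \<lfloor>log 2 r\<rfloor>" by linarith
    hence "j < m" unfolding m_def by linarith
    thus "z \<in> (\<Union>j\<in>{j\<in>{..<m}. R j \<le> r}. Zk j)" using j by blast
  qed
  have "card {z. norm z \<le> r \<and> z \<in> Z} \<le> card (\<Union>j\<in>{j\<in>{..<m}. R j \<le> r}. Zk j)"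
    by (rule card_mono[OF _ sub]) (use finite_Zk in auto)
  also have "\<dots> \<le> (\<Sum>j\<in>{j\<in>{..<m}. R j \<le> r}. card (Zk j))" by (rule card_UN_le) auto
  finally have "real (card {z. norm z \<le> r \<and> z \<in> Z}) \<le> (\<Sum>j\<in>{j\<in>{..<m}. R j \<le> r}. real (N j))"
    by (simp only: card_Zk flip: of_nat_sum of_nat_le_iff)
  also have "\<dots> \<le> (\<Sum>j\<in>{j\<in>{..<m}. R j \<le> r}. r powr l)"
  proof (rule sum_mono)
    fix j assume "j \<in> {j\<in>{..<m}. R j \<le> r}"
    hence "R j powr l \<le> r powr l" using R_pos[of j] l by (intro powr_mono2) auto
    thus "real (N j) \<le> r powr l" using N_le_powr[of j] by linarith
  qed
  also have "\<dots> = real (card {j\<in>{..<m}. R j \<le> r}) * r powr l" by simp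
  also have "\<dots> \<le> real m * r powr l"
  proof (rule mult_right_mono)
    have "card {j\<in>{..<m}. R j \<le> r} \<le> card {..<m}" by (intro card_mono) auto
    thus "real (card {j\<in>{..<m}. R j \<le> r}) \<le> real m" by simp
  qed auto
  also have "\<dots> \<le> (2 * (ln r)\<^sup>2) * r powr l"
  proof (rule mult_right_mono)
    have "log 2 r \<le> 2 * ln r"
    proof -
      have "1/2 \<le> ln (2::real)" using ln_2_less_1 ln2_ge_two_thirds by linarith
      hence "ln r * 1 \<le> ln r * (2 * ln 2)" using r1 by (intro mult_left_mono) auto
      thus ?thesis by (simp add: log_def pos_divide_le_eq mult_ac)
    qed
    also have "2 * ln r \<le> 2 * (ln r * ln r)" using mult_left_mono[of 1 "ln r" "ln r"] r1 by simp
    finally show "real m \<le> 2 * (ln r)\<^sup>2" using m by (simp add: power2_eq_square)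
  qed auto
  finally show ?thesis by (simp add: mult_ac)
qed

lemma count_ge: "1 / 2 * R k powr l \<le> real (card {z. norm z \<le> R k \<and> z \<in> Z})"
proof -
  have "{z. norm z \<le> R k \<and> z \<in> Z} = Z \<inter> cball 0 (R k)" by auto
  hence fin: "finite {z. norm z \<le> R k \<and> z \<in> Z}" using finite_Z_cball by simp
  have "card (Zk k) \<le> card {z. norm z \<le> R k \<and> z \<in> Z}"
    by (rule card_mono[OF fin]) (use norm_Zk in \<open>auto simp: Z_def\<close>)
  thus ?thesis using N_ge_powr[of k] unfolding card_Zk by (simp flip: of_nat_le_iff)
qed

lemma R_at_top: "filterlim R at_top sequentially"
proof (rule filterlim_at_top_mono)
  show "filterlim (\<lambda>k. real k) at_top sequentially" by (rule filterlim_real_sequentially)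
  show "eventually (\<lambda>k. real k \<le> R k) sequentially"
  proof (intro always_eventually allI)
    show "real k \<le> R k" for k using R_ge_k[of k] by simp
  qed
qed

lemma zero_exponent_eq:
  assumes "f holomorphic_on UNIV" "\<And>z. f z = 0 \<longleftrightarrow> z \<in> Z" "\<And>z. z \<in> Z \<Longrightarrow> deriv f z \<noteq> 0"
  shows "zero_exponent f = ereal l"
proof -
  have eq: "zero_count f r = card {z. norm z \<le> r \<and> z \<in> Z}" for r
    using zero_count_simple[OF assms(1)] assms(2,3) by simp
  show ?thesis unfolding zero_exponent_def
  proof (rule Limsup_log_ratio_eqI[where C = 2 and c = "1/2" and r = R])
    show "eventually (\<lambda>x. real (zero_count f x) \<le> 2 * x powr l * (ln x)\<^sup>2) at_top"
      using eventually_ge_at_top[of "exp 1"] by eventually_elim (unfold eq, rule count_le)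
    show "eventually (\<lambda>k. 1 / 2 * R k powr l \<le> real (zero_count f (R k))) sequentially"
      unfolding eq by (intro always_eventually allI count_ge)
  qed (use l R_at_top in auto)
qed

context
  fixes A :: "complex \<Rightarrow> complex"
  assumes A_holo: "A holomorphic_on UNIV"
    and A_eq: "\<And>z. z \<notin> Z \<Longrightarrow> A z = - (deriv \<psi> z + (\<psi> z)\<^sup>2)"
begin

text \<open>
  Here \<open>h = 1 / \<psi>\<close> is at most \<open>1 / 2\<close> on discs of radius \<open>1\<close>, hence so is its derivative, and
  \<open>A = \<psi>\<^sup>2 (h' - 1)\<close>.
\<close>

lemma A_annulus:
  assumes z: "2 * R k + 1 \<le> norm z" "norm z \<le> R (Suc k) / 2 - 1"
  shows "(norm (\<psi> z))\<^sup>2 / 2 \<le> norm (A z)" "norm (A z) \<le> 3 / 2 * (norm (\<psi> z))\<^sup>2"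
proof -
  have in_ann: "2 * R k \<le> norm w \<and> norm w \<le> R (Suc k) / 2" if "dist z w \<le> 1" for w
    using that z norm_triangle_ineq2[of z w] norm_triangle_ineq2[of w z]
    by (simp add: dist_norm norm_minus_commute)
  define h where "h = (\<lambda>w. 1 / \<psi> w)"
  have openZ: "open (- Z)"
  proof -
    have "closed Z" using locally_finite_imp_not_islimpt[OF finite_Z_cball] closed_limpt by blast
    thus ?thesis by auto
  qed
  have ne: "\<psi> w \<noteq> 0" "norm (h w) \<le> 1/2" "w \<notin> Z" if "dist z w \<le> 1" for w
  proof -
    have w: "2 * R k \<le> norm w" "norm w \<le> R (Suc k) / 2" using in_ann[OF that] by auto
    have "(4::real) ^ 1 \<le> 4 ^ d k" using d_ge1[of k] by (intro power_increasing) auto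
    hence b: "norm (\<psi> w) \<ge> 4" using \<psi>_annulus(2)[OF w] by simp
    thus "\<psi> w \<noteq> 0" by auto
    show "norm (h w) \<le> 1/2" unfolding h_def norm_divide using b by (simp add: divide_simps)
    show "w \<notin> Z" by (rule \<psi>_annulus(1)[OF w])
  qed
  have holo: "h holomorphic_on cball z 1"
    unfolding h_def by (intro holomorphic_intros holomorphic_on_subset[OF \<psi>_holo]) (use ne in auto)
  have "norm ((deriv ^^ 1) h z) \<le> fact 1 * (1/2) / 1 ^ 1"
  proof (rule Cauchy_inequality)
    show "h holomorphic_on ball z 1" by (rule holomorphic_on_subset[OF holo]) auto
    show "continuous_on (cball z 1) h" by (rule holomorphic_on_imp_continuous_on[OF holo])
  qed (use ne in \<open>auto simp: dist_norm\<close>)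
  hence dh: "norm (deriv h z) \<le> 1/2" by simp
  have "(\<psi> has_field_derivative deriv \<psi> z) (at z)"
    using \<psi>_holo openZ ne(3)[of z] by (auto intro: holomorphic_derivI)
  hence "(h has_field_derivative - (deriv \<psi> z / (\<psi> z)\<^sup>2)) (at z)"
    unfolding h_def using ne(1)[of z]
    by (auto intro!: derivative_eq_intros simp: power2_eq_square)
  hence "deriv h z = - (deriv \<psi> z / (\<psi> z)\<^sup>2)" by (rule DERIV_imp_deriv)
  hence "A z = (\<psi> z)\<^sup>2 * (deriv h z - 1)"
    using A_eq[OF ne(3)[of z]] ne(1)[of z] by (simp add: field_simps)
  hence eq: "norm (A z) = (norm (\<psi> z))\<^sup>2 * norm (deriv h z - 1)"
    by (simp add: norm_mult norm_power)
  have "1/2 \<le> norm (deriv h z - 1)" "norm (deriv h z - 1) \<le> 3/2"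
    using dh norm_triangle_ineq3[of "deriv h z" 1] norm_triangle_ineq4[of "deriv h z" 1] by auto
  thus "(norm (\<psi> z))\<^sup>2 / 2 \<le> norm (A z)" "norm (A z) \<le> 3 / 2 * (norm (\<psi> z))\<^sup>2"
    unfolding eq using mult_left_mono[of "1/2" "norm (deriv h z - 1)" "(norm (\<psi> z))\<^sup>2"]
      mult_left_mono[of "norm (deriv h z - 1)" "3/2" "(norm (\<psi> z))\<^sup>2"] by auto
qed

lemma nevanlinna_T_ge: "(1 / 3 ^ n) * (3 * R k) powr real n \<le> nevanlinna_T A (3 * R k)"
proof -
  have "real (d k) \<le> proximity A (3 * R k)"
  proof (rule proximity_ge[OF A_holo])
    fix z :: complex assume z: "norm z = 3 * R k"
    have z': "2 * R k + 1 \<le> norm z" "norm z \<le> R (Suc k) / 2 - 1"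
      using z R_ge[of k] R_less[of k "Suc k"] by auto
    have "4 ^ d k \<le> norm (\<psi> z)" using z' by (intro \<psi>_annulus(2)) auto
    hence "(4 ^ d k)\<^sup>2 \<le> (norm (\<psi> z))\<^sup>2" by (intro power_mono) auto
    hence "(4 ^ d k)\<^sup>2 / 2 \<le> norm (A z)" using A_annulus(1)[OF z'] by linarith
    moreover have "exp (real (d k)) \<le> (4 ^ d k)\<^sup>2 / 2"
    proof -
      have "exp (real (d k)) = exp 1 ^ d k" by (simp flip: exp_of_nat_mult)
      also have "\<dots> \<le> 4 ^ d k" using exp_le by (intro power_mono) auto
      also have "\<dots> \<le> 4 ^ d k * (4 ^ d k / 2)"
      proof -
        have "(4::real) ^ 1 \<le> 4 ^ d k" using d_ge1[of k] by (intro power_increasing) auto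
        thus ?thesis using mult_left_mono[of 1 "4 ^ d k / 2" "4 ^ d k :: real"] by simp
      qed
      finally show ?thesis by (simp add: power2_eq_square)
    qed
    ultimately have "exp (real (d k)) \<le> max 1 (norm (A z))" by simp
    hence "ln (exp (real (d k))) \<le> ln (max 1 (norm (A z)))" by (intro ln_mono) auto
    thus "real (d k) \<le> log_plus (norm (A z))" by (simp add: log_plus_def)
  qed (use R_pos[of k] in auto)
  moreover have "(1 / 3 ^ n) * (3 * R k) powr real n = real (d k)"
    using R_pos[of k] by (simp add: powr_realpow real_d power_mult_distrib)
  ultimately show ?thesis using nevanlinna_T_entire[OF A_holo] by simp
qed

lemma exists_scale: "3 * R 0 \<le> r \<Longrightarrow> \<exists>k. R k \<le> 3 * r \<and> 3 * r < R (Suc k)"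
proof -
  assume r: "3 * R 0 \<le> r"
  obtain m where "norm (of_real (3 * r) :: complex) < R m / 2" using exists_R by blast
  hence "\<bar>3 * r\<bar> < R m / 2" by (simp only: norm_of_real)
  hence m: "3 * r < R m" using R_pos[of m] by linarith
  define k where "k = (LEAST m. 3 * r < R m)"
  have k: "3 * r < R k" unfolding k_def by (rule LeastI[of _ m]) (rule m)
  have "k \<noteq> 0" using k r R_pos[of 0] by (cases "k = 0") auto
  then obtain j where j: "k = Suc j" by (cases k) auto
  have "\<not> 3 * r < R j" using not_less_Least[of j "\<lambda>m. 3 * r < R m"] j k_def by auto
  thus ?thesis using k j by (intro exI[of _ j]) auto
qed

text \<open>
  The circle of radius \<open>r\<close> may meet a circle of poles. It is therefore compared with a circle
  of radius \<open>s \<le> 9 r\<close> in a wide annulus, where \<open>A_annulus\<close> applies.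
\<close>

lemma nevanlinna_T_le:
  assumes r: "r \<ge> 3 * R 0"
  shows "nevanlinna_T A r \<le> (400 * 3 ^ n) * r powr real n * (ln r)\<^sup>2"
proof -
  have r9: "r \<ge> 3072" using r R_ge[of 0] by simp
  obtain k where k: "R k \<le> 3 * r" "3 * r < R (Suc k)" using exists_scale[OF r] by blast
  define s where "s = max r (3 * R k)"
  have s: "3 * R k \<le> s" "r \<le> s" "s \<le> 9 * r" "s \<le> R (Suc k) / 3"
    using k R_less[of k "Suc k"] r9 R_pos[of k] by (auto simp: s_def)
  have s1: "s \<ge> 1" using s r9 by linarith
  define D where "D = C (Suc k)"
  have circle: "norm (A z) \<le> 6 * s ^ (2 * D)" if z: "norm z = s" for z
  proof -
    have z': "2 * R k + 1 \<le> norm z" "norm z \<le> R (Suc k) / 2 - 1"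
      using z s R_ge[of k] R_ge[of "Suc k"] by auto
    have "norm (\<psi> z) \<le> 2 * s ^ D" using \<psi>_annulus(3)[of k z] z z' by (simp add: D_def)
    hence "(norm (\<psi> z))\<^sup>2 \<le> (2 * s ^ D)\<^sup>2" by (intro power_mono) auto
    also have "\<dots> = 4 * s ^ (2 * D)" by (simp add: power_mult_distrib power_mult[symmetric] mult.commute)
    finally show ?thesis using A_annulus(2)[OF z'] by simp
  qed
  have inside: "norm (A z) \<le> 6 * s ^ (2 * D)" if z: "norm z \<le> s" for z
  proof (rule maximum_modulus_frontier[of A "cball 0 s"])
    fix w :: complex assume "w \<in> frontier (cball 0 s)"
    thus "norm (A w) \<le> 6 * s ^ (2 * D)" using circle s1 by (auto simp: frontier_cball)
  qed (use z A_holo in \<open>auto intro!: holomorphic_on_imp_continuous_on intro: holomorphic_on_subset\<close>)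
  have ln_s: "ln s \<ge> 0" using s1 by simp
  have "proximity A r \<le> ln (6 * s ^ (2 * D))"
  proof (rule proximity_le[OF A_holo])
    fix z :: complex assume "norm z = r"
    hence "norm (A z) \<le> 6 * s ^ (2 * D)" using s by (intro inside) auto
    moreover have "(1::real) \<le> s ^ (2 * D)" using s1 by (rule one_le_power)
    ultimately show "log_plus (norm (A z)) \<le> ln (6 * s ^ (2 * D))"
      unfolding log_plus_def by (intro ln_mono) auto
  qed (use r9 in auto)
  also have "\<dots> = ln 6 + 2 * real D * ln s" using s1 by (simp add: ln_mult ln_realpow)
  finally have T: "nevanlinna_T A r \<le> ln 6 + 2 * real D * ln s"
    using nevanlinna_T_entire[OF A_holo] by simp
  have ln_r: "ln r \<ge> 2"
  proof -
    have "exp 2 \<le> (9::real)"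
    proof -
      have "exp (2::real) = exp 1 ^ 2" by (simp flip: exp_of_nat_mult)
      also have "\<dots> \<le> 3 ^ 2" using exp_le by (intro power_mono) auto
      finally show ?thesis by simp
    qed
    thus ?thesis using r9 by (subst ln_ge_iff) auto
  qed
  have ln6: "ln (6::real) \<le> ln r" using r9 by (intro ln_mono) auto
  have ln9: "ln s \<le> 2 * ln r"
  proof -
    have "ln s \<le> ln (r * r)"
    proof (rule ln_mono)
      have "9 * r \<le> r * r" using r9 by (intro mult_right_mono) auto
      thus "s \<le> r * r" using s by linarith
    qed (use s1 r9 in auto)
    thus ?thesis using r9 by (simp add: ln_mult)
  qed
  have D_le: "real D \<le> 12 * (4 * ln r) * (3 ^ n * r powr real n)"
  proof -
    have "real D \<le> 12 * (real k + 1) * real (d k)"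
      unfolding D_def by (rule real_C_Suc_le)
    also have "\<dots> \<le> 12 * (4 * ln r) * (3 ^ n * r powr real n)"
    proof (intro mult_mono)
      have "real k + 1 \<le> real (e k)" using e_ge[of k] by linarith
      also have "\<dots> = log 2 (R k)" by (rule real_e_eq_log)
      also have "\<dots> \<le> log 2 (r * r)"
      proof -
        have "3 * r \<le> r * r" using r9 by (intro mult_right_mono) auto
        hence "R k \<le> r * r" using k by linarith
        thus ?thesis using R_pos[of k] r9 by (subst log_le_cancel_iff) auto
      qed
      also have "\<dots> = 2 * ln r / ln 2" using r9 by (simp add: log_def ln_mult)
      also have "\<dots> \<le> 2 * ln r / (1/2)"
        using ln_r ln2_ge_two_thirds by (intro divide_left_mono) auto
      finally show "real k + 1 \<le> 4 * ln r" by simp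
      have "real (d k) = R k ^ n" by (rule real_d)
      also have "\<dots> \<le> (3 * r) ^ n" using k R_pos[of k] by (intro power_mono) auto
      finally show "real (d k) \<le> 3 ^ n * r powr real n"
        using r9 by (simp add: powr_realpow power_mult_distrib)
    qed (use ln_r in auto)
    finally show ?thesis .
  qed
  define Y where "Y = 3 ^ n * r powr real n"
  have Y1: "Y \<ge> 1"
  proof -
    have "1 * 1 \<le> (3::real) ^ n * r powr real n" using r9 by (intro mult_mono ge_one_powr_ge_zero) auto
    thus ?thesis by (simp add: Y_def)
  qed
  have "2 * real D * ln s \<le> 2 * (12 * (4 * ln r) * Y) * (2 * ln r)"
    using D_le ln9 ln_s ln_r Y1 by (intro mult_mono) (auto simp: Y_def)
  moreover have "ln r * 1 \<le> ln r * (ln r * Y)"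
    using ln_r Y1 mult_mono[of 1 "ln r" 1 Y] by (intro mult_left_mono) auto
  ultimately have "nevanlinna_T A r \<le> 193 * ((ln r * ln r) * Y)"
    using T ln6 by (simp add: mult_ac)
  also have "\<dots> \<le> 400 * ((ln r * ln r) * Y)" using ln_r Y1 by (intro mult_right_mono) auto
  finally show ?thesis by (simp add: Y_def power2_eq_square mult_ac)
qed

lemma growth_order_A: "growth_order A = ereal (real n)"
  unfolding growth_order_def
proof (rule Limsup_log_ratio_eqI[where C = "400 * 3 ^ n" and c = "1 / 3 ^ n" and r = "\<lambda>k. 3 * R k"])
  show "eventually (\<lambda>x. nevanlinna_T A x \<le> 400 * 3 ^ n * x powr real n * (ln x)\<^sup>2) at_top"
    using eventually_ge_at_top[of "3 * R 0"] by eventually_elim (rule nevanlinna_T_le)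
  show "filterlim (\<lambda>k. 3 * R k) at_top sequentially"
    by (rule filterlim_tendsto_pos_mult_at_top[OF tendsto_const _ R_at_top]) auto
  show "eventually (\<lambda>k. 1 / 3 ^ n * (3 * R k) powr real n \<le> nevanlinna_T A (3 * R k)) sequentially"
    by (intro always_eventually allI nevanlinna_T_ge)
qed auto

end

text \<open>
  The annuli that \<open>riccati_zeros_not_polynomially_bounded\<close> asks for start at \<open>r = 2 R k\<close>.
\<close>

lemma \<psi>_annuli:
  assumes K: "n + 3 \<le> K"
  shows "\<exists>r\<ge>r0. \<forall>z. r \<le> norm z \<longrightarrow> norm z \<le> 3 * r \<longrightarrow>
           z \<notin> Z \<and> exp (r / 4) \<le> norm (\<psi> z) \<and> norm (\<psi> z) \<le> exp (r ^ K)"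
proof -
  obtain k where "norm (of_real r0 :: complex) < R k / 2" using exists_R by blast
  hence k: "r0 \<le> 2 * R k" using R_pos[of k] by simp
  show ?thesis
  proof (intro exI[of _ "2 * R k"] conjI k allI impI)
    fix z :: complex assume z: "2 * R k \<le> norm z" "norm z \<le> 3 * (2 * R k)"
    have z': "norm z \<le> R (Suc k) / 2" using z R_less[of k "Suc k"] R_pos[of k] by simp
    note b = \<psi>_annulus[OF z(1) z']
    show "z \<notin> Z" by (rule b(1))
    have Rd: "R k \<le> real (d k)"
    proof -
      have "R k ^ 1 \<le> R k ^ n" using R_ge[of k] n_pos by (intro power_increasing) auto
      thus ?thesis by (simp add: real_d)
    qed
    have "exp (2 * R k / 4) \<le> exp (real (d k) * 1)"
      using Rd R_pos[of k] by (subst exp_le_cancel_iff) linarith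
    also have "\<dots> = exp 1 ^ d k" by (simp flip: exp_of_nat_mult)
    also have "\<dots> \<le> 4 ^ d k" using exp_le by (intro power_mono) auto
    finally show "exp (2 * R k / 4) \<le> norm (\<psi> z)" using b(2) by linarith
    have z0: "norm z > 0" using z R_pos[of k] by linarith
    have "2 * norm z ^ C (Suc k) \<le> exp 1 * exp (real (C (Suc k)) * norm z)"
    proof (rule mult_mono)
      show "2 \<le> exp (1::real)" using exp_ge_add_one_self[of 1] by simp
      have "norm z \<le> exp (norm z)" using exp_ge_add_one_self[of "norm z"] by linarith
      hence "norm z ^ C (Suc k) \<le> exp (norm z) ^ C (Suc k)" by (intro power_mono) auto
      thus "norm z ^ C (Suc k) \<le> exp (real (C (Suc k)) * norm z)" by (simp only: exp_of_nat_mult)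
    qed auto
    also have "\<dots> = exp (1 + real (C (Suc k)) * norm z)" by (simp add: exp_add)
    also have "\<dots> \<le> exp ((2 * R k) ^ K)"
    proof (subst exp_le_cancel_iff)
      have "real (C (Suc k)) \<le> 12 * (real k + 1) * real (d k)"
        by (rule real_C_Suc_le)
      also have "\<dots> \<le> 12 * R k * R k ^ n"
        using R_ge_k[of k] R_pos[of k] by (intro mult_mono) (auto simp: real_d)
      finally have "real (C (Suc k)) * norm z \<le> (12 * R k * R k ^ n) * (6 * R k)"
        using z R_pos[of k] by (intro mult_mono) auto
      also have "\<dots> = 72 * R k ^ (n + 2)" by (simp add: power_add power2_eq_square mult_ac)
      finally have "1 + real (C (Suc k)) * norm z \<le> 73 * R k ^ (n + 2)"
        using one_le_power[of "R k" "n + 2"] R_ge[of k] by linarith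
      also have "\<dots> \<le> R k * R k ^ (n + 2)" using R_ge[of k] by (intro mult_right_mono) auto
      also have "\<dots> = R k ^ (n + 3)" by (simp add: eval_nat_numeral)
      also have "\<dots> \<le> (2 * R k) ^ (n + 3)" using R_pos[of k] by (intro power_mono) auto
      also have "\<dots> \<le> (2 * R k) ^ K" using R_ge[of k] K by (intro power_increasing) auto
      finally show "1 + real (C (Suc k)) * norm z \<le> (2 * R k) ^ K" .
    qed
    finally show "norm (\<psi> z) \<le> exp ((2 * R k) ^ K)" using b(3) by linarith
  qed
qed

end

theorem theorem1p7:
  fixes n :: nat and l :: real
  assumes "n > 0" and "0 \<le> l" and "l \<le> real n"
  shows "\<exists>A f1 f2 :: complex \<Rightarrow> complex.
    A holomorphic_on UNIV \<and> growth_order A = ereal (real n) \<and>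
    normalized_solutions A f1 f2 \<and>
    bank_laine (\<lambda>z. f1 z * f2 z) \<and>
    zero_exponent f1 = ereal l \<and> zero_exponent f2 = \<infinity> \<and>
    (\<forall>c::complex.
       bank_laine (\<lambda>z. f1 z * (c * f1 z + f2 z)) \<and>
       zero_exponent (\<lambda>z. f1 z * (c * f1 z + f2 z)) = \<infinity>)"
proof -
  interpret lacunary_riccati n l by unfold_locales (use assms in auto)
  obtain f1 A where f1: "f1 holomorphic_on UNIV" and A: "A holomorphic_on UNIV"
    and f1_zero: "\<And>z. f1 z = 0 \<longleftrightarrow> z \<in> Z" and df1: "\<And>z. z \<notin> Z \<Longrightarrow> deriv f1 z = \<psi> z * f1 z"
    and simple: "\<And>z. z \<in> Z \<Longrightarrow> deriv f1 z \<noteq> 0"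
    and ode1: "\<And>z. deriv (deriv f1) z + A z * f1 z = 0"
    and A_eq: "\<And>z. z \<notin> Z \<Longrightarrow> A z = - (deriv \<psi> z + (\<psi> z)\<^sup>2)"
    using logarithmic_derivative_realization[OF infinite_Z finite_Z_cball zero_notin_Z \<psi>_holo \<psi>_pole]
    by metis
  have "f1 0 \<noteq> 0" using f1_zero zero_notin_Z by blast
  then obtain f2 where f2: "f2 holomorphic_on UNIV"
    and ode2: "\<And>z. deriv (deriv f2) z + A z * f2 z = 0"
    and W: "\<And>z. f1 z * deriv f2 z - deriv f1 z * f2 z = 1"
    using exists_normalized_solution[OF A f1 _ ode1] by metis
  have exp1: "zero_exponent f1 = ereal l" by (rule zero_exponent_eq[OF f1 f1_zero simple])
  define g where "g = (\<lambda>c z. c * f1 z + f2 z)"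
  have g: "g c holomorphic_on UNIV" for c
    unfolding g_def by (intro holomorphic_intros f1 f2)
  have Wg: "f1 z * deriv (g c) z - deriv f1 z * g c z = 1" for c z
  proof -
    have "deriv (g c) z = c * deriv f1 z + deriv f2 z"
      unfolding g_def using f1 f2
      by (intro DERIV_imp_deriv) (auto intro!: derivative_eq_intros holomorphic_derivI[of _ UNIV])
    thus ?thesis using W[of z] by (simp add: g_def algebra_simps)
  qed
  define E where "E = (\<lambda>c z. f1 z * g c z)"
  have E: "E c holomorphic_on UNIV" for c unfolding E_def by (intro holomorphic_intros f1 g)
  note dE = wronskian_1_product[OF f1 g Wg, folded E_def]
  have dE': "deriv (E c) z = 1 + 2 * deriv f1 z * g c z" for c z
    using dE(1)[of c z] by (simp add: E_def)
  have BL: "E c z = 0 \<Longrightarrow> deriv (E c) z = 1 \<or> deriv (E c) z = -1" for c z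
    using dE(2)[of z c] by (simp add: E_def)
  have E_simple: "E c z = 0 \<Longrightarrow> deriv (E c) z \<noteq> 0" for c z using BL[of c z] by auto
  have g_simple: "g c z = 0 \<Longrightarrow> deriv (g c) z \<noteq> 0" for c z by (rule dE(3))
  have no_bound: False
    if bound: "\<And>r. r \<ge> r0 \<Longrightarrow> real (card {z. norm z \<le> r \<and> E c z = 0}) \<le> r ^ K" for c r0 K
  proof (rule riccati_zeros_not_polynomially_bounded[OF E E_simple])
    define K' where "K' = max K (n + 3)"
    show "f1 z * deriv (E c) z = f1 z + 2 * deriv f1 z * E c z" for z
      unfolding dE' by (simp add: E_def algebra_simps)
    show "\<exists>R\<ge>R0. \<forall>z. R \<le> norm z \<longrightarrow> norm z \<le> 3 * R \<longrightarrow> f1 z \<noteq> 0 \<and>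
           exp (R/4) \<le> norm (deriv f1 z / f1 z) \<and> norm (deriv f1 z / f1 z) \<le> exp (R ^ K')" for R0
    proof -
      have "deriv f1 z / f1 z = \<psi> z" if "z \<notin> Z" for z
        using df1[OF that] f1_zero[of z] that by simp
      thus ?thesis using \<psi>_annuli[of K' R0] f1_zero by (simp add: K'_def) metis
    qed
    show "real (card {z. norm z \<le> r \<and> E c z = 0}) \<le> r ^ K'" if "r \<ge> max r0 1" for r
    proof -
      have "r ^ K \<le> r ^ K'" using that by (intro power_increasing) (auto simp: K'_def)
      thus ?thesis using bound[of r] that by simp
    qed
  qed
  have expE: "zero_exponent (E c) = \<infinity>" for c
  proof (rule ccontr)
    assume "zero_exponent (E c) \<noteq> \<infinity>"
    then obtain K r0 where "\<forall>r\<ge>r0. real (zero_count (E c) r) \<le> r ^ K"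
      using zero_exponent_finite_imp_power_bound by blast
    thus False using no_bound[of r0 c K] zero_count_simple[OF E E_simple] by simp
  qed
  have exp2: "zero_exponent f2 = \<infinity>"
  proof (rule ccontr)
    have g0: "g 0 = f2" by (simp add: g_def)
    assume "zero_exponent f2 \<noteq> \<infinity>"
    then obtain K2 r2 where b2: "\<forall>r\<ge>r2. real (zero_count f2 r) \<le> r ^ K2"
      using zero_exponent_finite_imp_power_bound by blast
    obtain K1 r1 where b1: "\<forall>r\<ge>r1. real (zero_count f1 r) \<le> r ^ K1"
      using zero_exponent_finite_imp_power_bound[of f1] exp1 by auto
    show False
    proof (rule no_bound[of "max 2 (max r1 r2)" 0 "Suc (max K1 K2)"])
      fix r :: real assume r: "max 2 (max r1 r2) \<le> r"
      have c1: "zero_count f1 r = card {z. norm z \<le> r \<and> f1 z = 0}"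
        by (rule zero_count_simple[OF f1]) (use f1_zero simple in blast)
      have c2: "zero_count f2 r = card {z. norm z \<le> r \<and> f2 z = 0}"
        using zero_count_simple[OF g[of 0] g_simple] by (simp add: g0)
      have "{z. norm z \<le> r \<and> E 0 z = 0} = {z. norm z \<le> r \<and> f1 z = 0} \<union> {z. norm z \<le> r \<and> f2 z = 0}"
        by (auto simp: E_def g0)
      hence "card {z. norm z \<le> r \<and> E 0 z = 0} \<le> zero_count f1 r + zero_count f2 r"
        unfolding c1 c2 by (simp add: card_Un_le)
      hence "real (card {z. norm z \<le> r \<and> E 0 z = 0}) \<le> real (zero_count f1 r) + real (zero_count f2 r)"
        by (simp flip: of_nat_add)
      also have "\<dots> \<le> r ^ K1 + r ^ K2" using b1 b2 r by (intro add_mono) auto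
      also have "\<dots> \<le> r ^ max K1 K2 + r ^ max K1 K2"
        using r by (intro add_mono power_increasing) auto
      also have "\<dots> \<le> r * r ^ max K1 K2" using r mult_right_mono[of 2 r "r ^ max K1 K2"] by simp
      finally show "real (card {z. norm z \<le> r \<and> E 0 z = 0}) \<le> r ^ Suc (max K1 K2)" by simp
    qed
  qed
  have indep: "a = 0 \<and> b = 0" if ab: "\<forall>z. a * f1 z + b * f2 z = 0" for a b
  proof -
    have eq: "(\<lambda>z. a * f1 z + b * f2 z) = (\<lambda>_. 0)" using ab by auto
    have "((\<lambda>z. a * f1 z + b * f2 z) has_field_derivative (a * deriv f1 0 + b * deriv f2 0)) (at 0)"
      using f1 f2 by (auto intro!: derivative_eq_intros holomorphic_derivI[of _ UNIV])
    hence d0: "a * deriv f1 0 + b * deriv f2 0 = 0"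
      unfolding eq using DERIV_unique DERIV_const by blast
    have v0: "a * f1 0 + b * f2 0 = 0" using ab by blast
    have "a * 1 = (a * f1 0 + b * f2 0) * deriv f2 0 - (a * deriv f1 0 + b * deriv f2 0) * f2 0"
      unfolding W[of 0, symmetric] by (simp add: algebra_simps)
    moreover have "b * 1 = (a * deriv f1 0 + b * deriv f2 0) * f1 0 - (a * f1 0 + b * f2 0) * deriv f1 0"
      unfolding W[of 0, symmetric] by (simp add: algebra_simps)
    ultimately show ?thesis unfolding d0 v0 by simp
  qed
  have BL': "bank_laine (E c)" for c using E BL by (simp add: bank_laine_def)
  have norm_sol: "normalized_solutions A f1 f2"
    unfolding normalized_solutions_def solves_def using f1 f2 ode1 ode2 W indep by blast
  have order_A: "growth_order A = ereal (real n)" by (rule growth_order_A[OF A A_eq])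
  have E_eq: "(\<lambda>z. f1 z * (c * f1 z + f2 z)) = E c" for c by (simp add: E_def g_def)
  have E0_eq: "(\<lambda>z. f1 z * f2 z) = E 0" by (simp add: E_def g_def)
  show ?thesis
  proof (intro exI[of _ A] exI[of _ f1] exI[of _ f2], unfold E_eq E0_eq)
    show "A holomorphic_on UNIV \<and> growth_order A = ereal (real n) \<and> normalized_solutions A f1 f2 \<and>
      bank_laine (E 0) \<and> zero_exponent f1 = ereal l \<and> zero_exponent f2 = \<infinity> \<and>
      (\<forall>c. bank_laine (E c) \<and> zero_exponent (E c) = \<infinity>)"
      using A order_A norm_sol BL' exp1 exp2 expE by blast
  qed
qed

end
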